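(* Let $P\subset\mathbb{R}^3$ be a generic simple convex polytope. If $P$ has at least one nice vertex, then $\mathcal{N}(P)\ge 10$.
   Context: Polytopes are compact, convex, with non-empty interior. For $y\in\mathrm{Int}\,P$, a normal to $\partial P$ emanating from $y$ is a segment $yz$ such that some support plane $h$ of $P$ satisfies $z\in h\cap P$ and $yz\perp h$. $n(P,y)$ is the number of normals emanating from $y$, and $\mathcal{N}(P)=\max_{y\in\mathrm{Int}\,P}n(P,y)$. $P\subset\mathbb{R}^3$ is simple if each vertex has exactly three emanating edges. Active regions and sheets: for a face $F$ of $P$ (vertex, edge or facet), let $o$ be a point in the relative interior of $F$ and $\mathrm{Cone}(F)=\{x\in\mathbb{R}^3:\langle p-o,x\rangle\ge0\ \forall p\in P\}$ (independent of $o$). The active region of $F$ is $\mathcal{AR}(F)=(\mathrm{Cone}(F)+F)\cap P$. The bifurcation set $\mathcal{B}(P)$ is the union of the boundaries of all active regions. Its linear pieces not lying on $\partial P$ are called sheets: the blue sheets are the side walls of the active regions of facets (i.e. for an edge $E$ of a facet $F$, the set $(E+\mathrm{Cone}(F))\cap P$), and the red sheets are the walls of the active regions of vertices (i.e. for an endpoint $V$ of an edge $E$, the set $(V+\mathrm{Cone}(E))\cap P$). A simple polytope $P\subset\mathbb{R}^3$ is generic if (i) no dihedral angle at an edge and no planar angle of a facet (angle of a facet at a vertex) is right, and (ii) the sheets of $\mathcal{B}(P)$ intersect (pairwise) transversally. Spherical triangles: a spherical triangle is a triangle with geodesic edges in the standard unit sphere $S^2$ contained in an open hemisphere. $|XY|$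 is spherical distance. A point $X\in S^2$ projects to a geodesic segment $s$ if $s$ and $X$ fit in an open hemisphere and $s$ contains a point $W$ such that the geodesic segment $XW$ is orthogonal to $s$ and $|XW|$ is the distance from $X$ to $s$. A spherical triangle $ABC$ is nice if there is a point $X$ in its interior such that (a) $X$ projects to all three edges of the triangle, and (b) $|XA|<\pi/2$, $|XB|<\pi/2$, $|XC|<\pi/2$. For a vertex $V$ of a simple polytope $P$, $Tr(V)$ is the spherical triangle obtained as the intersection of $P$ with a small sphere centered at $V$, rescaled to have unit radius. The vertex $V$ is nice if $Tr(V)$ is a nice triangle. *)

theory Defs
  imports "HOL-Analysis.Analysis"
begin

definition vangle :: "real^3 \<Rightarrow> real^3 \<Rightarrow> real" where
  "vangle u v = arccos (u \<bullet> v / (norm u * norm v))"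

definition dir_space :: "(real^3) set \<Rightarrow> (real^3) set" where
  "dir_space S = span {x - y | x y. x \<in> S \<and> y \<in> S}"


section \<open>Normals\<close>

text \<open>\<open>{x. a \<bullet> x = b}\<close> is the support plane \<open>h\<close>. A normal from \<open>y\<close> is the segment \<open>yz\<close>; for
  fixed \<open>y\<close> it is determined by its foot \<open>z\<close>, so normals are counted by their feet.\<close>

definition is_normal :: "(real^3) set \<Rightarrow> real^3 \<Rightarrow> real^3 \<Rightarrow> bool" where
  "is_normal P y z \<longleftrightarrow>
     (\<exists>a b. a \<noteq> 0 \<and> (\<forall>x\<in>P. a \<bullet> x \<le> b) \<and> z \<in> P \<and> a \<bullet> z = b \<and> (\<exists>c. z - y = c *\<^sub>R a))"

definition normal_count :: "(real^3) set \<Rightarrow> real^3 \<Rightarrow> nat" where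
  "normal_count P y = card {z. is_normal P y z}"

definition max_normals :: "(real^3) set \<Rightarrow> nat" where
  "max_normals P = Max (normal_count P ` interior P)"


section \<open>Generic simple polytopes\<close>

definition simple_polytope :: "(real^3) set \<Rightarrow> bool" where
  "simple_polytope P \<longleftrightarrow> polytope P \<and> interior P \<noteq> {} \<and>
     (\<forall>v. v extreme_point_of P \<longrightarrow> card {E. E edge_of P \<and> v \<in> E} = 3)"

definition face_cone :: "(real^3) set \<Rightarrow> (real^3) set \<Rightarrow> (real^3) set" where
  "face_cone P F = {x. \<forall>c\<in>rel_interior F. \<forall>p\<in>P. (p - c) \<bullet> x \<ge> 0}"

text \<open>The cone is already determined by a single point of the relative interior.\<close>

lemma face_cone_eq:
  assumes F: "F face_of P" and c: "c \<in> rel_interior F"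
  shows "face_cone P F = {x. \<forall>p\<in>P. (p - c) \<bullet> x \<ge> 0}"
proof
  show "face_cone P F \<subseteq> {x. \<forall>p\<in>P. (p - c) \<bullet> x \<ge> 0}"
    using c by (auto simp: face_cone_def)
next
  have FP: "F \<subseteq> P" and cF: "convex F"
    using F face_of_imp_subset face_of_imp_convex by auto
  have "(p - c') \<bullet> x \<ge> 0"
    if x: "\<forall>p\<in>P. (p - c) \<bullet> x \<ge> 0" and c': "c' \<in> rel_interior F" and p: "p \<in> P" for x c' p
  proof -
    have c'F: "c' \<in> F" using c' rel_interior_subset by auto
    obtain e where e: "e > 1" "(1 - e) *\<^sub>R c' + e *\<^sub>R c \<in> F"
      using convex_rel_interior_if2[OF cF c] c'F hull_subset by (metis in_mono less_add_one)
    have "((1 - e) *\<^sub>R c' + e *\<^sub>R c - c) \<bullet> x \<ge> 0" using x e FP by auto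
    then have "(e - 1) * ((c - c') \<bullet> x) \<ge> 0" by (simp add: algebra_simps)
    then have "(c - c') \<bullet> x \<ge> 0" using e by (simp add: zero_le_mult_iff)
    moreover have "(p - c) \<bullet> x \<ge> 0" using x p by auto
    ultimately show ?thesis by (simp add: inner_diff_left)
  qed
  then show "{x. \<forall>p\<in>P. (p - c) \<bullet> x \<ge> 0} \<subseteq> face_cone P F"
    by (auto simp: face_cone_def)
qed

definition active_region :: "(real^3) set \<Rightarrow> (real^3) set \<Rightarrow> (real^3) set" where
  "active_region P F = {f + x | f x. f \<in> F \<and> x \<in> face_cone P F} \<inter> P"

definition bifurcation_set :: "(real^3) set \<Rightarrow> (real^3) set" where
  "bifurcation_set P = (\<Union>F \<in> {F. F face_of P \<and> F \<noteq> {} \<and> F \<noteq> P}. frontier (active_region P F))"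

definition sheet :: "(real^3) set \<Rightarrow> (real^3) set \<times> (real^3) set \<Rightarrow> (real^3) set" where
  "sheet P = (\<lambda>(G, F). {g + x | g x. g \<in> G \<and> x \<in> face_cone P F} \<inter> P)"

lemma face_cone_orthogonal:
  assumes P: "F face_of P" and x: "x \<in> face_cone P F" and d: "d \<in> dir_space F" and ne: "F \<noteq> {}"
  shows "d \<bullet> x = 0"
proof -
  have FP: "F \<subseteq> P" and cF: "convex F"
    using P face_of_imp_subset face_of_imp_convex by auto
  obtain c where c: "c \<in> rel_interior F" using ne cF rel_interior_eq_empty by auto
  have "(f - c) \<bullet> x = 0" if f: "f \<in> F" for f
  proof -
    obtain e where e: "e > 1" "(1 - e) *\<^sub>R f + e *\<^sub>R c \<in> F"
      using convex_rel_interior_if2[OF cF c] f hull_subset by (metis in_mono less_add_one)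
    have "((1 - e) *\<^sub>R f + e *\<^sub>R c - c) \<bullet> x \<ge> 0"
      using x e FP c by (auto simp: face_cone_def)
    then have "(e - 1) * ((c - f) \<bullet> x) \<ge> 0" by (simp add: algebra_simps)
    then have "(c - f) \<bullet> x \<ge> 0" using e by (simp add: zero_le_mult_iff)
    moreover have "(f - c) \<bullet> x \<ge> 0" using x f FP c by (auto simp: face_cone_def)
    ultimately show ?thesis by (simp add: inner_diff_left)
  qed
  then have "s \<bullet> x = 0" if "s \<in> {x - y | x y. x \<in> F \<and> y \<in> F}" for s
    using that by (force simp: inner_diff_left)
  moreover have "subspace {d. d \<bullet> x = 0}"
    by (simp add: subspace_def inner_add_left)
  ultimately have "span {x - y | x y. x \<in> F \<and> y \<in> F} \<subseteq> {d. d \<bullet> x = 0}"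
    by (intro span_minimal) auto
  then show ?thesis using d by (auto simp: dir_space_def)
qed

text \<open>Every sheet lies in the boundary of an active region.\<close>

lemma sheet_subset_bifurcation_set:
  assumes F: "F face_of P" "F \<noteq> P" and G: "G face_of F" "G \<noteq> F"
  shows "sheet P (G, F) \<subseteq> bifurcation_set P"
proof
  fix w assume "w \<in> sheet P (G, F)"
  then obtain g x where w: "w = g + x" "g \<in> G" "x \<in> face_cone P F" "w \<in> P"
    by (auto simp: sheet_def)
  have cF: "convex F" using F face_of_imp_convex by auto
  have gF: "g \<in> F" using w G face_of_imp_subset by auto
  then have ne: "F \<noteq> {}" by auto
  have "g \<notin> rel_interior F" using face_of_disjoint_rel_interior[OF G] w by auto
  then obtain a where a: "\<And>y. y \<in> F \<Longrightarrow> a \<bullet> g \<le> a \<bullet> y"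
      "\<And>y. y \<in> rel_interior F \<Longrightarrow> a \<bullet> g < a \<bullet> y"
    using supporting_hyperplane_rel_boundary[OF cF gF] by metis
  obtain p q where pq: "p \<in> span (dir_space F)" "\<And>v. v \<in> span (dir_space F) \<Longrightarrow> orthogonal q v"
      "a = p + q"
    by (metis orthogonal_subspace_decomp_exists)
  have sp: "span (dir_space F) = dir_space F" by (simp add: dir_space_def span_span)
  have eq: "p \<bullet> (y - g) = a \<bullet> (y - g)" if "y \<in> F" for y
  proof -
    have "y - g \<in> dir_space F" unfolding dir_space_def using that gF by (intro span_base) auto
    then show ?thesis using pq sp by (simp add: inner_add_left orthogonal_def)
  qed
  obtain c where c: "c \<in> rel_interior F" using ne cF rel_interior_eq_empty by auto
  then have "c \<in> F" using rel_interior_subset by blast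
  then have "p \<noteq> 0" using eq[of c] a(2)[OF c] by (auto simp: inner_diff_right)
  have low: "p \<bullet> w \<le> p \<bullet> u" if uA: "u \<in> active_region P F" for u
  proof -
    obtain f t where u: "u = f + t" "f \<in> F" "t \<in> face_cone P F"
      using uA by (auto simp: active_region_def)
    have "p \<bullet> t = 0" "p \<bullet> x = 0"
      using face_cone_orthogonal[OF F(1) _ _ ne] u w pq sp by auto
    moreover have "p \<bullet> (f - g) \<ge> 0" using eq a(1) u by (simp add: inner_diff_right)
    ultimately show ?thesis using u w by (simp add: inner_add_right inner_diff_right)
  qed
  have "w \<notin> interior (active_region P F)"
  proof
    assume "w \<in> interior (active_region P F)"
    then have "w \<in> interior {u. p \<bullet> u \<ge> p \<bullet> w}"
      using interior_mono[of "active_region P F" "{u. p \<bullet> u \<ge> p \<bullet> w}"] low by auto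
    then show False using \<open>p \<noteq> 0\<close> by (simp add: interior_halfspace_ge)
  qed
  moreover have "w \<in> active_region P F" using w gF by (auto simp: active_region_def)
  ultimately have "w \<in> frontier (active_region P F)"
    using closure_subset by (auto simp: frontier_def)
  then show "w \<in> bifurcation_set P" using F ne by (auto simp: bifurcation_set_def)
qed

definition blue_flags :: "(real^3) set \<Rightarrow> ((real^3) set \<times> (real^3) set) set" where
  "blue_flags P = {(E, F). F facet_of P \<and> E edge_of F}"

definition red_flags :: "(real^3) set \<Rightarrow> ((real^3) set \<times> (real^3) set) set" where
  "red_flags P = {({v}, E) | v E. E edge_of P \<and> v extreme_point_of E}"

text \<open>Sheets are indexed by the flags producing them, so that two sheets that happen to coincide
  as point sets still count as a (non-transversal) pair. A candidate that lies in the boundary of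
  the polytope (it may even degenerate to an edge or a vertex) is not a sheet.\<close>

definition sheet_flags :: "(real^3) set \<Rightarrow> ((real^3) set \<times> (real^3) set) set" where
  "sheet_flags P = {f \<in> blue_flags P \<union> red_flags P. \<not> sheet P f \<subseteq> frontier P}"

text \<open>Sheets are flat, so the tangent space at each of their points is the direction space.\<close>

definition transversal :: "(real^3) set \<Rightarrow> (real^3) set \<Rightarrow> bool" where
  "transversal S T \<longleftrightarrow>
     (\<forall>x \<in> S \<inter> T. {u + v | u v. u \<in> dir_space S \<and> v \<in> dir_space T} = UNIV)"

text \<open>For an edge \<open>E\<close> of a polygon \<open>F\<close>: the unit vector in the plane of \<open>F\<close> that is orthogonal to \<open>E\<close>
  (take \<open>x\<close>, \<open>g\<close> both in \<open>E\<close> below) and points into \<open>F\<close>. A dihedral angle is measured between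
  two such vectors.\<close>

definition inward_normal :: "(real^3) set \<Rightarrow> (real^3) set \<Rightarrow> real^3 \<Rightarrow> bool" where
  "inward_normal E F u \<longleftrightarrow> u \<in> dir_space F \<and> norm u = 1 \<and> (\<forall>x\<in>F. \<forall>g\<in>E. u \<bullet> (x - g) \<ge> 0)"

definition is_dihedral_angle :: "(real^3) set \<Rightarrow> (real^3) set \<Rightarrow> real \<Rightarrow> bool" where
  "is_dihedral_angle P E \<theta> \<longleftrightarrow>
     (\<exists>F F' u u'. F facet_of P \<and> F' facet_of P \<and> F \<noteq> F' \<and> E edge_of F \<and> E edge_of F' \<and>
        inward_normal E F u \<and> inward_normal E F' u' \<and> \<theta> = vangle u u')"

definition is_planar_angle :: "(real^3) set \<Rightarrow> real^3 \<Rightarrow> real \<Rightarrow> bool" where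
  "is_planar_angle F v \<theta> \<longleftrightarrow>
     (\<exists>a b. a \<noteq> b \<and> closed_segment v a edge_of F \<and> closed_segment v b edge_of F \<and>
        \<theta> = vangle (a - v) (b - v))"

definition generic_polytope :: "(real^3) set \<Rightarrow> bool" where
  "generic_polytope P \<longleftrightarrow> simple_polytope P \<and>
     (\<forall>E. E edge_of P \<longrightarrow> \<not> is_dihedral_angle P E (pi/2)) \<and>
     (\<forall>F v. F facet_of P \<and> v extreme_point_of F \<longrightarrow> \<not> is_planar_angle F v (pi/2)) \<and>
     pairwise (\<lambda>f g. transversal (sheet P f) (sheet P g)) (sheet_flags P)"


section \<open>Nice spherical triangles and nice vertices\<close>

definition sph_dist :: "real^3 \<Rightarrow> real^3 \<Rightarrow> real" where
  "sph_dist x y = arccos (x \<bullet> y)"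

definition in_open_hemisphere :: "(real^3) set \<Rightarrow> bool" where
  "in_open_hemisphere S \<longleftrightarrow> S \<subseteq> sphere 0 1 \<and> (\<exists>h. \<forall>x\<in>S. h \<bullet> x > 0)"

text \<open>Spherical convex hull, by central projection: for points in an open hemisphere, two points
  yield their geodesic segment and three points the triangle they span.\<close>

definition sph_hull :: "(real^3) set \<Rightarrow> (real^3) set" where
  "sph_hull S = (\<lambda>x. x /\<^sub>R norm x) ` (convex hull S)"

definition is_sph_triangle :: "real^3 \<Rightarrow> real^3 \<Rightarrow> real^3 \<Rightarrow> bool" where
  "is_sph_triangle A B C \<longleftrightarrow>
     in_open_hemisphere {A, B, C} \<and> distinct [A, B, C] \<and> independent {A, B, C}"

text \<open>\<open>X - (X \<bullet> W) *\<^sub>R W\<close> is tangent at \<open>W\<close> to the geodesic \<open>WX\<close>, and the vectors \<open>t\<close> are the tangent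
  vectors at \<open>W\<close> of the great circle carrying the segment \<open>s\<close>.\<close>

definition projects_to :: "real^3 \<Rightarrow> (real^3) set \<Rightarrow> bool" where
  "projects_to X s \<longleftrightarrow> in_open_hemisphere (insert X s) \<and>
     (\<exists>W\<in>s. (\<forall>t\<in>span s. t \<bullet> W = 0 \<longrightarrow> (X - (X \<bullet> W) *\<^sub>R W) \<bullet> t = 0) \<and>
            (\<forall>Z\<in>s. sph_dist X W \<le> sph_dist X Z))"

definition nice_triangle :: "real^3 \<Rightarrow> real^3 \<Rightarrow> real^3 \<Rightarrow> bool" where
  "nice_triangle A B C \<longleftrightarrow> is_sph_triangle A B C \<and>
     (\<exists>X \<in> top_of_set (sphere 0 1) interior_of sph_hull {A, B, C}.
        projects_to X (sph_hull {A, B}) \<and> projects_to X (sph_hull {B, C}) \<and>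
        projects_to X (sph_hull {C, A}) \<and>
        sph_dist X A < pi/2 \<and> sph_dist X B < pi/2 \<and> sph_dist X C < pi/2)"

definition sphere_section :: "(real^3) set \<Rightarrow> real^3 \<Rightarrow> real \<Rightarrow> (real^3) set" where
  "sphere_section P v \<epsilon> = (\<lambda>x. (x - v) /\<^sub>R \<epsilon>) ` (P \<inter> sphere v \<epsilon>)"

definition nice_vertex :: "(real^3) set \<Rightarrow> real^3 \<Rightarrow> bool" where
  "nice_vertex P v \<longleftrightarrow> v extreme_point_of P \<and>
     (\<exists>A B C. nice_triangle A B C \<and>
        (\<forall>\<^sub>F \<epsilon> in at_right 0. sphere_section P v \<epsilon> = sph_hull {A, B, C}))"

end

theory Submission
  imports Defs
begin

text \<open>Call \<open>z\<close> a foot of \<open>y\<close> if \<open>z - y\<close> is an outer normal of \<open>P\<close> at \<open>z\<close>; for \<open>y\<close> in the interior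
  the feet are \<open>y\<close> itself and the feet of the normals. A foot lies in the relative interior of one
  face \<open>F\<close>, and \<open>z - y\<close> exposes a face \<open>G \<supseteq> F\<close>; generically \<open>F = G\<close>, and the points \<open>y\<close> with such a
  foot form an open cell attached to \<open>F\<close> (the interior of its active region). Along a generic ray
  only pairs \<open>F \<subset> G\<close> of consecutive dimensions degenerate, and then the cells of \<open>F\<close> and \<open>G\<close> are
  entered or left simultaneously. As there is exactly one foot far away, the number of feet is odd
  for almost every \<open>y\<close>.

  Near a nice vertex \<open>V\<close> the cells of the eight faces at \<open>V\<close> (including \<open>P\<close>) and of the vertex \<open>W\<close>
  farthest from \<open>V\<close> have a point in common. Follow a generic ray from \<open>V\<close> until one of these nine
  cells is left. Its degenerate partner cannot be one of the nine: the feet in the eight faces move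
  along distinct rays from \<open>V\<close>, and \<open>W\<close> being farthest from \<open>V\<close> excludes a pair containing \<open>W\<close>.
  So a tenth cell was present just before, giving ten feet, hence by parity eleven, one of which is
  the point itself.\<close>

section \<open>Feet and cells\<close>

text \<open>For an interior point, the feet other than the point itself are critical points of the
  distance to it on the boundary. Parity replaces the Euler characteristic of Morse theory: only the
  birth and death of feet in pairs matters, not their indices. Two kinds of ray occur. The one that
  yields the tenth cell starts at \<open>V\<close>, where the faces at \<open>V\<close> degenerate
  all at once, so genericity is demanded at positive times only. The parity ray starts at a point
  without degenerate feet. The point found in ten cells may well have a degenerate foot elsewhere;
  as cells are open, it can be moved off a null set. This is why cells of faces are tracked rather
  than feet. The eight cells at \<open>V\<close> come from linear algebra: the cone at
  \<open>V\<close> has \<open>2 ^ 3\<close> faces, and a direction \<open>X\<close> serves if its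
  projection to the span of each of them lies in its relative interior and the residual has the
  right signs. Niceness gives some of these inequalities only weakly, since the nearest point of an
  edge of the triangle may be an endpoint. Making them strict simultaneously is the obstacle behind
  the perturbation of \<open>X\<close>.\<close>

definition foot :: "'a::euclidean_space set \<Rightarrow> 'a \<Rightarrow> 'a \<Rightarrow> bool" where
  "foot P y z \<longleftrightarrow> z \<in> P \<and> (\<forall>x\<in>P. (z - y) \<bullet> (x - z) \<le> 0)"

text \<open>For \<open>z = y\<close> this is all of \<open>P\<close>, so \<open>P\<close> counts
  among the faces and has a cell of its own.\<close>

definition top_face :: "'a::euclidean_space set \<Rightarrow> 'a \<Rightarrow> 'a \<Rightarrow> 'a set" where
  "top_face P y z = {x \<in> P. (z - y) \<bullet> (x - z) = 0}"

definition open_cell :: "'a::euclidean_space set \<Rightarrow> 'a set \<Rightarrow> 'a set" where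
  "open_cell P F = {y. \<exists>z\<in>rel_interior F. foot P y z \<and> top_face P y z = F}"

text \<open>Only conditions that survive limits are kept: the foot may lie on the relative boundary
  of \<open>F\<close>, and the exposed face may be larger than \<open>F\<close>.\<close>

definition closed_cell :: "'a::euclidean_space set \<Rightarrow> 'a set \<Rightarrow> 'a set" where
  "closed_cell P F = {y. \<exists>z\<in>F. foot P y z \<and> F \<subseteq> top_face P y z}"

text \<open>\<open>dir_space\<close> for arbitrary Euclidean spaces, as the counting argument works
  in every dimension.\<close>

definition dirs :: "'a::euclidean_space set \<Rightarrow> 'a set" where
  "dirs F = span {x - y | x y. x \<in> F \<and> y \<in> F}"

section \<open>Direction spaces of faces\<close>

lemma subspace_dirs [simp]: "subspace (dirs F)"
  by (simp add: dirs_def)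

lemma diff_in_dirs: "x \<in> F \<Longrightarrow> y \<in> F \<Longrightarrow> x - y \<in> dirs F"
  unfolding dirs_def by (rule span_base) auto

lemma dirs_mono: "F \<subseteq> G \<Longrightarrow> dirs F \<subseteq> dirs G"
  unfolding dirs_def by (rule span_mono) auto

lemma orthogonal_dirsI:
  assumes "\<And>x y. x \<in> F \<Longrightarrow> y \<in> F \<Longrightarrow> n \<bullet> (x - y) = 0" and "d \<in> dirs F"
  shows "n \<bullet> d = 0"
proof -
  have "dirs F \<subseteq> {d. n \<bullet> d = 0}"
    unfolding dirs_def
    by (rule span_minimal) (use assms in \<open>auto simp: subspace_def inner_add_right\<close>)
  then show ?thesis using assms(2) by auto
qed

lemma dirs_eq_span_diffs:
  assumes "z \<in> F"
  shows "dirs F = span ((\<lambda>x. x - z) ` F)"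
proof
  have "x - y \<in> span ((\<lambda>x. x - z) ` F)" if "x \<in> F" "y \<in> F" for x y
  proof -
    have "(x - z) - (y - z) \<in> span ((\<lambda>x. x - z) ` F)"
      using that by (intro span_diff span_base) auto
    then show ?thesis by simp
  qed
  then show "dirs F \<subseteq> span ((\<lambda>x. x - z) ` F)"
    unfolding dirs_def by (intro span_minimal) auto
  show "span ((\<lambda>x. x - z) ` F) \<subseteq> dirs F"
    by (rule span_minimal) (use assms in \<open>auto intro: diff_in_dirs\<close>)
qed

lemma dim_dirs:
  assumes "F \<noteq> {}"
  shows "int (dim (dirs F)) = aff_dim F"
proof -
  obtain z where z: "z \<in> F" using assms by auto
  then show ?thesis
    by (simp add: dirs_eq_span_diffs[OF z] aff_dim_eq_dim_subtract[OF hull_inc[OF z]])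
qed

lemma dirs_decomp:
  obtains p q where "w = p + q" "p \<in> dirs F" "\<And>d. d \<in> dirs F \<Longrightarrow> q \<bullet> d = 0"
    "norm p \<le> norm w" "norm q \<le> norm w"
proof -
  obtain p q where pq: "p \<in> span (dirs F)" "\<And>v. v \<in> span (dirs F) \<Longrightarrow> orthogonal q v" "w = p + q"
    by (metis orthogonal_subspace_decomp_exists)
  have sp: "span (dirs F) = dirs F" by (simp add: dirs_def span_span)
  have "(norm w)\<^sup>2 = (norm p)\<^sup>2 + (norm q)\<^sup>2"
    using pq by (metis norm_add_Pythagorean orthogonal_commute)
  then have "norm p \<le> norm w" "norm q \<le> norm w"
    by (simp_all add: power2_le_imp_le)
  then show ?thesis
    using that pq sp by (auto simp: orthogonal_def)
qed

lemma add_dirs_in_affine_hull: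
  assumes "z \<in> F" "d \<in> dirs F"
  shows "z + d \<in> affine hull F"
proof -
  have "subspace ((\<lambda>x. - z + x) ` (affine hull F))"
    by (rule affine_diffs_subspace) (use assms hull_inc in auto)
  moreover have "(\<lambda>x. x - z) ` F \<subseteq> (\<lambda>x. - z + x) ` (affine hull F)"
    using hull_subset[of F affine] by (force simp: image_iff)
  ultimately have "dirs F \<subseteq> (\<lambda>x. - z + x) ` (affine hull F)"
    unfolding dirs_eq_span_diffs[OF assms(1)] by (rule span_minimal[rotated])
  then show ?thesis using assms(2) by auto
qed

lemma rel_interior_add_dirs:
  assumes "z \<in> rel_interior F"
  obtains \<epsilon> where "\<epsilon> > 0" "\<And>d. d \<in> dirs F \<Longrightarrow> norm d < \<epsilon> \<Longrightarrow> z + d \<in> rel_interior F"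
proof -
  have zF: "z \<in> F" using assms rel_interior_subset by blast
  obtain T where T: "open T" "rel_interior F = T \<inter> affine hull F"
    by (metis openin_rel_interior openin_open inf_commute)
  then obtain \<epsilon> where "\<epsilon> > 0" "ball z \<epsilon> \<subseteq> T"
    using assms by (metis Int_iff open_contains_ball)
  then show ?thesis
    by (intro that[of \<epsilon>]) (use T add_dirs_in_affine_hull[OF zF] in \<open>auto simp: subset_iff dist_norm\<close>)
qed

section \<open>Exposed faces and the topology of cells\<close>

lemma foot_top_face_mem: "foot P y z \<Longrightarrow> z \<in> top_face P y z"
  by (simp add: foot_def top_face_def)

lemma top_face_orthogonal:
  assumes "F \<subseteq> top_face P y z" "d \<in> dirs F"
  shows "(z - y) \<bullet> d = 0"
proof (rule orthogonal_dirsI[OF _ assms(2)])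
  fix a b assume "a \<in> F" "b \<in> F"
  then have "(z - y) \<bullet> (a - z) = 0" "(z - y) \<bullet> (b - z) = 0"
    using assms(1) by (auto simp: top_face_def)
  then show "(z - y) \<bullet> (a - b) = 0" by (simp add: inner_diff_right)
qed

text \<open>Such a foot is the orthogonal projection of \<open>y\<close> to the affine hull of
  \<open>F\<close>.\<close>

lemma foot_unique:
  assumes "z \<in> F" "F \<subseteq> top_face P y z" "z' \<in> F" "F \<subseteq> top_face P y z'"
  shows "z = z'"
proof -
  have "(z - y) \<bullet> (z - z') = 0" "(z' - y) \<bullet> (z - z') = 0"
    using assms top_face_orthogonal diff_in_dirs by metis+
  then have "(z - z') \<bullet> (z - z') = 0" by (simp add: inner_diff_left)
  then show ?thesis by simp
qed

lemma face_of_top_face: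
  assumes "convex P" "foot P y z"
  shows "top_face P y z face_of P"
proof -
  have "top_face P y z = P \<inter> {x. (z - y) \<bullet> x = (z - y) \<bullet> z}"
    by (auto simp: top_face_def inner_diff_right)
  moreover have "(P \<inter> {x. (z - y) \<bullet> x = (z - y) \<bullet> z}) face_of P"
    by (rule face_of_Int_supporting_hyperplane_le[OF assms(1)])
      (use assms(2) in \<open>auto simp: foot_def inner_diff_right\<close>)
  ultimately show ?thesis by simp
qed

lemma open_cell_subset_closed_cell: "open_cell P F \<subseteq> closed_cell P F"
  using rel_interior_subset by (fastforce simp: open_cell_def closed_cell_def)

lemma open_cell_imp_face_of:
  "convex P \<Longrightarrow> y \<in> open_cell P F \<Longrightarrow> F face_of P \<and> F \<noteq> {}"
  using face_of_top_face foot_top_face_mem by (fastforce simp: open_cell_def)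

text \<open>The pairs of foot and point that satisfy the defining conditions form a closed set, and
  its projection along the compact factor \<open>F\<close> is closed.\<close>

lemma closed_closed_cell:
  assumes "compact F" "F \<subseteq> P"
  shows "closed (closed_cell P F)"
proof -
  define T where "T = {(z, y). (\<forall>x\<in>P. (z - y) \<bullet> (x - z) \<le> 0) \<and> (\<forall>x\<in>F. (z - y) \<bullet> (x - z) = 0)}"
  have "T = (\<Inter>x\<in>P. {w. (fst w - snd w) \<bullet> (x - fst w) \<le> 0}) \<inter>
      (\<Inter>x\<in>F. {w. (fst w - snd w) \<bullet> (x - fst w) = 0})"
    by (auto simp: T_def)
  moreover have "closed \<dots>"
    by (intro closed_Int closed_INT ballI closed_Collect_le closed_Collect_eq continuous_intros)
  ultimately have "closed T" by simp
  from closed_compact_projection[OF assms(1) this]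
  have "closed {y. \<exists>z. z \<in> F \<and> (z, y) \<in> T}" .
  moreover have "closed_cell P F = {y. \<exists>z. z \<in> F \<and> (z, y) \<in> T}"
    using assms(2) by (auto simp: closed_cell_def T_def foot_def top_face_def)
  ultimately show ?thesis by simp
qed

text \<open>A minimal face through \<open>z\<close> works: if \<open>z\<close> were on its relative
  boundary, a supporting hyperplane would cut out a smaller face through \<open>z\<close>.\<close>

lemma exists_face_rel_interior:
  fixes P :: "'a::euclidean_space set"
  assumes P: "polytope P" and z: "z \<in> P"
  obtains F where "F face_of P" "z \<in> rel_interior F"
proof -
  define \<F> where "\<F> = {F. F face_of P \<and> z \<in> F}"
  have "finite \<F>" unfolding \<F>_def
    using finite_polytope_faces[OF P] by (rule rev_finite_subset) auto
  moreover have "\<F> \<noteq> {}"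
    using z P face_of_refl[OF polytope_imp_convex[OF P]] by (auto simp: \<F>_def)
  ultimately have "\<exists>F\<in>\<F>. \<forall>G\<in>\<F>. G \<subseteq> F \<longrightarrow> F = G"
    by (rule finite_has_minimal)
  then obtain F where F: "F face_of P" "z \<in> F"
      and min: "\<And>G. G face_of P \<Longrightarrow> z \<in> G \<Longrightarrow> G \<subseteq> F \<Longrightarrow> F = G"
    by (auto simp: \<F>_def)
  have cF: "convex F" using F face_of_imp_convex by auto
  have "z \<in> rel_interior F"
  proof (rule ccontr)
    assume nz: "z \<notin> rel_interior F"
    obtain a where a: "\<And>y. y \<in> F \<Longrightarrow> a \<bullet> z \<le> a \<bullet> y" "\<And>y. y \<in> rel_interior F \<Longrightarrow> a \<bullet> z < a \<bullet> y"
      using supporting_hyperplane_rel_boundary[OF cF F(2) nz] by metis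
    have "(F \<inter> {x. a \<bullet> x = a \<bullet> z}) face_of F"
      by (rule face_of_Int_supporting_hyperplane_ge[OF cF]) (use a in auto)
    then have "(F \<inter> {x. a \<bullet> x = a \<bullet> z}) face_of P"
      using F face_of_trans by blast
    then have "F = F \<inter> {x. a \<bullet> x = a \<bullet> z}"
      using F(2) by (intro min) auto
    then have sub: "F \<subseteq> {x. a \<bullet> x = a \<bullet> z}" by blast
    obtain c where c: "c \<in> rel_interior F"
      using cF F(2) rel_interior_eq_empty[OF cF] by blast
    then have "c \<in> F" using rel_interior_subset by blast
    then show False using sub a(2)[OF c] by auto
  qed
  then show ?thesis using F that by auto
qed

lemma face_subset_top_face:
  assumes "convex P" "foot P y z" "z \<in> rel_interior F" "F \<subseteq> P"
  shows "F \<subseteq> top_face P y z"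
  by (rule subset_of_face_of[OF face_of_top_face[OF assms(1,2)] assms(4)])
    (use assms(3) foot_top_face_mem[OF assms(2)] in \<open>auto simp: disjnt_iff\<close>)

text \<open>A linear functional on a hull is controlled by its values at the generators. The strict
  sign off \<open>F\<close> also identifies the exposed face, because every face of the hull is the
  hull of some of the generators.\<close>

lemma foot_convex_hullI:
  assumes "finite S" and F: "F face_of (convex hull S)" and z: "z \<in> F"
    and eq: "\<And>s. s \<in> S \<Longrightarrow> s \<in> F \<Longrightarrow> (z - y) \<bullet> (s - z) = 0"
    and lt: "\<And>s. s \<in> S \<Longrightarrow> s \<notin> F \<Longrightarrow> (z - y) \<bullet> (s - z) < 0"
  shows "foot (convex hull S) y z \<and> top_face (convex hull S) y z = F"
proof -
  have zP: "z \<in> convex hull S" using F z face_of_imp_subset by blast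
  have "convex hull S \<subseteq> {x. (z - y) \<bullet> x \<le> (z - y) \<bullet> z}"
  proof (rule hull_minimal)
    show "S \<subseteq> {x. (z - y) \<bullet> x \<le> (z - y) \<bullet> z}"
      using eq lt by (smt (verit) inner_diff_right mem_Collect_eq subsetI)
  qed (rule convex_halfspace_le)
  then have ft: "foot (convex hull S) y z"
    using zP by (auto simp: foot_def inner_diff_right)
  moreover have "top_face (convex hull S) y z = F"
  proof
    obtain S' where S': "S' \<subseteq> S" "top_face (convex hull S) y z = convex hull S'"
      using face_of_convex_hull_subset[OF finite_imp_compact[OF assms(1)] face_of_top_face[OF convex_convex_hull ft]]
      by blast
    have "S' \<subseteq> top_face (convex hull S) y z" using S' hull_subset[of S' convex] by auto
    then have "S' \<subseteq> F" using S'(1) lt by (fastforce simp: top_face_def)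
    then show "top_face (convex hull S) y z \<subseteq> F"
      using S' face_of_imp_convex[OF F] hull_minimal by metis
    obtain S'' where S'': "S'' \<subseteq> S" "F = convex hull S''"
      using face_of_convex_hull_subset[OF finite_imp_compact[OF assms(1)] F] by blast
    have "S'' \<subseteq> F" using S'' hull_subset[of S'' convex] by auto
    then have "S'' \<subseteq> top_face (convex hull S) y z"
      using S'' eq by (auto simp: top_face_def subset_iff intro: hull_inc)
    then show "F \<subseteq> top_face (convex hull S) y z"
      using S'' face_of_imp_convex[OF face_of_top_face[OF convex_convex_hull ft]] hull_minimal by metis
  qed
  ultimately show ?thesis by simp
qed

lemma eventually_nhds_0:
  "(\<forall>\<^sub>F w in nhds (0::'a::real_normed_vector). Q w) \<longleftrightarrow> (\<exists>\<delta>>0. \<forall>w. norm w < \<delta> \<longrightarrow> Q w)"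
  by (simp add: eventually_nhds_metric)

text \<open>A displacement of \<open>y\<close> splits into a part \<open>p\<close> along
  \<open>F\<close>, which the foot follows, and a part \<open>q\<close> orthogonal to
  \<open>F\<close>, which only tilts the normal. The finitely many generators outside
  \<open>F\<close> have strict slack, so a small tilt still exposes \<open>F\<close>.\<close>

lemma open_open_cell:
  assumes "polytope P"
  shows "open (open_cell P F)"
proof (subst open_contains_ball, intro ballI)
  fix y assume y: "y \<in> open_cell P F"
  have F: "F face_of P"
    using open_cell_imp_face_of[OF polytope_imp_convex[OF assms] y] by auto
  obtain S where S: "finite S" "P = convex hull S"
    using assms by (auto simp: polytope_def)
  obtain z where z: "z \<in> rel_interior F" "foot P y z" "top_face P y z = F"
    using y by (auto simp: open_cell_def)
  have zF: "z \<in> F" using z rel_interior_subset by blast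
  obtain \<epsilon> where \<epsilon>: "\<epsilon> > 0" "\<And>d. d \<in> dirs F \<Longrightarrow> norm d < \<epsilon> \<Longrightarrow> z + d \<in> rel_interior F"
    using rel_interior_add_dirs[OF z(1)] by metis
  define n where "n = z - y"
  have neg: "n \<bullet> (s - z) < 0" if "s \<in> S" "s \<notin> F" for s
  proof -
    have "s \<in> P" using that S hull_inc by metis
    then have "n \<bullet> (s - z) \<le> 0" "n \<bullet> (s - z) \<noteq> 0"
      using z that by (auto simp: foot_def top_face_def n_def)
    then show ?thesis by simp
  qed
  have "\<forall>\<^sub>F w in nhds (0::'a). \<forall>s\<in>S - F. norm w * norm (s - z) < - (n \<bullet> (s - z))"
  proof (rule eventually_ball_finite)
    show "finite (S - F)" using S by simp
    show "\<forall>s\<in>S - F. \<forall>\<^sub>F w in nhds (0::'a). norm w * norm (s - z) < - (n \<bullet> (s - z))"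
    proof
      fix s assume "s \<in> S - F"
      have "((\<lambda>w::'a. norm w * norm (s - z)) \<longlongrightarrow> norm (0::'a) * norm (s - z)) (nhds 0)"
        by (intro tendsto_intros filterlim_ident)
      then show "\<forall>\<^sub>F w in nhds (0::'a). norm w * norm (s - z) < - (n \<bullet> (s - z))"
        by (rule order_tendstoD) (use neg \<open>s \<in> S - F\<close> in auto)
    qed
  qed
  then obtain \<delta> where \<delta>: "\<delta> > 0"
      "\<forall>w::'a. norm w < \<delta> \<longrightarrow> (\<forall>s\<in>S - F. norm w * norm (s - z) < - (n \<bullet> (s - z)))"
    unfolding eventually_nhds_0 by (elim exE conjE)
  have "y + w \<in> open_cell P F" if w: "norm w < min \<epsilon> \<delta>" for w
  proof -
    obtain p q where pq: "w = p + q" "p \<in> dirs F" "\<And>d. d \<in> dirs F \<Longrightarrow> q \<bullet> d = 0"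
      "norm p \<le> norm w" "norm q \<le> norm w"
      using dirs_decomp by metis
    define z' where "z' = z + p"
    have z': "z' \<in> rel_interior F" using \<epsilon> pq w by (auto simp: z'_def)
    have z'F: "z' \<in> F" using z' rel_interior_subset by blast
    have nq: "z' - (y + w) = n - q" by (simp add: z'_def n_def pq(1))
    have np: "n \<bullet> p = 0" unfolding n_def using top_face_orthogonal[of F] z(3) pq(2) by blast
    have qp: "q \<bullet> p = 0" using pq by auto
    have "foot (convex hull S) (y + w) z' \<and> top_face (convex hull S) (y + w) z' = F"
    proof (rule foot_convex_hullI[OF S(1) _ z'F, where y = "y + w", unfolded nq])
      show "F face_of convex hull S" using F S by simp
      fix s assume s: "s \<in> S"
      { assume sF: "s \<in> F"
        have d: "s - z' \<in> dirs F" using sF z'F diff_in_dirs by auto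
        have "n \<bullet> (s - z') = 0" unfolding n_def using top_face_orthogonal[of F P y z] z(3) d by auto
        then show "(n - q) \<bullet> (s - z') = 0" using pq(3)[OF d] by (simp add: inner_diff_left) }
      { assume sF: "s \<notin> F"
        have "- (q \<bullet> (s - z)) \<le> norm q * norm (s - z)"
          using Cauchy_Schwarz_ineq2[of q "s - z"] by linarith
        also have "\<dots> \<le> norm w * norm (s - z)" using pq by (simp add: mult_right_mono)
        also have "\<dots> < - (n \<bullet> (s - z))" using \<delta> w s sF by auto
        finally show "(n - q) \<bullet> (s - z') < 0"
          using np qp by (simp add: z'_def inner_diff_left inner_diff_right inner_add_right) }
    qed
    then show ?thesis using z' S by (auto simp: open_cell_def)
  qed
  then have "ball y (min \<epsilon> \<delta>) \<subseteq> open_cell P F"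
    by (metis (no_types) add.commute diff_add_cancel dist_commute dist_norm mem_ball subsetI)
  then show "\<exists>e>0. ball y e \<subseteq> open_cell P F"
    using \<epsilon>(1) \<delta>(1) by (intro exI[of _ "min \<epsilon> \<delta>"]) simp
qed

section \<open>Degenerate feet\<close>

lemma dirs_codim_1:
  fixes F G :: "'a::euclidean_space set"
  assumes F: "F \<subseteq> G" "F \<noteq> {}" "aff_dim G = aff_dim F + 1"
    and e: "e \<in> dirs G" "e \<noteq> 0" "\<And>d. d \<in> dirs F \<Longrightarrow> e \<bullet> d = 0" and v: "v \<in> dirs G"
  obtains k d where "v = k *\<^sub>R e + d" "d \<in> dirs F"
proof -
  have "e \<notin> span (dirs F)" using e by (metis inner_eq_zero_iff span_eq_iff subspace_dirs)
  then have "dim (insert e (dirs F)) = dim (dirs F) + 1" by (simp add: dim_insert)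
  moreover have "dim (dirs G) = dim (dirs F) + 1"
    using dim_dirs[of F] dim_dirs[of G] F by fastforce
  moreover have "span (insert e (dirs F)) \<subseteq> dirs G"
    by (rule span_minimal) (use e dirs_mono[OF F(1)] in auto)
  ultimately have "span (insert e (dirs F)) = dirs G"
    by (metis dim_span subspace_dirs subspace_dim_equal subspace_span order_refl)
  then obtain k where "v - k *\<^sub>R e \<in> span (dirs F)"
    using v span_breakdown_eq by metis
  then have "v - k *\<^sub>R e \<in> dirs F" by (metis span_eq_iff subspace_dirs)
  then show ?thesis using that[of k "v - k *\<^sub>R e"] by simp
qed

lemma exists_orthogonal_in_dirs:
  fixes G :: "'a::euclidean_space set"
  assumes "subspace D" "D \<subseteq> dirs G" "D \<noteq> dirs G"
  obtains e where "e \<in> dirs G" "e \<noteq> 0" "\<And>d. d \<in> D \<Longrightarrow> e \<bullet> d = 0"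
proof -
  have "span D \<subset> span (dirs G)" using assms by (metis psubsetI span_eq_iff subspace_dirs)
  then obtain e where "e \<noteq> 0" "e \<in> span (dirs G)" "\<And>y. y \<in> span D \<Longrightarrow> orthogonal e y"
    using orthogonal_to_subspace_exists_gen by blast
  then show ?thesis
    using that by (metis orthogonal_def span_base span_eq_iff subspace_dirs)
qed

text \<open>Both cells of a degenerate foot lie locally on the same side of the wall between them, so that
  crossing the wall creates or destroys a pair of feet.\<close>

lemma degenerate_foot_cells:
  fixes P :: "'a::euclidean_space set"
  assumes P: "polytope P" and ft: "foot P y z" and F: "F face_of P" "z \<in> rel_interior F"
    and G: "top_face P y z = G" and dim: "aff_dim G = aff_dim F + 1"
    and e: "e \<in> dirs G" "\<And>d. d \<in> dirs F \<Longrightarrow> e \<bullet> d = 0" "e \<bullet> u \<noteq> 0"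
  obtains \<sigma> :: real and \<epsilon> where "\<sigma> \<noteq> 0" "\<epsilon> > 0"
    "\<And>t H. t \<noteq> 0 \<Longrightarrow> \<bar>t\<bar> < \<epsilon> \<Longrightarrow> H = F \<or> H = G \<Longrightarrow> y + t *\<^sub>R u \<in> open_cell P H \<longleftrightarrow> \<sigma> * t > 0"
proof -
  have cP: "convex P" using P polytope_imp_convex by auto
  have GP: "G face_of P" using face_of_top_face[OF cP ft] G by simp
  have FP: "F \<subseteq> P" using F face_of_imp_subset by auto
  have FG: "F \<subseteq> G" using face_subset_top_face[OF cP ft F(2) FP] G by simp
  have FGf: "F face_of G" using face_of_subset[OF F(1) FG] GP face_of_imp_subset by auto
  have cG: "convex G" using GP face_of_imp_convex by auto
  have zF: "z \<in> F" using F rel_interior_subset by blast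
  have e0: "e \<noteq> 0" using e by auto
  have "F \<noteq> G" using dim by auto
  then have zG: "z \<notin> rel_interior G"
    using face_of_disjoint_rel_interior[OF FGf] zF by auto
  \<comment> \<open>On \<open>G\<close> the functional \<open>a\<close> is minimal at
    \<open>z\<close>; it will tell on which side of \<open>F\<close> the face \<open>G\<close>
    lies.\<close>
  obtain a where a: "\<And>x. x \<in> G \<Longrightarrow> a \<bullet> z \<le> a \<bullet> x" "\<And>x. x \<in> rel_interior G \<Longrightarrow> a \<bullet> z < a \<bullet> x"
    using supporting_hyperplane_rel_boundary[OF cG _ zG] zF FG by (metis subsetD)
  have split: "\<exists>k d. x - z = k *\<^sub>R e + d \<and> d \<in> dirs F" if "x \<in> G" for x
    using dirs_codim_1[OF FG _ dim e(1) e0 e(2) diff_in_dirs[OF that]] zF FG by blast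
  \<comment> \<open>As \<open>z\<close> is relatively interior to \<open>F\<close>, small steps
    along both \<open>d\<close> and \<open>- d\<close> stay in \<open>F\<close>, so \<open>a\<close>
    cannot vary along \<open>F\<close>.\<close>
  have ad: "a \<bullet> d = 0" if d: "d \<in> dirs F" for d
  proof -
    obtain \<epsilon> where \<epsilon>: "\<epsilon> > 0" "\<And>d. d \<in> dirs F \<Longrightarrow> norm d < \<epsilon> \<Longrightarrow> z + d \<in> rel_interior F"
      using rel_interior_add_dirs[OF F(2)] by metis
    define s where "s = \<epsilon> / (2 * (norm d + 1))"
    have s: "s > 0" using \<epsilon> by (simp add: s_def add_nonneg_pos)
    have "s * norm d < \<epsilon>"
    proof -
      have "s * norm d = \<epsilon> * (norm d / (2 * (norm d + 1)))" by (simp add: s_def)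
      also have "\<dots> < \<epsilon> * 1"
        by (rule mult_strict_left_mono) (use \<epsilon> in \<open>auto simp: divide_simps add_nonneg_pos\<close>)
      finally show ?thesis by simp
    qed
    then have "norm (s *\<^sub>R d) < \<epsilon>" "norm (- s *\<^sub>R d) < \<epsilon>" using s by auto
    moreover have "s *\<^sub>R d \<in> dirs F" "- s *\<^sub>R d \<in> dirs F"
      using d by (metis subspace_scale subspace_dirs)+
    ultimately have "z + s *\<^sub>R d \<in> G" "z + - s *\<^sub>R d \<in> G"
      using \<epsilon>(2) rel_interior_subset FG by blast+
    from this[THEN a(1)] show ?thesis using s
      by (simp add: inner_add_right inner_diff_right mult_le_0_iff zero_le_mult_iff)
  qed
  \<comment> \<open>The sign of \<open>a \<bullet> e\<close> says on which side of \<open>F\<close>,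
    measured along \<open>e\<close>, the face \<open>G\<close> lies; the sign of
    \<open>e \<bullet> u\<close> says towards which side the ray moves.\<close>
  define \<sigma> where "\<sigma> = (a \<bullet> e) * (e \<bullet> u)"
  obtain q where q: "q \<in> rel_interior G"
    using cG zF FG rel_interior_eq_empty by blast
  then have qG: "q \<in> G" using rel_interior_subset by blast
  obtain k d where kd: "q - z = k *\<^sub>R e + d" "d \<in> dirs F" using split[OF qG] by auto
  have "a \<bullet> (q - z) > 0" using a(2)[OF q] by (simp add: inner_diff_right)
  then have kpos: "k * (a \<bullet> e) > 0" using kd ad by (simp add: inner_add_right)
  then have ae: "a \<bullet> e \<noteq> 0" by auto
  have \<sigma>0: "\<sigma> \<noteq> 0" using ae e by (simp add: \<sigma>_def)
  have eG: "(a \<bullet> e) * (e \<bullet> (x - z)) \<ge> 0" if xG: "x \<in> G" for x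
  proof -
    obtain k d where k: "x - z = k *\<^sub>R e + d" "d \<in> dirs F" using split[OF xG] by auto
    have "a \<bullet> (x - z) \<ge> 0" using a(1)[OF xG] by (simp add: inner_diff_right)
    then have "k * (a \<bullet> e) \<ge> 0" using k ad by (simp add: inner_add_right)
    moreover have "e \<bullet> (x - z) = k * (e \<bullet> e)" using k e by (simp add: inner_add_right)
    ultimately show ?thesis
      by (metis inner_ge_zero mult.assoc mult.commute mult_nonneg_nonneg)
  qed
  have nG: "(z - y) \<bullet> d = 0" if "d \<in> dirs G" for d
    using top_face_orthogonal that G by blast
  \<comment> \<open>The foot \<open>z'\<close> is compared with \<open>z\<close> along
    \<open>e\<close>: it can only be shifted into \<open>G\<close>, the old normal is orthogonal to
    \<open>e\<close>, and the new normal cannot point into \<open>G\<close> along \<open>e\<close>.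
    After multiplication by \<open>a \<bullet> e\<close>, all contributions to
    \<open>t * (e \<bullet> u)\<close> agree in sign.\<close>
  have only_if: "\<sigma> * t \<ge> 0" if H: "H = F \<or> H = G" and t: "y + t *\<^sub>R u \<in> open_cell P H" for t H
  proof -
    obtain z' where z': "z' \<in> rel_interior H" "foot P (y + t *\<^sub>R u) z'" "top_face P (y + t *\<^sub>R u) z' = H"
      using t by (auto simp: open_cell_def)
    have z'H: "z' \<in> H" using z' rel_interior_subset by blast
    then have z'G: "z' \<in> G" using H FG by auto
    define n where "n = z' - (y + t *\<^sub>R u)"
    have nH: "n \<bullet> d = 0" if "d \<in> dirs H" for d
      unfolding n_def using top_face_orthogonal[of H P "y + t *\<^sub>R u" z'] z'(3) that by blast
    have "(a \<bullet> e) * (n \<bullet> e) \<le> 0"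
    proof (cases "H = G")
      case True then show ?thesis using nH e by auto
    next
      case False
      then have HF: "H = F" using H by auto
      have "n \<bullet> (q - z') \<le> 0"
        using z'(2) qG GP face_of_imp_subset by (auto simp: foot_def n_def)
      moreover have "n \<bullet> (z' - z) = 0" using nH HF z'H zF diff_in_dirs by blast
      ultimately have "n \<bullet> (q - z) \<le> 0" by (simp add: inner_diff_right)
      then have "k * (n \<bullet> e) \<le> 0" using kd nH HF by (simp add: inner_add_right)
      then show ?thesis using kpos
        by (smt (verit) mult_le_0_iff zero_less_mult_iff)
    qed
    moreover have "(a \<bullet> e) * (e \<bullet> (z' - z)) \<ge> 0" using eG z'G by auto
    moreover have "(z - y) \<bullet> e = 0" using nG e by auto
    moreover have "t * (e \<bullet> u) = e \<bullet> (z' - z) + (z - y) \<bullet> e - n \<bullet> e"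
      by (simp add: n_def inner_diff_left inner_diff_right inner_add_left inner_add_right inner_commute)
    moreover have "\<sigma> * t = (a \<bullet> e) * (t * (e \<bullet> u))" by (simp add: \<sigma>_def)
    ultimately show ?thesis by (simp add: right_diff_distrib)
  qed
  have step: "\<exists>\<epsilon>>0. \<forall>t. \<sigma> * t > 0 \<longrightarrow> \<bar>t\<bar> < \<epsilon> \<longrightarrow> y + t *\<^sub>R u \<in> open_cell P H" if H: "H = F \<or> H = G" for H
  proof -
    have "F \<subseteq> H" "H \<subseteq> G" "H face_of P" using H FG F GP by auto
    obtain p r where pr: "u = p + r" "p \<in> dirs H" "\<And>d. d \<in> dirs H \<Longrightarrow> r \<bullet> d = 0"
      using dirs_decomp by metis
    obtain S where S: "finite S" "P = convex hull S"
      using P by (auto simp: polytope_def)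
    have relint: "\<exists>\<epsilon>>0. \<forall>t. \<sigma> * t > 0 \<longrightarrow> \<bar>t\<bar> < \<epsilon> \<longrightarrow> z + t *\<^sub>R p \<in> rel_interior H"
    proof -
      obtain \<epsilon> where \<epsilon>: "\<epsilon> > 0" "\<And>d. d \<in> dirs F \<Longrightarrow> norm d < \<epsilon> \<Longrightarrow> z + d \<in> rel_interior F"
        using rel_interior_add_dirs[OF F(2)] by metis
      show ?thesis
      proof (cases "H = F")
        case True
        have "z + t *\<^sub>R p \<in> rel_interior H" if "\<bar>t\<bar> < \<epsilon> / (norm p + 1)" for t
        proof -
          have "\<bar>t\<bar> * (norm p + 1) < \<epsilon>" using that by (simp add: pos_less_divide_eq add_nonneg_pos)
          moreover have "\<bar>t\<bar> * norm p \<le> \<bar>t\<bar> * (norm p + 1)" by (simp add: mult_left_mono)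
          ultimately have "norm (t *\<^sub>R p) < \<epsilon>" by simp
          then show ?thesis using \<epsilon>(2) pr True by (simp add: subspace_scale)
        qed
        moreover have "\<epsilon> / (norm p + 1) > 0" using \<epsilon> by (simp add: add_nonneg_pos)
        ultimately show ?thesis by blast
      next
        case False
        then have HG: "H = G" using H by auto
        then have "p \<in> dirs G" using pr by auto
        then obtain j c where jc: "p = j *\<^sub>R e + c" "c \<in> dirs F"
          using dirs_codim_1[OF FG _ dim e(1) e0 e(2)] zF by blast
        have "e \<bullet> u = j * (e \<bullet> e)"
          using pr(1) pr(3)[of e] e HG jc by (simp add: inner_add_right inner_commute)
        then have \<sigma>j: "\<sigma> = (a \<bullet> e) * j * (e \<bullet> e)" by (simp add: \<sigma>_def)
        have kn: "k \<noteq> 0" using kpos by auto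
        \<comment> \<open>Chosen so that a time below \<open>1 / (2 * m)\<close> keeps the weight
          \<open>s\<close> below 1/2 and the vector \<open>w\<close> shorter than
          \<open>\<epsilon>\<close>.\<close>
        define m where "m = \<bar>j / k\<bar> + 2 * norm (c - (j/k) *\<^sub>R d) / \<epsilon> + 1"
        have m: "m > 0" using \<epsilon> by (simp add: m_def add_nonneg_pos)
        have "z + t *\<^sub>R p \<in> rel_interior H" if t: "\<sigma> * t > 0" "\<bar>t\<bar> < 1 / (2 * m)" for t
        proof -
          \<comment> \<open>The point at \<open>z\<close> plus \<open>t\<close> times
            \<open>p\<close> is sought as a convex combination of \<open>q\<close>, relatively
            interior to \<open>G\<close>, and a point \<open>z + w\<close> of \<open>F\<close>.
            Matching the components along \<open>e\<close> forces this weight for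
            \<open>q\<close>.\<close>
          define s where "s = t * j / k"
          have tm: "\<bar>t\<bar> * m < 1/2" using t m by (simp add: field_simps)
          have "(a \<bullet> e) * j * (e \<bullet> e) * t * (k * (a \<bullet> e)) > 0"
            using t kpos \<sigma>j by (metis mult_pos_pos)
          moreover have "(a \<bullet> e) * j * (e \<bullet> e) * t * (k * (a \<bullet> e)) = s * ((a \<bullet> e)\<^sup>2 * (e \<bullet> e) * k\<^sup>2)"
            using kn by (simp add: s_def power2_eq_square)
          ultimately have s0: "s > 0"
            by (metis inner_ge_zero mult_nonneg_nonneg zero_le_power2 zero_less_mult_pos2 less_eq_real_def mult_zero_right order_less_irrefl)
          have "\<bar>t\<bar> * \<bar>j/k\<bar> \<le> \<bar>t\<bar> * m" using \<epsilon> by (intro mult_left_mono) (auto simp: m_def)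
          moreover have "\<bar>t\<bar> * \<bar>j/k\<bar> = \<bar>s\<bar>" by (simp add: s_def abs_mult)
          ultimately have s1: "s < 1/2" using tm by linarith
          have "\<bar>t\<bar> * (2 * norm (c - (j/k) *\<^sub>R d) / \<epsilon>) \<le> \<bar>t\<bar> * m"
            by (intro mult_left_mono) (auto simp: m_def)
          then have "\<bar>t\<bar> * (2 * norm (c - (j/k) *\<^sub>R d) / \<epsilon>) < 1/2" using tm by linarith
          then have "\<bar>t\<bar> * norm (c - (j/k) *\<^sub>R d) * 4 < \<epsilon>"
            using \<epsilon> by (simp add: field_simps)
          then have c1: "norm (t *\<^sub>R (c - (j/k) *\<^sub>R d)) * 4 < \<epsilon>" by simp
          define w where "w = (1 / (1 - s)) *\<^sub>R (t *\<^sub>R (c - (j/k) *\<^sub>R d))"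
          have "norm w = norm (t *\<^sub>R (c - (j/k) *\<^sub>R d)) / (1 - s)"
            using s1 by (simp add: w_def)
          also have "\<dots> \<le> norm (t *\<^sub>R (c - (j/k) *\<^sub>R d)) / (1/2)"
            using s1 by (intro divide_left_mono) auto
          also have "\<dots> < \<epsilon>" using c1 \<epsilon> by auto
          finally have "norm w < \<epsilon>" .
          moreover have "w \<in> dirs F"
            using jc kd by (auto simp: w_def intro!: subspace_scale subspace_diff)
          ultimately have "z + w \<in> G" using \<epsilon>(2) rel_interior_subset FG by blast
          then have "(z + w) - s *\<^sub>R ((z + w) - q) \<in> rel_interior G"
            by (rule rel_interior_convex_shrink[OF cG q]) (use s0 s1 in auto)
          moreover have "(z + w) - s *\<^sub>R ((z + w) - q) = z + (1 - s) *\<^sub>R w + s *\<^sub>R (q - z)"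
            by (simp add: algebra_simps)
          moreover have "(1 - s) *\<^sub>R w = t *\<^sub>R (c - (j/k) *\<^sub>R d)" using s1 by (simp add: w_def)
          moreover have "s *\<^sub>R (q - z) = (t * j) *\<^sub>R e + (t * (j/k)) *\<^sub>R d"
            using kn kd by (simp add: s_def scaleR_add_right)
          ultimately have "z + t *\<^sub>R (c - (j/k) *\<^sub>R d) + ((t * j) *\<^sub>R e + (t * (j/k)) *\<^sub>R d) \<in> rel_interior G"
            by simp
          moreover have "z + t *\<^sub>R (c - (j/k) *\<^sub>R d) + ((t * j) *\<^sub>R e + (t * (j/k)) *\<^sub>R d) = z + t *\<^sub>R p"
            by (simp add: jc algebra_simps)
          ultimately show ?thesis using HG by metis
        qed
        moreover have "1 / (2 * m) > 0" using m by simp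
        ultimately show ?thesis by blast
      qed
    qed
    then obtain \<epsilon>1 where \<epsilon>1: "\<epsilon>1 > 0" "\<And>t. \<sigma> * t > 0 \<Longrightarrow> \<bar>t\<bar> < \<epsilon>1 \<Longrightarrow> z + t *\<^sub>R p \<in> rel_interior H"
      by blast
    define n where "n = z - y"
    have np: "n \<bullet> p = 0" unfolding n_def using nG pr dirs_mono[OF \<open>H \<subseteq> G\<close>] by blast
    have rp: "r \<bullet> p = 0" using pr by auto
    have neg: "n \<bullet> (s - z) < 0" if "s \<in> S" "s \<notin> G" for s
    proof -
      have "s \<in> P" using that S hull_inc by metis
      then have "n \<bullet> (s - z) \<le> 0" "n \<bullet> (s - z) \<noteq> 0"
        using ft G that by (auto simp: foot_def top_face_def n_def)
      then show ?thesis by simp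
    qed
    have "\<forall>\<^sub>F t in nhds (0::real). \<forall>s\<in>S - G. \<bar>t\<bar> * \<bar>r \<bullet> (s - z)\<bar> < - (n \<bullet> (s - z))"
    proof (rule eventually_ball_finite)
      show "finite (S - G)" using S by simp
      show "\<forall>s\<in>S - G. \<forall>\<^sub>F t in nhds (0::real). \<bar>t\<bar> * \<bar>r \<bullet> (s - z)\<bar> < - (n \<bullet> (s - z))"
      proof
        fix s assume "s \<in> S - G"
        have "((\<lambda>t. \<bar>t\<bar> * \<bar>r \<bullet> (s - z)\<bar>) \<longlongrightarrow> \<bar>0\<bar> * \<bar>r \<bullet> (s - z)\<bar>) (nhds (0::real))"
          by (intro tendsto_intros filterlim_ident)
        then show "\<forall>\<^sub>F t in nhds (0::real). \<bar>t\<bar> * \<bar>r \<bullet> (s - z)\<bar> < - (n \<bullet> (s - z))"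
          by (rule order_tendstoD) (use neg \<open>s \<in> S - G\<close> in auto)
      qed
    qed
    then obtain \<epsilon>2 where \<epsilon>2: "\<epsilon>2 > 0"
        "\<forall>t. norm t < \<epsilon>2 \<longrightarrow> (\<forall>s\<in>S - G. \<bar>t\<bar> * \<bar>r \<bullet> (s - z)\<bar> < - (n \<bullet> (s - z)))"
      unfolding eventually_nhds_0 by (elim exE conjE)
    have "y + t *\<^sub>R u \<in> open_cell P H" if t: "\<sigma> * t > 0" "\<bar>t\<bar> < min \<epsilon>1 \<epsilon>2" for t
    proof -
      define z' where "z' = z + t *\<^sub>R p"
      have z': "z' \<in> rel_interior H" using \<epsilon>1 t by (auto simp: z'_def)
      have z'H: "z' \<in> H" using z' rel_interior_subset by blast
      have nq: "z' - (y + t *\<^sub>R u) = n - t *\<^sub>R r"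
        by (simp add: z'_def n_def pr(1) scaleR_add_right)
      have "foot (convex hull S) (y + t *\<^sub>R u) z' \<and> top_face (convex hull S) (y + t *\<^sub>R u) z' = H"
      proof (rule foot_convex_hullI[OF S(1) _ z'H, where y = "y + t *\<^sub>R u", unfolded nq])
        show "H face_of convex hull S" using \<open>H face_of P\<close> S by simp
        fix s assume s: "s \<in> S"
        { assume sH: "s \<in> H"
          have d: "s - z' \<in> dirs H" using sH z'H diff_in_dirs by auto
          then have "n \<bullet> (s - z') = 0" unfolding n_def using nG dirs_mono[OF \<open>H \<subseteq> G\<close>] by blast
          then show "(n - t *\<^sub>R r) \<bullet> (s - z') = 0" using pr(3)[OF d] by (simp add: inner_diff_left) }
        { assume sH: "s \<notin> H"
          have eq: "(n - t *\<^sub>R r) \<bullet> (s - z') = n \<bullet> (s - z) - t * (r \<bullet> (s - z))"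
            using np rp by (simp add: z'_def inner_diff_left inner_diff_right inner_add_right right_diff_distrib)
          \<comment> \<open>Generators outside \<open>G\<close> have strict slack from the old
            normal. Those in \<open>G\<close> but not in \<open>F\<close>, relevant for
            \<open>H = F\<close>, have none: there the tilt \<open>r\<close> decides, with the sign
            dictated by \<open>\<sigma> * t > 0\<close>.\<close>
          show "(n - t *\<^sub>R r) \<bullet> (s - z') < 0"
          proof (cases "s \<in> G")
            case False
            then have "\<bar>t\<bar> * \<bar>r \<bullet> (s - z)\<bar> < - (n \<bullet> (s - z))" using \<epsilon>2 t s by auto
            moreover have "- (t * (r \<bullet> (s - z))) \<le> \<bar>t\<bar> * \<bar>r \<bullet> (s - z)\<bar>"
              by (metis abs_ge_minus_self abs_mult)
            ultimately show ?thesis using eq by linarith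
          next
            case True
            then have HF: "H = F" using H sH by auto
            have sP: "s \<in> P" using s S hull_inc by metis
            obtain k' d' where k': "s - z = k' *\<^sub>R e + d'" "d' \<in> dirs F" using split[OF True] by auto
            have es: "e \<bullet> (s - z) = k' * (e \<bullet> e)" using k' e by (simp add: inner_add_right)
            have "k' \<noteq> 0"
            proof
              assume "k' = 0"
              then have "s \<in> affine hull F"
                using k'(1) add_dirs_in_affine_hull[OF zF k'(2)] by (simp add: algebra_simps)
              then have "s \<in> F"
                using face_of_imp_eq_affine_Int[OF cP F(1)] sP by auto
              then show False using HF sH by auto
            qed
            then have "(a \<bullet> e) * (k' * (e \<bullet> e)) > 0"
              using eG[OF True] es ae e0 by (smt (verit) inner_eq_zero_iff mult_eq_0_iff)
            then have "(a \<bullet> e) * k' > 0"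
              using e0 by (metis inner_gt_zero_iff mult.assoc zero_less_mult_pos2)
            moreover have "\<sigma> * t > 0" using t by simp
            ultimately have "(a \<bullet> e) * k' * ((a \<bullet> e) * (e \<bullet> u) * t) > 0"
              unfolding \<sigma>_def by (rule mult_pos_pos)
            moreover have "(a \<bullet> e) * k' * ((a \<bullet> e) * (e \<bullet> u) * t) = (a \<bullet> e)\<^sup>2 * (t * (k' * (e \<bullet> u)))"
              by (simp add: power2_eq_square)
            ultimately have "t * (k' * (e \<bullet> u)) > 0"
              by (metis zero_le_power2 zero_less_mult_pos less_eq_real_def mult_zero_left order_less_irrefl)
            moreover have "r \<bullet> (s - z) = k' * (e \<bullet> u)"
            proof -
              have "e \<bullet> p = 0" using e pr HF by auto
              then have "e \<bullet> r = e \<bullet> u" by (simp add: pr(1) inner_add_right)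
              moreover have "r \<bullet> d' = 0" using pr k' HF by auto
              ultimately show ?thesis using k' by (simp add: inner_add_right inner_commute)
            qed
            moreover have "n \<bullet> (s - z) = 0"
              unfolding n_def using nG diff_in_dirs True zF FG by blast
            ultimately show ?thesis using eq by simp
          qed }
      qed
      then show ?thesis using z' S by (auto simp: open_cell_def)
    qed
    then show ?thesis using \<epsilon>1(1) \<epsilon>2(1) by (intro exI[of _ "min \<epsilon>1 \<epsilon>2"]) simp
  qed
  obtain \<epsilon>F where \<epsilon>F: "\<epsilon>F > 0" "\<And>t. \<sigma> * t > 0 \<Longrightarrow> \<bar>t\<bar> < \<epsilon>F \<Longrightarrow> y + t *\<^sub>R u \<in> open_cell P F"
    using step[of F] by blast
  obtain \<epsilon>G where \<epsilon>G: "\<epsilon>G > 0" "\<And>t. \<sigma> * t > 0 \<Longrightarrow> \<bar>t\<bar> < \<epsilon>G \<Longrightarrow> y + t *\<^sub>R u \<in> open_cell P G"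
    using step[of G] by blast
  show ?thesis
  proof (rule that[of \<sigma> "min \<epsilon>F \<epsilon>G"])
    show "\<sigma> \<noteq> 0" "min \<epsilon>F \<epsilon>G > 0" using \<sigma>0 \<epsilon>F \<epsilon>G by auto
    fix t H assume t: "t \<noteq> 0" "\<bar>t\<bar> < min \<epsilon>F \<epsilon>G" and H: "H = F \<or> H = G"
    have "\<sigma> * t \<noteq> 0" using \<sigma>0 t by simp
    then show "y + t *\<^sub>R u \<in> open_cell P H \<longleftrightarrow> \<sigma> * t > 0"
      using only_if[OF H, of t] \<epsilon>F(2)[of t] \<epsilon>G(2)[of t] H t by (smt (verit))
  qed
qed

section \<open>Parity of the number of feet\<close>

text \<open>The first condition prevents \<open>u\<close> from being parallel to the walls between
  comparable faces. The second keeps the ray off the sets of codimension at least two where faces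
  with a larger dimension gap degenerate together; it is silent at \<open>t = 0\<close>, so that a
  ray may start at a vertex.\<close>

definition transverse_ray :: "'a::euclidean_space set \<Rightarrow> 'a \<Rightarrow> 'a \<Rightarrow> bool" where
  "transverse_ray P y u \<longleftrightarrow>
     (\<forall>F G. F face_of P \<and> G face_of P \<and> F \<noteq> {} \<and> F \<subset> G \<longrightarrow>
        (\<exists>e\<in>dirs G. (\<forall>d\<in>dirs F. e \<bullet> d = 0) \<and> e \<bullet> u \<noteq> 0) \<and>
        (aff_dim G \<noteq> aff_dim F + 1 \<longrightarrow> (\<forall>t>0. \<forall>z\<in>F. \<exists>d\<in>dirs G. (y + t *\<^sub>R u - z) \<bullet> d \<noteq> 0)))"

lemma transverse_rayD:
  assumes "transverse_ray P y u" "F face_of P" "G face_of P" "F \<noteq> {}" "F \<subset> G"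
  shows "\<exists>e. e \<in> dirs G \<and> (\<forall>d\<in>dirs F. e \<bullet> d = 0) \<and> e \<bullet> u \<noteq> 0"
    and "aff_dim G \<noteq> aff_dim F + 1 \<Longrightarrow> t > 0 \<Longrightarrow> z \<in> F \<Longrightarrow> \<exists>d\<in>dirs G. (y + t *\<^sub>R u - z) \<bullet> d \<noteq> 0"
  using assms unfolding transverse_ray_def by meson+

text \<open>\<open>H\<close> lies between the face carrying the foot and the exposed face.
  Transversality lets their dimensions differ by one only, which leaves no room strictly between
  them.\<close>

lemma degenerate_pair:
  fixes P :: "'a::euclidean_space set"
  assumes P: "polytope P" and tr: "transverse_ray P y u" and t: "t > 0" and H: "H face_of P"
    and mem: "y + t *\<^sub>R u \<in> closed_cell P H" "y + t *\<^sub>R u \<notin> open_cell P H"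
  obtains z F G and \<sigma> \<epsilon> :: real where "foot P (y + t *\<^sub>R u) z" "z \<in> rel_interior F" "F face_of P"
    "top_face P (y + t *\<^sub>R u) z = G" "F \<subseteq> G" "aff_dim G = aff_dim F + 1" "H = F \<or> H = G"
    "\<sigma> \<noteq> 0" "\<epsilon> > 0"
    "\<And>s H'. s \<noteq> 0 \<Longrightarrow> \<bar>s\<bar> < \<epsilon> \<Longrightarrow> H' = F \<or> H' = G \<Longrightarrow>
       y + (t + s) *\<^sub>R u \<in> open_cell P H' \<longleftrightarrow> \<sigma> * s > 0"
proof -
  have cP: "convex P" using P polytope_imp_convex by auto
  obtain z where z: "z \<in> H" "foot P (y + t *\<^sub>R u) z" "H \<subseteq> top_face P (y + t *\<^sub>R u) z"
    using mem(1) by (auto simp: closed_cell_def)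
  define G where "G = top_face P (y + t *\<^sub>R u) z"
  have G: "G face_of P" using face_of_top_face[OF cP z(2)] by (simp add: G_def)
  have HG: "H \<subseteq> G" using z G_def by simp
  have "z \<in> P" using z(2) by (simp add: foot_def)
  then obtain F where F: "F face_of P" "z \<in> rel_interior F"
    using exists_face_rel_interior[OF P] by metis
  have FH: "F \<subseteq> H"
    by (rule subset_of_face_of[OF H face_of_imp_subset[OF F(1)]]) (use z F in \<open>auto simp: disjnt_iff\<close>)
  have zF: "z \<in> F" using F rel_interior_subset by blast
  have "F \<noteq> G"
  proof
    assume "F = G"
    then have "H = F" "H = G" using FH HG by auto
    then have "y + t *\<^sub>R u \<in> open_cell P H" using F z G_def by (auto simp: open_cell_def)
    then show False using mem by simp
  qed
  then have FG: "F \<subset> G" using FH HG by auto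
  have nG: "(y + t *\<^sub>R u - z) \<bullet> d = 0" if d: "d \<in> dirs G" for d
  proof -
    have "(z - (y + t *\<^sub>R u)) \<bullet> d = 0"
      using top_face_orthogonal[of G P "y + t *\<^sub>R u" z] d G_def by blast
    then show ?thesis by (simp add: inner_diff_left)
  qed
  have dim: "aff_dim G = aff_dim F + 1"
    using transverse_rayD(2)[OF tr F(1) G _ FG _ t zF] zF nG by blast
  obtain e where e: "e \<in> dirs G" "\<And>d. d \<in> dirs F \<Longrightarrow> e \<bullet> d = 0" "e \<bullet> u \<noteq> 0"
    using transverse_rayD(1)[OF tr F(1) G _ FG] zF by auto
  have HFG: "H = F \<or> H = G"
  proof (rule ccontr)
    assume ne: "\<not> (H = F \<or> H = G)"
    have "F face_of H" "H face_of G"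
      using face_of_subset[OF F(1) FH] face_of_subset[OF H HG] H G face_of_imp_subset by auto
    then have "aff_dim F < aff_dim H" "aff_dim H < aff_dim G"
      using face_of_aff_dim_lt face_of_imp_convex[OF H] face_of_imp_convex[OF G] ne by blast+
    then show False using dim by simp
  qed
  obtain \<sigma> :: real and \<epsilon> where se: "\<sigma> \<noteq> 0" "\<epsilon> > 0"
    "\<And>s H'. s \<noteq> 0 \<Longrightarrow> \<bar>s\<bar> < \<epsilon> \<Longrightarrow> H' = F \<or> H' = G \<Longrightarrow>
       (y + t *\<^sub>R u) + s *\<^sub>R u \<in> open_cell P H' \<longleftrightarrow> \<sigma> * s > 0"
    using degenerate_foot_cells[OF P z(2) F G_def[symmetric] dim e] by metis
  show ?thesis
  proof (rule that[OF z(2) F(2) F(1) G_def[symmetric] _ dim HFG se(1,2)])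
    show "F \<subseteq> G" using FG by simp
    fix s H' assume "s \<noteq> 0" "\<bar>s\<bar> < \<epsilon>" "H' = F \<or> H' = G"
    from se(3)[OF this] show "y + (t + s) *\<^sub>R u \<in> open_cell P H' \<longleftrightarrow> \<sigma> * s > 0"
      by (simp add: scaleR_add_left add.assoc)
  qed
qed

lemma tendsto_ray:
  fixes y u :: "'a::real_normed_vector"
  shows "((\<lambda>s. y + (t + s) *\<^sub>R u) \<longlongrightarrow> y + t *\<^sub>R u) (at (0::real))"
proof -
  have "((\<lambda>s. y + (t + s) *\<^sub>R u) \<longlongrightarrow> y + (t + 0) *\<^sub>R u) (at (0::real))"
    by (intro tendsto_intros)
  then show ?thesis by simp
qed

text \<open>Cells containing the point persist nearby, cells whose closed version misses it stay
  absent, and the remaining faces fall into pairs whose cells appear or vanish together. The second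
  alternative for \<open>t\<close> covers the start of the ray, where no such pairs may be
  present.\<close>

lemma cell_count_locally_even:
  fixes P :: "'a::euclidean_space set"
  assumes P: "polytope P" and tr: "transverse_ray P y u"
    and t: "t > 0 \<or> (\<forall>H. H face_of P \<longrightarrow> y + t *\<^sub>R u \<in> closed_cell P H \<longrightarrow> y + t *\<^sub>R u \<in> open_cell P H)"
  shows "\<forall>\<^sub>F s in at (0::real). even (card {F. y + (t + s) *\<^sub>R u \<in> open_cell P F}) =
     even (card {F. y + t *\<^sub>R u \<in> open_cell P F})"
proof -
  have cP: "convex P" using P polytope_imp_convex by auto
  define w where "w = y + t *\<^sub>R u"
  define \<F> where "\<F> = {F. F face_of P}"
  define N where "N = {F. w \<in> open_cell P F}"
  define D where "D = {H \<in> \<F>. w \<in> closed_cell P H \<and> w \<notin> open_cell P H}"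
  have fin: "finite \<F>" using finite_polytope_faces[OF P] by (simp add: \<F>_def)
  have N\<F>: "N \<subseteq> \<F>" using open_cell_imp_face_of[OF cP] by (auto simp: N_def \<F>_def)
  define zf where "zf H = (SOME z. z \<in> H \<and> foot P w z \<and> H \<subseteq> top_face P w z)" for H
  have zf: "zf H \<in> H \<and> foot P w (zf H) \<and> H \<subseteq> top_face P w (zf H)" if "w \<in> closed_cell P H" for H
    unfolding zf_def by (rule someI_ex) (use that in \<open>auto simp: closed_cell_def\<close>)
  have zf_eq: "zf H = z" if "z \<in> H" "foot P w z" "H \<subseteq> top_face P w z" for H z
  proof -
    have "w \<in> closed_cell P H" using that by (auto simp: closed_cell_def)
    then show ?thesis using foot_unique[of "zf H" H P w z] zf that by blast
  qed
  \<comment> \<open>\<open>D1\<close> holds the lower and \<open>D2\<close> the upper members of the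
    degenerate pairs; \<open>g\<close> sends a lower face to the face exposed at its foot.\<close>
  define D1 where "D1 = {F \<in> D. zf F \<in> rel_interior F}"
  define D2 where "D2 = {G \<in> D. top_face P w (zf G) = G}"
  define g where "g F = top_face P w (zf F)" for F
  have dp: "\<exists>z F G. foot P w z \<and> z \<in> rel_interior F \<and> F face_of P \<and> top_face P w z = G \<and>
      F \<subseteq> G \<and> (H = F \<or> H = G) \<and> (\<exists>\<epsilon>>0. \<forall>s. s \<noteq> 0 \<longrightarrow> \<bar>s\<bar> < \<epsilon> \<longrightarrow>
        (y + (t + s) *\<^sub>R u \<in> open_cell P F \<longleftrightarrow> y + (t + s) *\<^sub>R u \<in> open_cell P G))"
    if H: "H \<in> D" for H
  proof -
    have HD: "H face_of P" "w \<in> closed_cell P H" "w \<notin> open_cell P H"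
      using H by (auto simp: D_def \<F>_def)
    then have "t > 0" using t w_def by auto
    from degenerate_pair[OF P tr this HD(1) HD(2,3)[unfolded w_def]]
    obtain z F G and \<sigma> \<epsilon> :: real where z: "foot P w z" "z \<in> rel_interior F" "F face_of P"
      "top_face P w z = G" "F \<subseteq> G" "H = F \<or> H = G" "\<epsilon> > 0"
      and cells: "\<And>s H'. s \<noteq> 0 \<Longrightarrow> \<bar>s\<bar> < \<epsilon> \<Longrightarrow> H' = F \<or> H' = G \<Longrightarrow>
        y + (t + s) *\<^sub>R u \<in> open_cell P H' \<longleftrightarrow> \<sigma> * s > 0"
      unfolding w_def by metis
    have "\<forall>s. s \<noteq> 0 \<longrightarrow> \<bar>s\<bar> < \<epsilon> \<longrightarrow>
        (y + (t + s) *\<^sub>R u \<in> open_cell P F \<longleftrightarrow> y + (t + s) *\<^sub>R u \<in> open_cell P G)"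
      using cells by blast
    then show ?thesis using z by blast
  qed
  have D12: "D = D1 \<union> D2"
  proof
    show "D \<subseteq> D1 \<union> D2"
    proof
      fix H assume H: "H \<in> D"
      obtain z F G where z: "foot P w z" "z \<in> rel_interior F" "top_face P w z = G" "F \<subseteq> G" "H = F \<or> H = G"
        using dp[OF H] by metis
      have zF: "z \<in> F" using z rel_interior_subset by blast
      then have "zf H = z" using zf_eq[of z H] z by auto
      then show "H \<in> D1 \<union> D2" using H z by (auto simp: D1_def D2_def)
    qed
  qed (auto simp: D1_def D2_def)
  have zfD: "zf H \<in> H" "foot P w (zf H)" "H \<subseteq> top_face P w (zf H)" "H face_of P" if "H \<in> D" for H
    using zf[of H] that by (auto simp: D_def \<F>_def)
  have disj: "D1 \<inter> D2 = {}"
  proof -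
    have False if "F \<in> D1" "F \<in> D2" for F
    proof -
      have "w \<in> open_cell P F" using that zfD[of F] by (auto simp: D1_def D2_def open_cell_def)
      then show False using that by (auto simp: D1_def D_def)
    qed
    then show ?thesis by auto
  qed
  have gz: "zf (g F) = zf F" if "F \<in> D" for F
    using zf_eq[of "zf F" "g F"] zfD[OF that] foot_top_face_mem by (auto simp: g_def)
  \<comment> \<open>The exposed face determines the foot, and distinct faces have disjoint relative
    interiors.\<close>
  have inj: "inj_on g D1"
  proof (rule inj_onI)
    fix F F' assume a: "F \<in> D1" "F' \<in> D1" "g F = g F'"
    then have "zf F = zf F'" using gz by (metis D1_def mem_Collect_eq)
    then have "rel_interior F \<inter> rel_interior F' \<noteq> {}" using a by (auto simp: D1_def)
    then show "F = F'"
      using face_of_eq zfD(4) a by (metis (mono_tags) D1_def mem_Collect_eq)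
  qed
  have gD: "g ` D1 = D2"
  proof
    show "g ` D1 \<subseteq> D2"
    proof
      fix G assume "G \<in> g ` D1"
      then obtain F where F: "F \<in> D1" "G = g F" by auto
      then have FD: "F \<in> D" by (auto simp: D1_def)
      have z: "zf G = zf F" using gz[OF FD] F by simp
      have top: "top_face P w (zf G) = G" using z F by (simp add: g_def)
      have Gf: "G face_of P" using face_of_top_face[OF cP] zfD[OF FD] F by (simp add: g_def)
      have zG: "zf F \<in> G" using zfD[OF FD] F by (auto simp: g_def)
      have "w \<in> closed_cell P G" using z top zG zfD[OF FD] by (auto simp: closed_cell_def)
      moreover have "w \<notin> open_cell P G"
      proof
        assume "w \<in> open_cell P G"
        then obtain z' where z': "z' \<in> rel_interior G" "foot P w z'" "top_face P w z' = G"
          by (auto simp: open_cell_def)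
        then have "z' \<in> G" using rel_interior_subset by blast
        then have "z' = zf F" using zf_eq[of z' G] z z' by auto
        then have "rel_interior F \<inter> rel_interior G \<noteq> {}" using F z' by (auto simp: D1_def)
        then have "F = G" using face_of_eq zfD(4)[OF FD] Gf by blast
        then have "F \<in> D2" using F(1) top by (auto simp: D1_def D2_def)
        then show False using F disj by auto
      qed
      ultimately show "G \<in> D2" using top Gf by (auto simp: D2_def D_def \<F>_def)
    qed
    show "D2 \<subseteq> g ` D1"
    proof
      fix G assume G: "G \<in> D2"
      then have GD: "G \<in> D" by (auto simp: D2_def)
      note zG = zfD[OF GD]
      obtain F where F: "F face_of P" "zf G \<in> rel_interior F"
        using exists_face_rel_interior[OF P, of "zf G"] zG by (auto simp: foot_def)
      have FG: "F \<subseteq> G"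
        using face_subset_top_face[OF cP zG(2) F(2) face_of_imp_subset[OF F(1)]] G by (auto simp: D2_def)
      have zF: "zf G \<in> F" using F rel_interior_subset by blast
      have zfF: "zf F = zf G" using zf_eq[OF zF zG(2)] FG zG by auto
      have "w \<in> closed_cell P F" using zF zG FG by (auto simp: closed_cell_def)
      moreover have "w \<notin> open_cell P F"
      proof
        assume "w \<in> open_cell P F"
        then obtain z' where z': "z' \<in> rel_interior F" "foot P w z'" "top_face P w z' = F"
          by (auto simp: open_cell_def)
        then have "z' \<in> F" using rel_interior_subset by blast
        then have "z' = zf G" using zf_eq[of z' F] zfF z' by auto
        then have "F = G" using z' G by (auto simp: D2_def)
        then show False using \<open>w \<in> open_cell P F\<close> GD by (auto simp: D_def)
      qed
      ultimately have "F \<in> D1" using F zfF by (auto simp: D1_def D_def \<F>_def)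
      moreover have "g F = G" using zfF G by (simp add: g_def D2_def)
      ultimately show "G \<in> g ` D1" by auto
    qed
  qed
  have lim: "((\<lambda>s. y + (t + s) *\<^sub>R u) \<longlongrightarrow> w) (at (0::real))"
    unfolding w_def by (rule tendsto_ray)
  have evN: "\<forall>\<^sub>F s in at (0::real). \<forall>H\<in>N. y + (t + s) *\<^sub>R u \<in> open_cell P H"
    by (intro eventually_ball_finite ballI topological_tendstoD[OF lim] open_open_cell P
        finite_subset[OF N\<F> fin]) (simp add: N_def)
  have evC: "\<forall>\<^sub>F s in at (0::real). \<forall>H\<in>\<F> - N - D. y + (t + s) *\<^sub>R u \<notin> open_cell P H"
  proof (intro eventually_ball_finite ballI)
    show "finite (\<F> - N - D)" using fin by simp
    fix H assume H: "H \<in> \<F> - N - D"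
    have "compact H"
      using H P face_of_imp_compact polytope_imp_compact polytope_imp_convex by (auto simp: \<F>_def)
    then have "open (- closed_cell P H)"
      using closed_closed_cell[of H P] H face_of_imp_subset by (auto simp: \<F>_def)
    moreover have "w \<in> - closed_cell P H" using H by (auto simp: N_def D_def)
    ultimately have "\<forall>\<^sub>F s in at (0::real). y + (t + s) *\<^sub>R u \<in> - closed_cell P H"
      by (rule topological_tendstoD[OF lim])
    then show "\<forall>\<^sub>F s in at (0::real). y + (t + s) *\<^sub>R u \<notin> open_cell P H"
      by (rule eventually_mono) (use open_cell_subset_closed_cell in blast)
  qed
  have evD: "\<forall>\<^sub>F s in at (0::real). \<forall>F\<in>D1. y + (t + s) *\<^sub>R u \<in> open_cell P F \<longleftrightarrow>
      y + (t + s) *\<^sub>R u \<in> open_cell P (g F)"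
  proof (intro eventually_ball_finite ballI)
    show "finite D1" using fin by (auto simp: D1_def D_def)
    fix F assume F: "F \<in> D1"
    then have FD: "F \<in> D" by (auto simp: D1_def)
    obtain z F' G \<epsilon> where z: "foot P w z" "z \<in> rel_interior F'" "F' face_of P" "top_face P w z = G"
      "F' \<subseteq> G" "F = F' \<or> F = G" "\<epsilon> > 0"
      "\<forall>s. s \<noteq> 0 \<longrightarrow> \<bar>s\<bar> < \<epsilon> \<longrightarrow> (y + (t + s) *\<^sub>R u \<in> open_cell P F' \<longleftrightarrow> y + (t + s) *\<^sub>R u \<in> open_cell P G)"
      using dp[OF FD] by metis
    have zF': "z \<in> F'" using z rel_interior_subset by blast
    then have "zf F = z" using zf_eq[of z F] z by auto
    then have "rel_interior F \<inter> rel_interior F' \<noteq> {}" using F z by (auto simp: D1_def)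
    then have "F = F'" using face_of_eq zfD(4)[OF FD] z by blast
    moreover have "G = g F" using \<open>zf F = z\<close> z by (simp add: g_def)
    ultimately show "\<forall>\<^sub>F s in at (0::real). y + (t + s) *\<^sub>R u \<in> open_cell P F \<longleftrightarrow>
        y + (t + s) *\<^sub>R u \<in> open_cell P (g F)"
      using z by (auto simp: eventually_at)
  qed
  show ?thesis using evN evC evD
  proof eventually_elim
    case (elim s)
    define x where "x = y + (t + s) *\<^sub>R u"
    define B where "B = {F \<in> D1. x \<in> open_cell P F}"
    have B: "B \<subseteq> D1" "finite B" using fin by (auto simp: B_def D1_def D_def)
    have "{F. x \<in> open_cell P F} = N \<union> (B \<union> g ` B)"
    proof
      show "{F. x \<in> open_cell P F} \<subseteq> N \<union> (B \<union> g ` B)"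
      proof
        fix F assume F: "F \<in> {F. x \<in> open_cell P F}"
        then have "F \<in> \<F>" using open_cell_imp_face_of[OF cP] by (auto simp: \<F>_def)
        then have "F \<in> N \<or> F \<in> D1 \<or> F \<in> D2" using elim(2) F D12 by (auto simp: x_def)
        moreover have "F \<in> g ` B" if "F \<in> D2"
        proof -
          have "F \<in> g ` D1" using that gD by simp
          then obtain F' where "F' \<in> D1" "F = g F'" by auto
          then show ?thesis using elim(3) F by (auto simp: x_def B_def)
        qed
        ultimately show "F \<in> N \<union> (B \<union> g ` B)" using F by (auto simp: B_def)
      qed
      show "N \<union> (B \<union> g ` B) \<subseteq> {F. x \<in> open_cell P F}"
        using elim by (auto simp: x_def B_def)
    qed
    moreover have "N \<inter> (B \<union> g ` B) = {}"
      using B gD D12 by (auto simp: N_def D_def)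
    moreover have "B \<inter> g ` B = {}" using B gD disj by blast
    moreover have "card (g ` B) = card B" using inj B by (meson card_image inj_on_subset)
    moreover have "finite N" using finite_subset[OF N\<F> fin] .
    ultimately have "card {F. x \<in> open_cell P F} = card N + 2 * card B"
      using B by (simp add: card_Un_disjoint)
    then show ?case by (simp add: x_def N_def w_def)
  qed
qed

text \<open>Far out, the vector from the point to any \<open>z\<close> in \<open>P\<close> is
  dominated by a large negative multiple of \<open>u\<close>, so a foot must minimise
  \<open>u\<close> on \<open>P\<close>. Transversality makes the minimising face a single
  vertex.\<close>

lemma ray_cell_count_eventually_1:
  fixes P :: "'a::euclidean_space set"
  assumes P: "polytope P" "P \<noteq> {}" and tr: "transverse_ray P y u"
  obtains t where "t > 0" "card {F. y + t *\<^sub>R u \<in> open_cell P F} = 1"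
proof -
  have cP: "convex P" "compact P" using P polytope_imp_convex polytope_imp_compact by auto
  obtain S where S: "finite S" "P = convex hull S"
    using P by (auto simp: polytope_def)
  obtain v0 where v0: "v0 \<in> P" "\<And>x. x \<in> P \<Longrightarrow> u \<bullet> v0 \<le> u \<bullet> x"
    using continuous_attains_inf[OF cP(2) P(2) continuous_on_inner[OF continuous_on_const continuous_on_id]]
    by blast
  define M where "M = P \<inter> {x. u \<bullet> x = u \<bullet> v0}"
  have M: "M face_of P" unfolding M_def
    by (rule face_of_Int_supporting_hyperplane_ge[OF cP(1)]) (use v0 in auto)
  have "compact M" "convex M" "M \<noteq> {}"
    using face_of_imp_compact[OF cP M] M face_of_imp_convex v0 by (auto simp: M_def)
  then obtain v where v: "v extreme_point_of M"
    using extreme_point_exists_convex by blast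
  then have vM: "v \<in> M" by (simp add: extreme_point_of_def)
  have vP: "v \<in> P" using vM by (simp add: M_def)
  have "{v} face_of P" using v M face_of_singleton face_of_trans by blast
  have "M = {v}"
  proof (rule ccontr)
    assume "M \<noteq> {v}"
    then have "{v} \<subset> M" using vM by auto
    then obtain e where e: "e \<in> dirs M" "e \<bullet> u \<noteq> 0"
      using transverse_rayD(1)[OF tr \<open>{v} face_of P\<close> M] by auto
    have "u \<bullet> e = 0"
      by (rule orthogonal_dirsI[OF _ e(1)]) (auto simp: M_def inner_diff_right)
    then show False using e by (simp add: inner_commute)
  qed
  then have "u \<bullet> x \<noteq> u \<bullet> v0" if "x \<in> P" "x \<noteq> v" for x
    using that by (auto simp: M_def)
  moreover have "u \<bullet> v = u \<bullet> v0" using vM by (simp add: M_def)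
  ultimately have pos: "u \<bullet> (x - v) > 0" if "x \<in> P" "x \<noteq> v" for x
    using v0(2)[OF that(1)] that by (simp add: inner_diff_right order_less_le)
  \<comment> \<open>Away from \<open>v\<close> the functional grows at least linearly:
    \<open>c\<close> is at most the least slope over the generators, and convexity of the norm
    extends the bound to \<open>P\<close>. The inserted 1 keeps the minimum defined when
    \<open>v\<close> is the only generator.\<close>
  obtain c where c: "c > 0" "\<And>s. s \<in> S \<Longrightarrow> c * norm (s - v) \<le> u \<bullet> (s - v)"
  proof -
    define c where "c = Min (insert 1 ((\<lambda>s. u \<bullet> (s - v) / norm (s - v)) ` (S - {v})))"
    have fin: "finite (insert 1 ((\<lambda>s. u \<bullet> (s - v) / norm (s - v)) ` (S - {v})))" using S by simp
    have "u \<bullet> (s - v) > 0" if "s \<in> S - {v}" for s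
      using pos that S hull_inc[of s S convex] by auto
    then have "c > 0" unfolding c_def using fin by (subst Min_gr_iff) auto
    moreover have "c * norm (s - v) \<le> u \<bullet> (s - v)" if "s \<in> S" for s
    proof (cases "s = v")
      case False
      then have "c \<le> u \<bullet> (s - v) / norm (s - v)"
        unfolding c_def using fin that by (intro Min_le) auto
      then show ?thesis using False by (simp add: pos_le_divide_eq)
    qed simp
    ultimately show ?thesis using that by blast
  qed
  have lin: "c * norm (x - v) \<le> u \<bullet> (x - v)" if "x \<in> P" for x
  proof -
    have "convex {x. c * norm (x - v) \<le> u \<bullet> (x - v)}"
    proof (rule convexI, clarify)
      fix p q and a b :: real
      assume pq: "c * norm (p - v) \<le> u \<bullet> (p - v)" "c * norm (q - v) \<le> u \<bullet> (q - v)"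
        and ab: "a \<ge> 0" "b \<ge> 0" "a + b = 1"
      have "a *\<^sub>R (p - v) + b *\<^sub>R (q - v) = a *\<^sub>R p + b *\<^sub>R q - (a + b) *\<^sub>R v"
        by (simp add: algebra_simps)
      then have eq: "a *\<^sub>R p + b *\<^sub>R q - v = a *\<^sub>R (p - v) + b *\<^sub>R (q - v)"
        using ab by simp
      have "c * norm (a *\<^sub>R (p - v) + b *\<^sub>R (q - v)) \<le> c * (a * norm (p - v) + b * norm (q - v))"
        using c ab norm_triangle_ineq[of "a *\<^sub>R (p - v)" "b *\<^sub>R (q - v)"] by (intro mult_left_mono) auto
      also have "\<dots> = a * (c * norm (p - v)) + b * (c * norm (q - v))" by (simp add: algebra_simps)
      also have "\<dots> \<le> a * (u \<bullet> (p - v)) + b * (u \<bullet> (q - v))"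
        using pq ab by (intro add_mono mult_left_mono) auto
      finally show "c * norm (a *\<^sub>R p + b *\<^sub>R q - v) \<le> u \<bullet> (a *\<^sub>R p + b *\<^sub>R q - v)"
        unfolding eq by (simp add: inner_add_right)
    qed
    then have "P \<subseteq> {x. c * norm (x - v) \<le> u \<bullet> (x - v)}"
      unfolding S(2) by (intro hull_minimal) (use c in auto)
    then show ?thesis using that by auto
  qed
  obtain B where B: "B > 0" "\<forall>x\<in>P. norm x \<le> B"
    using compact_imp_bounded[OF cP(2)] unfolding bounded_pos by auto
  define K where "K = B + norm y"
  have K: "K > 0" "\<And>x. x \<in> P \<Longrightarrow> norm (x - y) \<le> K"
    using B by (auto simp: K_def add_pos_nonneg intro: order_trans[OF norm_triangle_ineq4])
  \<comment> \<open>Beyond \<open>K / c\<close> the linear growth outweighs the contribution of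
    every \<open>p - y\<close> with \<open>p\<close> in \<open>P\<close>.\<close>
  define t where "t = K / c + 1"
  have t: "t > 0" "K < t * c" using K c by (auto simp: t_def field_simps add_pos_pos)
  have key: "(p - y) \<bullet> (x - v) < t * (u \<bullet> (x - v))" "- ((p - y) \<bullet> (x - v)) < t * (u \<bullet> (x - v))"
    if p: "p \<in> P" and x: "x \<in> P" "x \<noteq> v" for p x
  proof -
    have "\<bar>(p - y) \<bullet> (x - v)\<bar> \<le> norm (p - y) * norm (x - v)" by (rule Cauchy_Schwarz_ineq2)
    also have "\<dots> \<le> K * norm (x - v)" using K(2)[OF p] by (intro mult_right_mono) auto
    also have "\<dots> < t * c * norm (x - v)" using t x by (intro mult_strict_right_mono) auto
    also have "\<dots> \<le> t * (u \<bullet> (x - v))"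
      using lin[OF x(1)] t by (simp add: mult.assoc mult_left_mono)
    finally show "(p - y) \<bullet> (x - v) < t * (u \<bullet> (x - v))" "- ((p - y) \<bullet> (x - v)) < t * (u \<bullet> (x - v))"
      by linarith+
  qed
  have neg: "(v - (y + t *\<^sub>R u)) \<bullet> (x - v) < 0" if "x \<in> P" "x \<noteq> v" for x
    using key(1)[OF vP that] by (simp add: inner_diff_left inner_add_left)
  have top_v: "top_face P (y + t *\<^sub>R u) v = {v}"
    using neg vP by (force simp: top_face_def)
  have foot_v: "foot P (y + t *\<^sub>R u) v"
    using neg vP by (force simp: foot_def)
  have foot_eq: "z = v" if z: "foot P (y + t *\<^sub>R u) z" for z
  proof (rule ccontr)
    assume "z \<noteq> v"
    moreover have "z \<in> P" using z by (simp add: foot_def)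
    ultimately have "- ((z - y) \<bullet> (z - v)) < t * (u \<bullet> (z - v))" using key(2)[of z z] by auto
    moreover have "(z - (y + t *\<^sub>R u)) \<bullet> (v - z) \<le> 0" using z vP by (simp add: foot_def)
    ultimately show False using key(1)[of z z] \<open>z \<in> P\<close> \<open>z \<noteq> v\<close>
      by (simp add: inner_diff_left inner_diff_right inner_add_left right_diff_distrib)
  qed
  have "y + t *\<^sub>R u \<in> open_cell P F \<longleftrightarrow> F = {v}" for F
  proof
    assume "y + t *\<^sub>R u \<in> open_cell P F"
    then obtain z where "foot P (y + t *\<^sub>R u) z" "top_face P (y + t *\<^sub>R u) z = F"
      unfolding open_cell_def by blast
    then show "F = {v}" using foot_eq top_v by metis
  next
    assume "F = {v}"
    moreover have "v \<in> rel_interior {v}" by simp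
    ultimately show "y + t *\<^sub>R u \<in> open_cell P F"
      unfolding open_cell_def using foot_v top_v by blast
  qed
  then have "{F. y + t *\<^sub>R u \<in> open_cell P F} = {{v}}" by auto
  then show ?thesis using that[OF t(1)] by simp
qed

text \<open>The parity of the number of cells is locally constant on the closed half-line, hence
  constant, and odd far out. At a point without degenerate feet, feet correspond to cells through
  their exposed faces.\<close>

lemma odd_card_feet:
  fixes P :: "'a::euclidean_space set"
  assumes P: "polytope P" "P \<noteq> {}" and tr: "transverse_ray P y u"
    and nd: "\<And>z. foot P y z \<Longrightarrow> z \<in> rel_interior (top_face P y z)"
  shows "odd (card {z. foot P y z})"
proof -
  have cP: "convex P" using P polytope_imp_convex by auto
  define f where "f t = even (card {F. y + t *\<^sub>R u \<in> open_cell P F})" for t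
  have loc: "\<forall>\<^sub>F s in at (0::real). f (t + s) = f t" if "t \<ge> 0" for t
  proof (unfold f_def, rule cell_count_locally_even[OF P(1) tr])
    show "t > 0 \<or> (\<forall>H. H face_of P \<longrightarrow> y + t *\<^sub>R u \<in> closed_cell P H \<longrightarrow> y + t *\<^sub>R u \<in> open_cell P H)"
    proof (cases "t > 0")
      case False
      then have t0: "t = 0" using that by simp
      have "y \<in> open_cell P H" if H: "H face_of P" "y \<in> closed_cell P H" for H
      proof -
        obtain z where z: "z \<in> H" "foot P y z" "H \<subseteq> top_face P y z"
          using H by (auto simp: closed_cell_def)
        have "top_face P y z \<subseteq> H"
          by (rule subset_of_face_of[OF H(1)]) (use z nd in \<open>auto simp: top_face_def disjnt_iff\<close>)
        then have "top_face P y z = H" using z by auto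
        then show ?thesis using z nd[OF z(2)] by (auto simp: open_cell_def)
      qed
      then show ?thesis using t0 by simp
    qed simp
  qed
  have "f constant_on {0..}"
  proof (rule locally_constant_imp_constant)
    show "connected {0::real..}" by (simp add: connected_Ici)
    fix a :: real assume a: "a \<in> {0..}"
    then obtain d where d: "d > 0" "\<And>s. s \<noteq> 0 \<Longrightarrow> \<bar>s\<bar> < d \<Longrightarrow> f (a + s) = f a"
      using loc[of a] by (auto simp: eventually_at)
    have "f x = f a" if "x \<in> ball a d" for x
      using d(2)[of "x - a"] that by (cases "x = a") (auto simp: dist_real_def)
    then have "\<forall>x\<in>{0..} \<inter> ball a d. f x = f a" by blast
    moreover have "openin (top_of_set {0..}) ({0..} \<inter> ball a d)"
      by (rule openin_open_Int) simp
    moreover have "a \<in> {0..} \<inter> ball a d" using a d by simp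
    ultimately show "\<exists>T. openin (top_of_set {0..}) T \<and> a \<in> T \<and> (\<forall>x\<in>T. f x = f a)" by blast
  qed
  then obtain b where "\<And>s. s \<in> {0..} \<Longrightarrow> f s = b"
    unfolding constant_on_def by metis
  then have const: "f s = f 0" if "s \<ge> 0" for s
    using that by simp
  obtain t where "t > 0" "card {F. y + t *\<^sub>R u \<in> open_cell P F} = 1"
    using ray_cell_count_eventually_1[OF P tr] by metis
  then have "\<not> f 0" using const[of t] by (simp add: f_def)
  then have "odd (card {F. y \<in> open_cell P F})" by (simp add: f_def)
  moreover have "bij_betw (top_face P y) {z. foot P y z} {F. y \<in> open_cell P F}"
  proof (rule bij_betw_imageI)
    show "inj_on (top_face P y) {z. foot P y z}"
    proof (rule inj_onI)
      fix z z' assume "z \<in> {z. foot P y z}" "z' \<in> {z. foot P y z}" "top_face P y z = top_face P y z'"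
      then show "z = z'"
        using foot_unique[of z "top_face P y z" P y z'] foot_top_face_mem by blast
    qed
    show "top_face P y ` {z. foot P y z} = {F. y \<in> open_cell P F}"
      using nd by (auto simp: open_cell_def)
  qed
  ultimately show ?thesis using bij_betw_same_card by metis
qed

section \<open>Almost every point and direction is generic\<close>

lemma dim_dirs_less:
  fixes F G :: "'a::euclidean_space set"
  assumes "F face_of P" "G face_of P" "F \<noteq> {}" "F \<subset> G"
  shows "dim (dirs F) < dim (dirs G)"
proof -
  have "F face_of G" using assms face_of_subset face_of_imp_subset by blast
  then have "aff_dim F < aff_dim G"
    using face_of_aff_dim_lt[OF face_of_imp_convex[OF assms(2)]] assms by blast
  then show ?thesis using dim_dirs[of F] dim_dirs[of G] assms by force
qed

lemma exists_dirs_orthogonal_face: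
  fixes F G :: "'a::euclidean_space set"
  assumes "F face_of P" "G face_of P" "F \<noteq> {}" "F \<subset> G"
  obtains e where "e \<in> dirs G" "e \<noteq> 0" "\<And>d. d \<in> dirs F \<Longrightarrow> e \<bullet> d = 0"
  using exists_orthogonal_in_dirs[OF subspace_dirs dirs_mono[of F G]] dim_dirs_less[OF assms] assms
  by (metis less_irrefl psubset_imp_subset)

lemma negligible_finite_pairs:
  fixes P :: "'a::euclidean_space set"
  assumes P: "polytope P"
    and "\<And>F G. F face_of P \<Longrightarrow> G face_of P \<Longrightarrow> negligible (X F G)"
  shows "negligible (\<Union>(F, G) \<in> {F. F face_of P} \<times> {G. G face_of P}. X F G)"
  by (rule negligible_Union) (use finite_polytope_faces[OF P] assms(2) in auto)

text \<open>A degenerate foot puts \<open>y\<close> into the sum of \<open>F\<close> and the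
  orthogonal complement of \<open>dirs G\<close>, for faces \<open>F \<subset> G\<close>. A non-zero
  \<open>e\<close> in \<open>dirs G\<close> orthogonal to \<open>dirs F\<close> is constant on this
  sum, which therefore lies in a hyperplane.\<close>

lemma negligible_degenerate_feet:
  fixes P :: "'a::euclidean_space set"
  assumes P: "polytope P"
  shows "negligible {y. \<exists>z. foot P y z \<and> z \<notin> rel_interior (top_face P y z)}"
proof -
  have cP: "convex P" using P polytope_imp_convex by auto
  define X where "X F G = (if F \<noteq> {} \<and> F \<subset> G then {y. \<exists>z\<in>F. \<forall>d\<in>dirs G. (z - y) \<bullet> d = 0} else {})"
    for F G :: "'a set"
  have "negligible (X F G)" if FG: "F face_of P" "G face_of P" for F G
  proof (cases "F \<noteq> {} \<and> F \<subset> G")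
    case True
    then obtain e where e: "e \<in> dirs G" "e \<noteq> 0" "\<And>d. d \<in> dirs F \<Longrightarrow> e \<bullet> d = 0"
      using exists_dirs_orthogonal_face[OF FG] by blast
    obtain z0 where z0: "z0 \<in> F" using True by auto
    have "X F G \<subseteq> {y. e \<bullet> y = e \<bullet> z0}"
    proof
      fix y assume "y \<in> X F G"
      then obtain z where z: "z \<in> F" "(z - y) \<bullet> e = 0" using True e by (auto simp: X_def)
      have "e \<bullet> (z - z0) = 0" using e(3) diff_in_dirs[OF z(1) z0] by auto
      then show "y \<in> {y. e \<bullet> y = e \<bullet> z0}"
        using z(2) by (simp add: inner_diff_left inner_diff_right inner_commute)
    qed
    then show ?thesis using negligible_subset[OF negligible_hyperplane] e(2) by blast
  qed (auto simp: X_def)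
  then have "negligible (\<Union>(F, G) \<in> {F. F face_of P} \<times> {G. G face_of P}. X F G)"
    by (rule negligible_finite_pairs[OF P])
  moreover have "{y. \<exists>z. foot P y z \<and> z \<notin> rel_interior (top_face P y z)} \<subseteq>
      (\<Union>(F, G) \<in> {F. F face_of P} \<times> {G. G face_of P}. X F G)"
  proof clarify
    fix y z assume z: "foot P y z" "z \<notin> rel_interior (top_face P y z)"
    have "z \<in> P" using z by (simp add: foot_def)
    then obtain F where F: "F face_of P" "z \<in> rel_interior F"
      using exists_face_rel_interior[OF P] by metis
    have zF: "z \<in> F" using F rel_interior_subset by blast
    have "F \<subseteq> top_face P y z"
      using face_subset_top_face[OF cP z(1) F(2) face_of_imp_subset[OF F(1)]] .
    then have "F \<subset> top_face P y z" using F z by auto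
    moreover have "\<forall>d\<in>dirs (top_face P y z). (z - y) \<bullet> d = 0"
      using top_face_orthogonal by blast
    ultimately have "y \<in> X F (top_face P y z)" using zF by (auto simp: X_def)
    then show "y \<in> (\<Union>(F, G) \<in> {F. F face_of P} \<times> {G. G face_of P}. X F G)"
      using F(1) face_of_top_face[OF cP z(1)] by blast
  qed
  ultimately show ?thesis by (rule negligible_subset)
qed

text \<open>The set to be avoided has codimension at least two, so the directions of the rays from
  \<open>y\<close> that hit it lie in a hyperplane.\<close>

lemma negligible_hits_codim_2:
  fixes F G :: "'a::euclidean_space set"
  assumes FG: "F face_of P" "G face_of P" "F \<noteq> {}" "F \<subset> G" and dim: "aff_dim G \<noteq> aff_dim F + 1"
  shows "negligible {u. \<exists>t>0. \<exists>z\<in>F. \<forall>d\<in>dirs G. (y + t *\<^sub>R u - z) \<bullet> d = 0}"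
proof -
  obtain e1 where e1: "e1 \<in> dirs G" "e1 \<noteq> 0" "\<And>d. d \<in> dirs F \<Longrightarrow> e1 \<bullet> d = 0"
    using exists_dirs_orthogonal_face[OF FG] by blast
  define D where "D = span (insert e1 (dirs F))"
  have "dim D \<le> dim (dirs F) + 1" by (simp add: D_def dim_insert)
  moreover have "dim (dirs F) + 1 < dim (dirs G)"
    using dim_dirs_less[OF FG] dim dim_dirs[of F] dim_dirs[of G] FG by force
  ultimately have "D \<noteq> dirs G" by auto
  moreover have "D \<subseteq> dirs G" unfolding D_def
    by (rule span_minimal) (use e1 dirs_mono[of F G] FG in auto)
  ultimately obtain e2 where e2: "e2 \<in> dirs G" "e2 \<noteq> 0" "\<And>d. d \<in> D \<Longrightarrow> e2 \<bullet> d = 0"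
    using exists_orthogonal_in_dirs[of D G] by (metis D_def subspace_span)
  have e12: "e2 \<bullet> e1 = 0" using e2(3)[of e1] by (simp add: D_def span_base)
  have e2F: "e2 \<bullet> d = 0" if "d \<in> dirs F" for d using e2(3)[of d] that by (simp add: D_def span_base)
  obtain z0 where z0: "z0 \<in> F" using FG by auto
  define c1 where "c1 = e1 \<bullet> (y - z0)"
  define c2 where "c2 = e2 \<bullet> (y - z0)"
  \<comment> \<open>At a hit, \<open>c1\<close> and \<open>c2\<close> are the same multiple of
    \<open>e1 \<bullet> u\<close> and \<open>e2 \<bullet> u\<close>, so the combination below
    annihilates \<open>u\<close>. If \<open>c1\<close> and \<open>c2\<close> both vanish, this
    combination is zero, but then \<open>e1\<close> annihilates \<open>u\<close>.\<close>
  define w where "w = (if c1 = 0 \<and> c2 = 0 then e1 else c1 *\<^sub>R e2 - c2 *\<^sub>R e1)"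
  have "w \<noteq> 0"
  proof
    assume w: "w = 0"
    have n: "\<not> (c1 = 0 \<and> c2 = 0)" using w e1 by (auto simp: w_def)
    then have eq: "c1 *\<^sub>R e2 - c2 *\<^sub>R e1 = 0" using w unfolding w_def by (metis (full_types))
    have "(c1 *\<^sub>R e2 - c2 *\<^sub>R e1) \<bullet> e2 = c1 * (e2 \<bullet> e2)" "(c1 *\<^sub>R e2 - c2 *\<^sub>R e1) \<bullet> e1 = - c2 * (e1 \<bullet> e1)"
      using e12 by (simp_all add: inner_diff_left inner_commute[of e1 e2])
    then show False using n e1 e2 unfolding eq by auto
  qed
  have "{u. \<exists>t>0. \<exists>z\<in>F. \<forall>d\<in>dirs G. (y + t *\<^sub>R u - z) \<bullet> d = 0} \<subseteq> {u. w \<bullet> u = 0}"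
  proof clarify
    fix u z and t :: real
    assume t: "t > 0" and z: "z \<in> F" and d: "\<forall>d\<in>dirs G. (y + t *\<^sub>R u - z) \<bullet> d = 0"
    have "e1 \<bullet> (z - z0) = 0" "e2 \<bullet> (z - z0) = 0"
      using e1(3) e2F diff_in_dirs[OF z z0] by auto
    moreover have "(y + t *\<^sub>R u - z) \<bullet> e1 = 0" "(y + t *\<^sub>R u - z) \<bullet> e2 = 0" using d e1 e2 by auto
    ultimately have c: "c1 = - t * (e1 \<bullet> u)" "c2 = - t * (e2 \<bullet> u)"
      by (simp_all add: c1_def c2_def inner_diff_left inner_diff_right inner_add_left inner_add_right inner_commute)
    show "w \<bullet> u = 0"
    proof (cases "c1 = 0 \<and> c2 = 0")
      case True then show ?thesis using c t by (simp add: w_def)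
    next
      case False
      then have "w \<bullet> u = c1 * (e2 \<bullet> u) - c2 * (e1 \<bullet> u)" by (auto simp: w_def inner_diff_left)
      then show ?thesis unfolding c by simp
    qed
  qed
  then show ?thesis using negligible_subset[OF negligible_hyperplane] \<open>w \<noteq> 0\<close> by blast
qed

lemma negligible_not_transverse:
  fixes P :: "'a::euclidean_space set"
  assumes P: "polytope P"
  shows "negligible {u. \<not> transverse_ray P y u}"
proof -
  define X where "X F G = (if F \<noteq> {} \<and> F \<subset> G then
      {u. \<forall>e\<in>dirs G. (\<forall>d\<in>dirs F. e \<bullet> d = 0) \<longrightarrow> e \<bullet> u = 0} \<union>
      (if aff_dim G = aff_dim F + 1 then {} else
        {u. \<exists>t>0. \<exists>z\<in>F. \<forall>d\<in>dirs G. (y + t *\<^sub>R u - z) \<bullet> d = 0}) else {})"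
    for F G :: "'a set"
  have "negligible (X F G)" if FG: "F face_of P" "G face_of P" for F G
  proof (cases "F \<noteq> {} \<and> F \<subset> G")
    case True
    then obtain e where e: "e \<in> dirs G" "e \<noteq> 0" "\<And>d. d \<in> dirs F \<Longrightarrow> e \<bullet> d = 0"
      using exists_dirs_orthogonal_face[OF FG] by blast
    have "{u. \<forall>e\<in>dirs G. (\<forall>d\<in>dirs F. e \<bullet> d = 0) \<longrightarrow> e \<bullet> u = 0} \<subseteq> {u. e \<bullet> u = 0}"
      using e by auto
    then have "negligible {u. \<forall>e\<in>dirs G. (\<forall>d\<in>dirs F. e \<bullet> d = 0) \<longrightarrow> e \<bullet> u = 0}"
      using negligible_subset[OF negligible_hyperplane] e(2) by blast
    then show ?thesis
      using negligible_hits_codim_2[OF FG] True by (auto simp: X_def intro: negligible_Un)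
  qed (auto simp: X_def)
  then have "negligible (\<Union>(F, G) \<in> {F. F face_of P} \<times> {G. G face_of P}. X F G)"
    by (rule negligible_finite_pairs[OF P])
  moreover have "{u. \<not> transverse_ray P y u} \<subseteq>
      (\<Union>(F, G) \<in> {F. F face_of P} \<times> {G. G face_of P}. X F G)"
  proof
    fix u assume "u \<in> {u. \<not> transverse_ray P y u}"
    then obtain F G where FG: "F face_of P" "G face_of P" "F \<noteq> {}" "F \<subset> G"
      "\<not> ((\<exists>e\<in>dirs G. (\<forall>d\<in>dirs F. e \<bullet> d = 0) \<and> e \<bullet> u \<noteq> 0) \<and>
        (aff_dim G \<noteq> aff_dim F + 1 \<longrightarrow> (\<forall>t>0. \<forall>z\<in>F. \<exists>d\<in>dirs G. (y + t *\<^sub>R u - z) \<bullet> d \<noteq> 0)))"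
      unfolding transverse_ray_def by blast
    then have "u \<in> X F G" unfolding X_def by auto
    then show "u \<in> (\<Union>(F, G) \<in> {F. F face_of P} \<times> {G. G face_of P}. X F G)"
      using FG by blast
  qed
  ultimately show ?thesis by (rule negligible_subset)
qed

text \<open>A transverse direction exists at every point, so only points with a degenerate foot can
  have an even count.\<close>

lemma negligible_even_card_feet:
  fixes P :: "'a::euclidean_space set"
  assumes P: "polytope P" "P \<noteq> {}"
  shows "negligible {y. even (card {z. foot P y z})}"
proof (rule negligible_subset[OF negligible_degenerate_feet[OF P(1)]], clarify)
  fix y assume ev: "even (card {z. foot P y z})"
  have "{u. \<not> transverse_ray P y u} \<noteq> UNIV"
    using negligible_not_transverse[OF P(1), of y] by auto
  then obtain u where "transverse_ray P y u" by auto
  then show "\<exists>z. foot P y z \<and> z \<notin> rel_interior (top_face P y z)"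
    using odd_card_feet[OF P] ev by blast
qed

text \<open>A foot is determined by the face that carries it in its relative interior. The bound is
  uniform in \<open>y\<close>, so that the maximum in \<open>max_normals\<close> is taken over a
  finite set.\<close>

lemma card_feet_le:
  fixes P :: "'a::euclidean_space set"
  assumes P: "polytope P"
  shows "finite {z. foot P y z}" "card {z. foot P y z} \<le> card {F. F face_of P}"
proof -
  have cP: "convex P" using P polytope_imp_convex by auto
  define f where "f z = (SOME F. F face_of P \<and> z \<in> rel_interior F)" for z
  have f: "f z face_of P \<and> z \<in> rel_interior (f z)" if "foot P y z" for z
  proof -
    have "\<exists>F. F face_of P \<and> z \<in> rel_interior F"
      using exists_face_rel_interior[OF P, of z] that by (auto simp: foot_def)
    then show ?thesis unfolding f_def by (rule someI_ex)
  qed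
  have inj: "inj_on f {z. foot P y z}"
  proof (rule inj_onI)
    fix z z' assume "z \<in> {z. foot P y z}" "z' \<in> {z. foot P y z}" and eq: "f z = f z'"
    then have z: "foot P y z" "foot P y z'" by auto
    have "z \<in> f z" "z' \<in> f z" using f[OF z(1)] f[OF z(2)] eq rel_interior_subset by (metis subsetD)+
    moreover have "f z \<subseteq> top_face P y z" "f z \<subseteq> top_face P y z'"
      using face_subset_top_face[OF cP z(1)] face_subset_top_face[OF cP z(2)] f[OF z(1)] f[OF z(2)]
        face_of_imp_subset eq by metis+
    ultimately show "z = z'" by (intro foot_unique[of z "f z" P y z'])
  qed
  have sub: "f ` {z. foot P y z} \<subseteq> {F. F face_of P}" using f by auto
  show "finite {z. foot P y z}" "card {z. foot P y z} \<le> card {F. F face_of P}"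
    using inj_on_finite[OF inj sub] card_inj_on_le[OF inj sub] finite_polytope_faces[OF P] by auto
qed

text \<open>A foot exposes only one face, so distinct cells need distinct feet.\<close>

lemma card_cells_le_card_feet:
  fixes P :: "'a::euclidean_space set"
  assumes P: "polytope P" and y: "\<And>F. F \<in> \<F> \<Longrightarrow> y \<in> open_cell P F"
  shows "card \<F> \<le> card {z. foot P y z}"
proof (rule surj_card_le[OF card_feet_le(1)[OF P]])
  show "\<F> \<subseteq> top_face P y ` {z. foot P y z}"
    using y by (fastforce simp: open_cell_def)
qed

lemma dirs_eq_UNIV:
  fixes P :: "'a::euclidean_space set"
  assumes "interior P \<noteq> {}"
  shows "dirs P = UNIV"
proof -
  have "aff_dim P = DIM('a)" using assms by (simp add: aff_dim_nonempty_interior)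
  moreover have "P \<noteq> {}" using assms interior_subset by auto
  ultimately have "dim (dirs P) = DIM('a)" using dim_dirs[of P] by simp
  then show ?thesis by (metis dim_eq_full span_eq_iff subspace_dirs)
qed

lemma top_face_full_imp_eq:
  fixes P :: "'a::euclidean_space set"
  assumes "interior P \<noteq> {}" "P \<subseteq> top_face P y z"
  shows "z = y"
proof -
  have "(z - y) \<bullet> (z - y) = 0"
    using top_face_orthogonal[OF assms(2)] dirs_eq_UNIV[OF assms(1)] by blast
  then show ?thesis by simp
qed

lemma open_cell_self:
  fixes P :: "'a::euclidean_space set"
  assumes "interior P \<noteq> {}"
  shows "open_cell P P = interior P"
proof
  have ri: "rel_interior P = interior P" using assms by (rule rel_interior_nonempty_interior)
  show "open_cell P P \<subseteq> interior P"
  proof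
    fix y assume "y \<in> open_cell P P"
    then obtain z where "z \<in> rel_interior P" "top_face P y z = P" by (auto simp: open_cell_def)
    then show "y \<in> interior P" using top_face_full_imp_eq[OF assms, of y z] ri by auto
  qed
  show "interior P \<subseteq> open_cell P P"
  proof
    fix y assume y: "y \<in> interior P"
    have "foot P y y" "top_face P y y = P"
      using y interior_subset by (auto simp: foot_def top_face_def)
    then show "y \<in> open_cell P P" using y ri by (auto simp: open_cell_def)
  qed
qed

section \<open>Leaving a family of cells\<close>

text \<open>A family of cells that all meet the start of a ray cannot be left without first entering the cell
  of a face outside the family, unless the two faces of a degenerate pair both belong to it.\<close>

lemma extra_cell_on_ray:
  fixes P :: "'a::euclidean_space set"
  assumes P: "polytope P" "interior P \<noteq> {}" and tr: "transverse_ray P y u" and u: "u \<noteq> 0"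
    and fin: "finite \<F>" and P\<F>: "P \<in> \<F>"
    and start: "\<forall>\<^sub>F t in at_right 0. \<forall>F\<in>\<F>. y + t *\<^sub>R u \<in> open_cell P F"
    and no_pair: "\<And>t z F G. t > 0 \<Longrightarrow> (\<And>H. H \<in> \<F> \<Longrightarrow> y + t *\<^sub>R u \<in> closed_cell P H) \<Longrightarrow>
      F \<in> \<F> \<Longrightarrow> G \<in> \<F> \<Longrightarrow> foot P (y + t *\<^sub>R u) z \<Longrightarrow> z \<in> F \<Longrightarrow> F \<subseteq> G \<Longrightarrow>
      top_face P (y + t *\<^sub>R u) z = G \<Longrightarrow> aff_dim G = aff_dim F + 1 \<Longrightarrow> False"
  obtains t H where "H \<notin> \<F>" "\<And>F. F \<in> insert H \<F> \<Longrightarrow> y + t *\<^sub>R u \<in> open_cell P F"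
proof -
  have cP: "convex P" "compact P" using P polytope_imp_convex polytope_imp_compact by auto
  define A where "A = {t. t > 0 \<and> (\<forall>s. 0 < s \<longrightarrow> s \<le> t \<longrightarrow> (\<forall>F\<in>\<F>. y + s *\<^sub>R u \<in> open_cell P F))}"
  obtain \<delta> where \<delta>: "\<delta> > 0" "\<And>t. 0 < t \<Longrightarrow> t < \<delta> \<Longrightarrow> \<forall>F\<in>\<F>. y + t *\<^sub>R u \<in> open_cell P F"
    using start unfolding eventually_at_right_field by auto
  have "\<delta> / 2 \<in> A" using \<delta> by (auto simp: A_def)
  then have ne: "A \<noteq> {}" by auto
  obtain B where B: "\<forall>x\<in>P. norm x \<le> B" using compact_imp_bounded[OF cP(2)] by (auto simp: bounded_iff)
  \<comment> \<open>As \<open>P\<close> belongs to the family, the ray stays in the interior of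
    \<open>P\<close> while the family lasts, which bounds the time.\<close>
  have le: "t \<le> (B + norm y) / norm u" if t: "t \<in> A" for t
  proof -
    have "y + t *\<^sub>R u \<in> P"
      using t P\<F> open_cell_self[OF P(2)] interior_subset[of P] by (force simp: A_def)
    then have "norm (y + t *\<^sub>R u) \<le> B" using B by auto
    moreover have "norm (t *\<^sub>R u) \<le> norm (y + t *\<^sub>R u) + norm y"
      by (metis add_diff_cancel_left' norm_triangle_ineq4)
    ultimately have "t * norm u \<le> B + norm y" using t by (simp add: A_def)
    then show ?thesis using u by (simp add: pos_le_divide_eq)
  qed
  then have bdd: "bdd_above A" by (auto simp: bdd_above_def)
  define T where "T = Sup A"
  have T0: "T > 0" using cSup_upper[OF \<open>\<delta> / 2 \<in> A\<close> bdd] \<delta> by (simp add: T_def)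
  have before: "y + s *\<^sub>R u \<in> open_cell P F" if "0 < s" "s < T" "F \<in> \<F>" for s F
  proof -
    have "\<exists>t\<in>A. s < t" using less_cSupD[OF ne] \<open>s < T\<close> by (simp add: T_def)
    then show ?thesis using that by (auto simp: A_def)
  qed
  have closed: "y + T *\<^sub>R u \<in> closed_cell P H" if H: "H \<in> \<F>" for H
  proof -
    have HP: "H face_of P" using open_cell_imp_face_of[OF cP(1) before[of "T/2" H]] T0 H by auto
    have "closed (closed_cell P H)"
      by (rule closed_closed_cell[OF face_of_imp_compact[OF cP HP] face_of_imp_subset[OF HP]])
    then have "closed ((\<lambda>s. y + s *\<^sub>R u) -` closed_cell P H)"
      by (rule continuous_closed_vimage) (intro continuous_intros)
    moreover have "{0<..<T} \<subseteq> (\<lambda>s. y + s *\<^sub>R u) -` closed_cell P H"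
      using before H open_cell_subset_closed_cell by fastforce
    ultimately have "closure {0<..<T} \<subseteq> (\<lambda>s. y + s *\<^sub>R u) -` closed_cell P H"
      by (metis closure_minimal)
    then show ?thesis using T0 by (auto simp: subset_iff)
  qed
  have "\<exists>F\<in>\<F>. y + T *\<^sub>R u \<notin> open_cell P F"
  proof (rule ccontr)
    assume "\<not> ?thesis"
    then have all: "\<forall>F\<in>\<F>. y + T *\<^sub>R u \<in> open_cell P F" by auto
    have "\<forall>\<^sub>F s in at 0. \<forall>F\<in>\<F>. y + (T + s) *\<^sub>R u \<in> open_cell P F"
      using fin all by (intro eventually_ball_finite ballI topological_tendstoD[OF tendsto_ray] open_open_cell P) auto
    then obtain d where d: "d > 0" "\<And>s. s \<noteq> 0 \<Longrightarrow> \<bar>s\<bar> < d \<Longrightarrow> \<forall>F\<in>\<F>. y + (T + s) *\<^sub>R u \<in> open_cell P F"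
      by (auto simp: eventually_at)
    have "\<forall>F\<in>\<F>. y + s *\<^sub>R u \<in> open_cell P F" if s: "0 < s" "s \<le> T + d / 2" for s
    proof (cases "s < T")
      case False
      then show ?thesis using d(2)[of "s - T"] d(1) s all by (cases "s = T") auto
    qed (use before s in auto)
    then have "T + d / 2 \<in> A" using T0 d by (auto simp: A_def)
    then show False using cSup_upper[OF _ bdd, of "T + d / 2"] d by (simp add: T_def)
  qed
  then obtain H where H: "H \<in> \<F>" "y + T *\<^sub>R u \<notin> open_cell P H" by auto
  have HP: "H face_of P" using open_cell_imp_face_of[OF cP(1) before[of "T/2" H]] T0 H by auto
  obtain z F G and \<sigma> \<epsilon> :: real where z: "foot P (y + T *\<^sub>R u) z" "z \<in> rel_interior F" "F face_of P"
    "top_face P (y + T *\<^sub>R u) z = G" "F \<subseteq> G" "aff_dim G = aff_dim F + 1" "H = F \<or> H = G"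
    and \<epsilon>: "\<epsilon> > 0"
    and cells: "\<And>s H'. s \<noteq> 0 \<Longrightarrow> \<bar>s\<bar> < \<epsilon> \<Longrightarrow> H' = F \<or> H' = G \<Longrightarrow>
       y + (T + s) *\<^sub>R u \<in> open_cell P H' \<longleftrightarrow> \<sigma> * s > 0"
    by (rule degenerate_pair[OF P(1) tr T0 HP closed[OF H(1)] H(2)]) blast
  have zF: "z \<in> F" using z rel_interior_subset by blast
  have "F \<notin> \<F> \<or> G \<notin> \<F>"
    using no_pair[OF T0 closed _ _ z(1) zF z(5,4,6)] by blast
  then obtain H' where H': "H' \<notin> \<F>" "H' = F \<or> H' = G" by blast
  \<comment> \<open>A small step back from the exit time: \<open>H\<close> still has its cell there,
    and its partner has one exactly when \<open>H\<close> does.\<close>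
  define s where "s = - (min \<epsilon> T / 2)"
  have s: "s \<noteq> 0" "\<bar>s\<bar> < \<epsilon>" "0 < T + s" "T + s < T" using \<epsilon> T0 by (auto simp: s_def min_def)
  have "y + (T + s) *\<^sub>R u \<in> open_cell P H" using before s H by auto
  then have "y + (T + s) *\<^sub>R u \<in> open_cell P H'" using cells[OF s(1,2)] z(7) H'(2) by blast
  then show ?thesis using that[OF H'(1), of "T + s"] before s by blast
qed

section \<open>Counting normals by feet\<close>

lemma is_normal_iff_foot:
  assumes "y \<in> interior P"
  shows "is_normal P y z \<longleftrightarrow> foot P y z \<and> z \<noteq> y"
proof
  assume "is_normal P y z"
  then obtain a b c where a: "a \<noteq> 0" "\<forall>x\<in>P. a \<bullet> x \<le> b" "z \<in> P" "a \<bullet> z = b" "z - y = c *\<^sub>R a"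
    by (auto simp: is_normal_def)
  have "P \<subseteq> {x. a \<bullet> x \<le> b}" using a by auto
  then have "y \<in> interior {x. a \<bullet> x \<le> b}" using assms interior_mono by blast
  \<comment> \<open>An interior point is strictly below the support plane; this makes
    \<open>c\<close> positive and \<open>z - y\<close> an outer normal.\<close>
  then have "a \<bullet> y < b" using a by (simp add: interior_halfspace_le)
  then have "c * (a \<bullet> a) > 0" using a by (metis diff_gt_0_iff_gt inner_diff_right inner_scaleR_right)
  then have c: "c > 0" by (metis inner_ge_zero zero_less_mult_pos2 less_eq_real_def mult_zero_right order_less_irrefl)
  have "(z - y) \<bullet> (x - z) \<le> 0" if "x \<in> P" for x
    unfolding a(5) using a(2,4) that c by (simp add: inner_diff_right mult_le_0_iff)
  moreover have "z \<noteq> y" using a c by auto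
  ultimately show "foot P y z \<and> z \<noteq> y" using a by (auto simp: foot_def)
next
  assume "foot P y z \<and> z \<noteq> y"
  then show "is_normal P y z"
    unfolding is_normal_def foot_def
    by (intro exI[of _ "z - y"] exI[of _ "(z - y) \<bullet> z"]) (auto simp: inner_diff_right intro: exI[of _ 1])
qed

lemma normal_count_eq:
  assumes "polytope P" "y \<in> interior P"
  shows "normal_count P y = card {z. foot P y z} - 1"
proof -
  have "foot P y y" using assms interior_subset by (auto simp: foot_def)
  moreover have "{z. is_normal P y z} = {z. foot P y z} - {y}"
    using is_normal_iff_foot[OF assms(2)] by auto
  ultimately show ?thesis
    unfolding normal_count_def using card_feet_le(1)[OF assms(1), of y] by simp
qed

text \<open>Counting the interior point itself as a foot, the number of feet is odd for almost every point, so
  ten cells force an eleventh foot.\<close>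

lemma max_normals_ge_10:
  assumes P: "polytope P" "interior P \<noteq> {}" and fin: "finite \<F>" "P \<in> \<F>" "card \<F> \<ge> 10"
    and y: "\<And>F. F \<in> \<F> \<Longrightarrow> y \<in> open_cell P F"
  shows "max_normals P \<ge> 10"
proof -
  have ne: "P \<noteq> {}" using P interior_subset by auto
  define U where "U = (\<Inter>F\<in>\<F>. open_cell P F)"
  have "open U" unfolding U_def using fin P open_open_cell by (intro open_INT) auto
  moreover have "U \<noteq> {}" using y by (auto simp: U_def)
  ultimately have "\<not> negligible U" using open_not_negligible by blast
  then obtain x where x: "x \<in> U" "odd (card {z. foot P x z})"
    using negligible_subset[OF negligible_even_card_feet[OF P(1) ne], of U] by auto
  have "card \<F> \<le> card {z. foot P x z}"
    by (rule card_cells_le_card_feet[OF P(1)]) (use x in \<open>auto simp: U_def\<close>)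
  then have "card {z. foot P x z} \<ge> 11" using fin x(2) by (cases "card {z. foot P x z} = 10") auto
  moreover have xP: "x \<in> interior P" using x(1) fin(2) open_cell_self[OF P(2)] by (auto simp: U_def)
  ultimately have "normal_count P x \<ge> 10" using normal_count_eq[OF P(1)] by simp
  moreover have "normal_count P x \<le> max_normals P"
    unfolding max_normals_def
  proof (rule Max_ge)
    have "normal_count P ` interior P \<subseteq> {..card {F. F face_of P}}"
      using normal_count_eq[OF P(1)] card_feet_le(2)[OF P(1)] by (force intro: order_trans[OF diff_le_self])
    then show "finite (normal_count P ` interior P)" by (rule finite_subset) simp
  qed (use xP in simp)
  ultimately show ?thesis by simp
qed

section \<open>Simplicial vertices\<close>

text \<open>\<open>d\<close> is the basis dual to the edge directions \<open>Bs\<close>. By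
  \<open>in_cone\<close> all of \<open>P\<close> lies in the cone at \<open>V\<close> generated by
  \<open>Bs\<close>, and by \<open>near\<close> this cone is filled by \<open>P\<close> within
  radius \<open>\<rho>\<close>.\<close>

locale simplicial_vertex =
  fixes P :: "'a::euclidean_space set" and V :: 'a and Bs :: "'a set" and d :: "'a \<Rightarrow> 'a" and \<rho> :: real
  assumes P: "polytope P" "interior P \<noteq> {}"
    and finite_Bs: "finite Bs"
    and dual: "S \<in> Bs \<Longrightarrow> T \<in> Bs \<Longrightarrow> d S \<bullet> T = (if S = T then 1 else 0)"
    and expand: "x = (\<Sum>S\<in>Bs. (d S \<bullet> x) *\<^sub>R S)"
    and in_cone: "x \<in> P \<Longrightarrow> S \<in> Bs \<Longrightarrow> d S \<bullet> (x - V) \<ge> 0"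
    and \<rho>: "\<rho> > 0"
    and near: "(\<And>S. S \<in> Bs \<Longrightarrow> d S \<bullet> p \<ge> 0) \<Longrightarrow> norm p < \<rho> \<Longrightarrow> V + p \<in> P"
begin

text \<open>The face at \<open>V\<close> spanned by the directions in \<open>J\<close>. It is
  recognised as a face of \<open>P\<close> only through its non-empty cell.\<close>

definition face :: "'a set \<Rightarrow> 'a set" where
  "face J = {x \<in> P. \<forall>S\<in>Bs - J. d S \<bullet> (x - V) = 0}"

lemma V_in_P: "V \<in> P"
  using near[of 0] \<rho> by simp

lemma V_in_face: "V \<in> face J"
  using V_in_P by (simp add: face_def)

lemma face_Bs: "face Bs = P"
  by (simp add: face_def)

lemma dual_sum:
  assumes "J \<subseteq> Bs" "S \<in> Bs"
  shows "d S \<bullet> (\<Sum>T\<in>J. c T *\<^sub>R T) = (if S \<in> J then c S else 0)"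
proof -
  have "finite J" using assms finite_Bs finite_subset by auto
  have "d S \<bullet> (\<Sum>T\<in>J. c T *\<^sub>R T) = (\<Sum>T\<in>J. if S = T then c T else 0)"
    unfolding inner_sum_right inner_scaleR_right
    by (rule sum.cong) (use assms dual in auto)
  then show ?thesis using \<open>finite J\<close> by simp
qed

lemma inner_expand: "n \<bullet> x = (\<Sum>S\<in>Bs. (d S \<bullet> x) * (n \<bullet> S))"
proof -
  have "n \<bullet> x = n \<bullet> (\<Sum>S\<in>Bs. (d S \<bullet> x) *\<^sub>R S)" using expand[of x] by simp
  then show ?thesis by (simp add: inner_sum_right)
qed

lemma corner_in_face:
  assumes J: "J \<subseteq> Bs" and c: "\<And>S. S \<in> J \<Longrightarrow> c S \<ge> 0" and q: "norm (\<Sum>S\<in>J. c S *\<^sub>R S) < \<rho>"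
  shows "V + (\<Sum>S\<in>J. c S *\<^sub>R S) \<in> face J"
proof -
  have "V + (\<Sum>S\<in>J. c S *\<^sub>R S) \<in> P"
    by (rule near[OF _ q]) (simp add: dual_sum[OF J] c)
  then show ?thesis using dual_sum[OF J] by (simp add: face_def)
qed

text \<open>Positive coordinates in \<open>J\<close> and closeness to \<open>V\<close> are open
  conditions; within the affine hull of the face they already imply membership.\<close>

lemma corner_rel_interior:
  assumes J: "J \<subseteq> Bs" and c: "\<And>S. S \<in> J \<Longrightarrow> c S > 0" and q: "norm (\<Sum>S\<in>J. c S *\<^sub>R S) < \<rho>"
  shows "V + (\<Sum>S\<in>J. c S *\<^sub>R S) \<in> rel_interior (face J)"
proof -
  let ?z = "V + (\<Sum>S\<in>J. c S *\<^sub>R S)"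
  have fJ: "finite J" using J finite_Bs finite_subset by auto
  define T where "T = (\<Inter>S\<in>J. {x. d S \<bullet> (x - V) > 0}) \<inter> ball V \<rho>"
  have "open T" unfolding T_def
    by (intro open_Int open_INT ballI fJ open_Collect_less continuous_intros open_ball)
  moreover have "?z \<in> face J" using corner_in_face[OF J _ q] c less_imp_le by blast
  moreover have "?z \<in> T"
    using dual_sum[OF J] c q J by (auto simp: T_def subset_iff dist_norm)
  moreover have "T \<inter> affine hull face J \<subseteq> face J"
  proof
    fix x assume x: "x \<in> T \<inter> affine hull face J"
    have "affine {x. d S \<bullet> (x - V) = 0}" for S
      using affine_hyperplane[of "d S" "d S \<bullet> V"] by (simp add: inner_diff_right)
    then have "affine (\<Inter>S\<in>Bs - J. {x. d S \<bullet> (x - V) = 0})"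
      by (intro affine_Inter) auto
    then have "affine hull face J \<subseteq> (\<Inter>S\<in>Bs - J. {x. d S \<bullet> (x - V) = 0})"
      by (intro hull_minimal) (auto simp: face_def)
    then have zero: "d S \<bullet> (x - V) = 0" if "S \<in> Bs - J" for S using x that by auto
    have "d S \<bullet> (x - V) \<ge> 0" if "S \<in> Bs" for S
      using zero[of S] x that by (cases "S \<in> J") (auto simp: T_def intro: less_imp_le)
    then have "V + (x - V) \<in> P"
      by (rule near) (use x in \<open>auto simp: T_def dist_norm norm_minus_commute\<close>)
    then show "x \<in> face J" using zero by (simp add: face_def)
  qed
  ultimately show ?thesis unfolding mem_rel_interior by blast
qed

text \<open>In dual coordinates \<open>n \<bullet> (x - V)\<close> is a sum of non-negative
  coordinates times the numbers \<open>n \<bullet> S\<close>, none of which is positive. So sign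
  conditions on the edge directions alone give a foot for all of \<open>P\<close>, and the sum
  vanishes exactly on the face.\<close>

lemma corner_cell:
  assumes J: "J \<subseteq> Bs" and c: "\<And>S. S \<in> J \<Longrightarrow> c S > 0" and q: "norm (\<Sum>S\<in>J. c S *\<^sub>R S) < \<rho>"
    and eq: "\<And>S. S \<in> J \<Longrightarrow> (V + (\<Sum>S\<in>J. c S *\<^sub>R S) - y) \<bullet> S = 0"
    and lt: "\<And>S. S \<in> Bs \<Longrightarrow> S \<notin> J \<Longrightarrow> (V + (\<Sum>S\<in>J. c S *\<^sub>R S) - y) \<bullet> S < 0"
  shows "y \<in> open_cell P (face J)"
proof -
  define z where "z = V + (\<Sum>S\<in>J. c S *\<^sub>R S)"
  define n where "n = z - y"
  have zr: "z \<in> rel_interior (face J)" unfolding z_def by (rule corner_rel_interior[OF J c q])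
  then have zF: "z \<in> face J" using rel_interior_subset by blast
  have "n \<bullet> (\<Sum>S\<in>J. c S *\<^sub>R S) = 0"
    unfolding inner_sum_right using eq by (intro sum.neutral) (auto simp: n_def z_def)
  then have "n \<bullet> (x - z) = n \<bullet> (x - V)" for x
    by (simp add: z_def inner_diff_right inner_add_right)
  moreover have "n \<bullet> (x - V) = - (\<Sum>S\<in>Bs - J. (d S \<bullet> (x - V)) * - (n \<bullet> S))" for x
  proof -
    have "n \<bullet> (x - V) = (\<Sum>S\<in>Bs. (d S \<bullet> (x - V)) * (n \<bullet> S))" by (rule inner_expand)
    also have "\<dots> = (\<Sum>S\<in>Bs - J. (d S \<bullet> (x - V)) * (n \<bullet> S))"
      by (rule sum.mono_neutral_right) (use finite_Bs eq in \<open>auto simp: n_def z_def\<close>)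
    finally show ?thesis by (simp add: sum_negf)
  qed
  ultimately have n: "n \<bullet> (x - z) = - (\<Sum>S\<in>Bs - J. (d S \<bullet> (x - V)) * - (n \<bullet> S))" for x by simp
  have neg: "n \<bullet> S < 0" if "S \<in> Bs - J" for S using lt that by (auto simp: n_def z_def)
  have nonneg: "(d S \<bullet> (x - V)) * - (n \<bullet> S) \<ge> 0" if "x \<in> P" "S \<in> Bs - J" for x S
    using in_cone[of x S] neg[of S] that by (intro mult_nonneg_nonneg) auto
  have "foot P y z"
    unfolding foot_def n_def[symmetric] n using nonneg zF
    by (auto simp: face_def intro!: sum_nonneg)
  moreover have "top_face P y z = face J"
  proof -
    have "n \<bullet> (x - z) = 0 \<longleftrightarrow> (\<forall>S\<in>Bs - J. d S \<bullet> (x - V) = 0)" if "x \<in> P" for x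
    proof -
      have "n \<bullet> (x - z) = 0 \<longleftrightarrow> (\<forall>S\<in>Bs - J. (d S \<bullet> (x - V)) * - (n \<bullet> S) = 0)"
        unfolding n neg_equal_0_iff_equal
        by (rule sum_nonneg_eq_0_iff) (use finite_Bs nonneg[OF that] in auto)
      then show ?thesis using neg by (metis less_irrefl mult_eq_0_iff neg_equal_0_iff_equal)
    qed
    then show ?thesis by (auto simp: top_face_def face_def n_def)
  qed
  ultimately show ?thesis using zr by (auto simp: open_cell_def)
qed

text \<open>The difference of the two points has no coordinates outside \<open>J\<close> and is
  orthogonal to every direction in \<open>J\<close>. No smallness is assumed, so feet are located
  even after they have left the neighbourhood of \<open>V\<close>.\<close>

lemma corner_foot_eq:
  assumes J: "J \<subseteq> Bs" and z: "z \<in> face J" "face J \<subseteq> top_face P y z"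
    and eq: "\<And>S. S \<in> J \<Longrightarrow> (V + (\<Sum>S\<in>J. c S *\<^sub>R S) - y) \<bullet> S = 0"
  shows "z = V + (\<Sum>S\<in>J. c S *\<^sub>R S)"
proof -
  have nS: "(z - y) \<bullet> S = 0" if S: "S \<in> J" for S
  proof -
    \<comment> \<open>A step along \<open>S\<close> that is shorter than \<open>\<rho>\<close> and
      hence stays in the face.\<close>
    define r where "r = \<rho> / (2 * (norm S + 1))"
    have r: "r > 0" using \<rho> by (simp add: r_def add_nonneg_pos)
    have "r * norm S \<le> r * (norm S + 1)" using r by (intro mult_left_mono) auto
    moreover have "norm S + 1 > 0" by (simp add: add_nonneg_pos)
    then have "r * (norm S + 1) = \<rho> / 2" by (simp add: r_def field_simps)
    ultimately have "norm (\<Sum>T\<in>{S}. r *\<^sub>R T) < \<rho>" using r \<rho> by simp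
    then have "V + (\<Sum>T\<in>{S}. r *\<^sub>R T) \<in> face {S}"
      using corner_in_face[of "{S}" "\<lambda>_. r"] r J S by auto
    then have "V + r *\<^sub>R S \<in> face J" using S by (auto simp: face_def)
    then have "(V + r *\<^sub>R S) - V \<in> dirs (face J)" using V_in_face by (rule diff_in_dirs)
    then show ?thesis using top_face_orthogonal[OF z(2), of "(V + r *\<^sub>R S) - V"] r by simp
  qed
  define w where "w = z - (V + (\<Sum>S\<in>J. c S *\<^sub>R S))"
  have wS: "w \<bullet> S = 0" if "S \<in> J" for S
    using nS[OF that] eq[OF that] by (simp add: w_def inner_diff_left)
  have "d S \<bullet> w = 0" if "S \<in> Bs" "S \<notin> J" for S
  proof -
    have "d S \<bullet> (z - V) = 0" using z that by (simp add: face_def)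
    then show ?thesis using dual_sum[OF J that(1), of c] that(2)
      by (simp add: w_def inner_diff_right inner_add_right)
  qed
  then have "w \<bullet> w = 0"
    unfolding inner_expand[of w w] using wS by (intro sum.neutral) auto
  then show ?thesis by (simp add: w_def)
qed

end

text \<open>Thus the projection of \<open>X\<close> to the span of every face of the cone generated by \<open>Bs\<close> lies in the
  relative interior of that face.\<close>

definition nice_direction :: "'a::real_inner set \<Rightarrow> 'a \<Rightarrow> bool" where
  "nice_direction Bs X \<longleftrightarrow> (\<forall>J\<subseteq>Bs. \<exists>c. (\<forall>S\<in>J. c S > 0 \<and> ((\<Sum>T\<in>J. c T *\<^sub>R T) - X) \<bullet> S = 0) \<and>
     (\<forall>S\<in>Bs - J. ((\<Sum>T\<in>J. c T *\<^sub>R T) - X) \<bullet> S < 0))"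

text \<open>Cones are invariant under scaling, so at time \<open>t\<close> a foot in
  \<open>face J\<close> is \<open>V\<close> plus \<open>t\<close> times \<open>Q J\<close>, where
  \<open>Q J\<close> is the projection of \<open>X\<close> to the span of \<open>J\<close>. The dual
  coordinates of \<open>Q J\<close> vanish exactly outside \<open>J\<close>, which makes the
  \<open>Q J\<close> distinct. The 2 added to the power counts the farthest point and the new
  face.\<close>

lemma (in simplicial_vertex) extra_cell:
  assumes DIM: "DIM('a) \<ge> 2" and X: "nice_direction Bs X" and tr: "transverse_ray P V X"
  obtains y \<F> where "finite \<F>" "P \<in> \<F>" "card \<F> = 2 ^ card Bs + 2" "\<And>F. F \<in> \<F> \<Longrightarrow> y \<in> open_cell P F"
proof -
  have cP: "convex P" "compact P" using P polytope_imp_convex polytope_imp_compact by auto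
  obtain c where c: "\<And>J. J \<subseteq> Bs \<Longrightarrow> (\<forall>S\<in>J. c J S > 0 \<and> ((\<Sum>T\<in>J. c J T *\<^sub>R T) - X) \<bullet> S = 0) \<and>
     (\<forall>S\<in>Bs - J. ((\<Sum>T\<in>J. c J T *\<^sub>R T) - X) \<bullet> S < 0)"
    using X unfolding nice_direction_def by metis
  define Q where "Q J = (\<Sum>T\<in>J. c J T *\<^sub>R T)" for J
  have scale: "t *\<^sub>R Q J = (\<Sum>T\<in>J. (t * c J T) *\<^sub>R T)" for t J
    by (simp add: Q_def scaleR_sum_right)
  have cpos: "c J S > 0" if "J \<subseteq> Bs" "S \<in> J" for J S using c that by blast
  have Qeq: "(Q J - X) \<bullet> S = 0" if "J \<subseteq> Bs" "S \<in> J" for J S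
    using c that unfolding Q_def by blast
  have Qlt: "(Q J - X) \<bullet> S < 0" if "J \<subseteq> Bs" "S \<in> Bs" "S \<notin> J" for J S
    using c that unfolding Q_def by blast
  have Qinj: "J = K" if "J \<subseteq> Bs" "K \<subseteq> Bs" "Q J = Q K" for J K
  proof -
    have iff: "S \<in> J \<longleftrightarrow> d S \<bullet> Q J \<noteq> 0" if "J \<subseteq> Bs" "S \<in> Bs" for J S
      using dual_sum[OF that, of "c J"] cpos[OF that(1), of S] by (auto simp: Q_def)
    show ?thesis using iff[OF that(1)] iff[OF that(2)] that by (metis subset_antisym subsetD subsetI)
  qed
  \<comment> \<open>\<open>Bs\<close> spans the whole space, so the projection changes
    nothing.\<close>
  have QBs: "Q Bs = X"
  proof -
    have "(Q Bs - X) \<bullet> (Q Bs - X) = 0"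
      unfolding inner_expand[of "Q Bs - X" "Q Bs - X"] using Qeq by (intro sum.neutral) auto
    then show ?thesis by simp
  qed
  have foot_eq: "z = V + t *\<^sub>R Q J"
    if "J \<subseteq> Bs" "z \<in> face J" "face J \<subseteq> top_face P (V + t *\<^sub>R X) z" for t z J
  proof -
    have "(V + t *\<^sub>R Q J - (V + t *\<^sub>R X)) \<bullet> S = 0" if "S \<in> J" for S
      using Qeq[OF \<open>J \<subseteq> Bs\<close> that] by (simp flip: scaleR_diff_right)
    then show ?thesis unfolding scale by (rule corner_foot_eq[OF that])
  qed
  have cell: "V + t *\<^sub>R X \<in> open_cell P (face J)" if J: "J \<subseteq> Bs" and t: "t > 0" "t * norm (Q J) < \<rho>" for t J
  proof (rule corner_cell[OF J, where c = "\<lambda>S. t * c J S"])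
    show "\<And>S. S \<in> J \<Longrightarrow> 0 < t * c J S" using cpos J t by simp
    show "norm (\<Sum>S\<in>J. (t * c J S) *\<^sub>R S) < \<rho>" unfolding scale[symmetric] using t by simp
    have e: "(V + t *\<^sub>R Q J - (V + t *\<^sub>R X)) \<bullet> S = t * ((Q J - X) \<bullet> S)" for S
      by (simp flip: scaleR_diff_right)
    show "(V + (\<Sum>S\<in>J. (t * c J S) *\<^sub>R S) - (V + t *\<^sub>R X)) \<bullet> S = 0" if "S \<in> J" for S
      unfolding scale[symmetric] e using Qeq[OF J that] by simp
    show "(V + (\<Sum>S\<in>J. (t * c J S) *\<^sub>R S) - (V + t *\<^sub>R X)) \<bullet> S < 0" if "S \<in> Bs" "S \<notin> J" for S
      unfolding scale[symmetric] e using Qlt[OF J that] t by (simp add: mult_pos_neg)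
  qed
  have ev: "\<forall>\<^sub>F t in at_right 0. t > 0 \<and> t * norm (Q J) < \<rho>" for J
  proof -
    have "((\<lambda>t. t * norm (Q J)) \<longlongrightarrow> 0 * norm (Q J)) (at_right 0)" by (intro tendsto_intros)
    then have "\<forall>\<^sub>F t in at_right 0. t * norm (Q J) < \<rho>" by (rule order_tendstoD) (use \<rho> in simp)
    then show ?thesis using eventually_at_right_less[of "0::real"] by eventually_elim simp
  qed
  have face_inj: "inj_on face (Pow Bs)"
  proof (rule inj_onI)
    fix J K assume JK: "J \<in> Pow Bs" "K \<in> Pow Bs" and eq: "face J = face K"
    obtain t where t: "t > 0" "t * norm (Q J) < \<rho>"
      using eventually_happens[OF ev[of J]] by auto
    then have "V + t *\<^sub>R X \<in> open_cell P (face J)" using cell JK by auto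
    then obtain z where z: "z \<in> face J" "face J \<subseteq> top_face P (V + t *\<^sub>R X) z"
      using open_cell_subset_closed_cell by (fastforce simp: closed_cell_def)
    then have "V + t *\<^sub>R Q J = V + t *\<^sub>R Q K"
      using foot_eq[of J z t] foot_eq[of K z t] JK eq by auto
    then have "Q J = Q K" using t by simp
    then show "J = K" using Qinj JK by auto
  qed
  obtain W where W: "W \<in> P" "\<And>x. x \<in> P \<Longrightarrow> norm (x - V) \<le> norm (W - V)"
  proof -
    have "continuous_on P (\<lambda>x. norm (x - V))" by (intro continuous_intros)
    then have "\<exists>W\<in>P. \<forall>x\<in>P. norm (x - V) \<le> norm (W - V)"
      using continuous_attains_sup[OF cP(2)] V_in_P by blast
    then show ?thesis using that by blast
  qed
  have "W \<noteq> V"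
  proof
    assume "W = V"
    then have "P \<subseteq> {V}" using W(2) by auto
    then have "interior P \<subseteq> interior {V}" by (rule interior_mono)
    then show False using P(2) by simp
  qed
  \<comment> \<open>\<open>P\<close> lies in the ball around \<open>V\<close> through
    \<open>W\<close>, and by strict convexity the tangent plane of this ball at \<open>W\<close>
    meets \<open>P\<close> only in \<open>W\<close>.\<close>
  have W_neg: "(W - V) \<bullet> (x - W) < 0" if x: "x \<in> P" "x \<noteq> W" for x
  proof -
    have "(norm (x - V))\<^sup>2 \<le> (norm (W - V))\<^sup>2" using W(2)[OF x(1)] by (simp add: power_mono)
    moreover have "(norm (x - V))\<^sup>2 = (norm (W - V))\<^sup>2 + 2 * ((W - V) \<bullet> (x - W)) + (norm (x - W))\<^sup>2"
      by (simp add: power2_norm_eq_inner inner_diff_left inner_diff_right inner_commute)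
    moreover have "(norm (x - W))\<^sup>2 > 0" using x by simp
    ultimately show ?thesis by linarith
  qed
  have W_cell: "V \<in> open_cell P {W}"
  proof -
    have "foot P V W" "top_face P V W = {W}"
      using W_neg W(1) by (force simp: foot_def top_face_def)+
    then show ?thesis by (auto simp: open_cell_def)
  qed
  define \<F> where "\<F> = insert {W} (face ` Pow Bs)"
  have fin: "finite \<F>" using finite_Bs by (simp add: \<F>_def)
  have P\<F>: "P \<in> \<F>" using face_Bs by (auto simp: \<F>_def)
  have "{W} \<notin> face ` Pow Bs" using V_in_face \<open>W \<noteq> V\<close> by fastforce
  then have card: "card \<F> = 2 ^ card Bs + 1"
    using finite_Bs card_image[OF face_inj] by (simp add: \<F>_def card_Pow)
  have start: "\<forall>\<^sub>F t in at_right 0. \<forall>F\<in>\<F>. V + t *\<^sub>R X \<in> open_cell P F"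
  proof (intro eventually_ball_finite[OF fin] ballI)
    fix F assume "F \<in> \<F>"
    then consider "F = {W}" | J where "J \<subseteq> Bs" "F = face J" by (auto simp: \<F>_def)
    then show "\<forall>\<^sub>F t in at_right 0. V + t *\<^sub>R X \<in> open_cell P F"
    proof cases
      case 1
      have "((\<lambda>t. V + t *\<^sub>R X) \<longlongrightarrow> V + 0 *\<^sub>R X) (at_right 0)" by (intro tendsto_intros)
      then show ?thesis
        using topological_tendstoD[OF _ open_open_cell[OF P(1)]] W_cell 1 by fastforce
    next
      case 2
      show ?thesis using ev[of J] by eventually_elim (use cell 2 in auto)
    qed
  qed
  have X0: "X \<noteq> 0"
  proof
    assume "X = 0"
    have "Bs \<noteq> {}"
    proof
      assume "Bs = {}"
      then show False using expand[of W] expand[of V] \<open>W \<noteq> V\<close> by simp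
    qed
    then obtain S where "S \<in> Bs" by auto
    then have "(Q {} - X) \<bullet> S < 0" using Qlt[of "{}" S] by simp
    then show False using \<open>X = 0\<close> by (simp add: Q_def)
  qed
  obtain t H where tH: "H \<notin> \<F>" "\<And>F. F \<in> insert H \<F> \<Longrightarrow> V + t *\<^sub>R X \<in> open_cell P F"
  proof (rule extra_cell_on_ray[OF P tr X0 fin P\<F> start])
    fix t z F G
    assume t: "t > 0" and closed: "\<And>H. H \<in> \<F> \<Longrightarrow> V + t *\<^sub>R X \<in> closed_cell P H"
      and FG: "F \<in> \<F>" "G \<in> \<F>" and z: "foot P (V + t *\<^sub>R X) z" "z \<in> F" "F \<subseteq> G"
        "top_face P (V + t *\<^sub>R X) z = G" and dim: "aff_dim G = aff_dim F + 1"
    have ne: "F \<noteq> G" using dim by auto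
    have "G \<noteq> {W}" using z(2,3) ne by auto
    then obtain K where K: "K \<subseteq> Bs" "G = face K" using FG by (auto simp: \<F>_def)
    have zK: "z = V + t *\<^sub>R Q K" using foot_eq[OF K(1)] z K by auto
    show False
    proof (cases "F = {W}")
      case False
      then obtain J where J: "J \<subseteq> Bs" "F = face J" using FG by (auto simp: \<F>_def)
      have "z = V + t *\<^sub>R Q J" using foot_eq[OF J(1)] z J by auto
      then have "Q J = Q K" using zK t by simp
      then show False using Qinj J K ne by auto
    next
      case True
      then have WK: "W = V + t *\<^sub>R Q K" using z zK by auto
      show False
      proof (cases "K = Bs")
        case True
        \<comment> \<open>Here \<open>{W}\<close> would be paired with \<open>P\<close> itself, a
          dimension gap of at least two.\<close>
        then have "aff_dim G = DIM('a)" using K face_Bs P aff_dim_nonempty_interior by auto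
        then show False using dim \<open>F = {W}\<close> DIM by simp
      next
        case False
        txt \<open>The projections grow with the face, so the foot \<open>W\<close> would be closer to \<open>V\<close> than the
          point of \<open>P\<close> that it is the projection of.\<close>
        have "V + t *\<^sub>R X \<in> closed_cell P P" using closed P\<F> by auto
        then have "V + t *\<^sub>R X \<in> P" using top_face_full_imp_eq[OF P(2)] by (auto simp: closed_cell_def)
        then have "norm (t *\<^sub>R X) \<le> norm (t *\<^sub>R Q K)" using W(2) WK by fastforce
        then have le: "norm X \<le> norm (Q K)" using t by simp
        have "(Q K - X) \<bullet> Q K = (\<Sum>S\<in>K. c K S * ((Q K - X) \<bullet> S))"
          by (subst (2) Q_def) (simp add: inner_sum_right)
        also have "\<dots> = 0" using Qeq[OF K(1)] by simp
        finally have orth: "(Q K - X) \<bullet> Q K = 0" .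
        have "(norm X)\<^sup>2 = (norm (Q K))\<^sup>2 - 2 * ((Q K - X) \<bullet> Q K) + (norm (Q K - X))\<^sup>2"
          by (simp add: power2_norm_eq_inner inner_diff_left inner_diff_right inner_commute)
        moreover have "(norm X)\<^sup>2 \<le> (norm (Q K))\<^sup>2" using le by (simp add: power_mono)
        ultimately have "(norm (Q K - X))\<^sup>2 \<le> 0" using orth by simp
        then have "Q K = X" by simp
        then show False using Qinj[OF K(1) subset_refl] QBs False by simp
      qed
    qed
  qed blast
  show ?thesis
  proof (rule that[of "insert H \<F>" "V + t *\<^sub>R X"])
    show "card (insert H \<F>) = 2 ^ card Bs + 2" using card tH(1) fin by simp
  qed (use fin P\<F> tH in auto)
qed

section \<open>Nice spherical triangles\<close>

text \<open>The coordinate functionals are represented by vectors through their adjoints.\<close>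

lemma exists_dual_basis:
  fixes Bs :: "'a::euclidean_space set"
  assumes "independent Bs"
  obtains d where "\<And>S T. S \<in> Bs \<Longrightarrow> T \<in> Bs \<Longrightarrow> d S \<bullet> T = (if S = T then 1 else 0)"
proof -
  have "\<exists>v. \<forall>T\<in>Bs. v \<bullet> T = (if S = T then 1 else 0)" for S
  proof -
    obtain f :: "'a \<Rightarrow> real" where f: "linear f" "\<forall>T\<in>Bs. f T = (if S = T then 1 else 0)"
      using linear_independent_extend[OF assms, of "\<lambda>T. if S = T then 1 else (0::real)"] by auto
    have "adjoint f 1 \<bullet> x = f x" for x
      using adjoint_works[OF f(1), of x 1] by (simp add: inner_commute)
    then show ?thesis using f(2) by (intro exI[of _ "adjoint f 1"]) simp
  qed
  then show ?thesis using that by metis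
qed

lemma dual_basis_expand:
  fixes Bs :: "'a::euclidean_space set"
  assumes fin: "finite Bs" and span: "span Bs = UNIV"
    and dual: "\<And>S T. S \<in> Bs \<Longrightarrow> T \<in> Bs \<Longrightarrow> d S \<bullet> T = (if S = T then 1 else 0)"
  shows "x = (\<Sum>S\<in>Bs. (d S \<bullet> x) *\<^sub>R S)"
proof (rule linear_eq_on_span[where B = Bs and f = "\<lambda>x. x"])
  show "linear (\<lambda>x::'a. x)" by (rule linear_ident)
  show "linear (\<lambda>x. \<Sum>S\<in>Bs. (d S \<bullet> x) *\<^sub>R S)"
    by (intro linear_compose_sum ballI) (simp add: linear_iff inner_add_right scaleR_add_left)
  show "x \<in> span Bs" using span by simp
  fix T assume T: "T \<in> Bs"
  have "(\<Sum>S\<in>Bs. (d S \<bullet> T) *\<^sub>R S) = (\<Sum>S\<in>Bs. if S = T then S else 0)"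
    by (rule sum.cong) (use T dual in auto)
  then show "T = (\<Sum>S\<in>Bs. (d S \<bullet> T) *\<^sub>R S)" using fin T by simp
qed

text \<open>A predicate in all six vectors, so that relabelling transports a statement about one
  vertex or edge of the triangle to the others.\<close>

definition dual_triple :: "'a::real_inner \<Rightarrow> 'a \<Rightarrow> 'a \<Rightarrow> 'a \<Rightarrow> 'a \<Rightarrow> 'a \<Rightarrow> bool" where
  "dual_triple A B C a b c \<longleftrightarrow> norm A = 1 \<and> norm B = 1 \<and> norm C = 1 \<and>
     a \<bullet> A = 1 \<and> a \<bullet> B = 0 \<and> a \<bullet> C = 0 \<and> b \<bullet> A = 0 \<and> b \<bullet> B = 1 \<and> b \<bullet> C = 0 \<and>
     c \<bullet> A = 0 \<and> c \<bullet> B = 0 \<and> c \<bullet> C = 1 \<and>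
     (\<forall>x. x = (a \<bullet> x) *\<^sub>R A + (b \<bullet> x) *\<^sub>R B + (c \<bullet> x) *\<^sub>R C)"

lemma dual_triple_rotate: "dual_triple A B C a b c \<Longrightarrow> dual_triple B C A b c a"
  unfolding dual_triple_def by (simp add: add_ac)

lemma dual_triple_swap: "dual_triple A B C a b c \<Longrightarrow> dual_triple B A C b a c"
  unfolding dual_triple_def by (simp add: add_ac)

text \<open>For unit \<open>S\<close> this is the component of \<open>T\<close> orthogonal to
  \<open>S\<close>: the unnormalised initial direction at \<open>S\<close> of the geodesic towards
  \<open>T\<close>. Its sign against \<open>X\<close> tells whether the angle at \<open>S\<close>
  between \<open>X\<close> and \<open>T\<close> is acute.\<close>

definition tangent :: "'a::real_inner \<Rightarrow> 'a \<Rightarrow> 'a" where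
  "tangent S T = T - (S \<bullet> T) *\<^sub>R S"

lemma inner_unit: "norm A = 1 \<Longrightarrow> A \<bullet> A = 1"
  by (simp add: dot_square_norm)

lemma tangent_self: "norm A = 1 \<Longrightarrow> A \<bullet> tangent A B = 0"
  by (simp add: tangent_def inner_diff_right inner_unit)

lemma tangent_sq: "norm B = 1 \<Longrightarrow> B \<bullet> tangent A B = 1 - (A \<bullet> B)\<^sup>2"
  by (simp add: tangent_def inner_diff_right inner_unit power2_eq_square inner_commute)

text \<open>\<open>tangent A B\<close> has squared length \<open>1 - (A \<bullet> B)\<^sup>2\<close>
  and is non-zero, because its dual coordinate \<open>b\<close> is 1.\<close>

lemma dual_triple_inner_less_1:
  assumes "dual_triple A B C a b c"
  shows "(A \<bullet> B)\<^sup>2 < 1"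
proof -
  have u: "norm A = 1" "norm B = 1" using assms by (auto simp: dual_triple_def)
  have "b \<bullet> tangent A B = 1"
    using assms by (simp add: dual_triple_def tangent_def inner_diff_right)
  then have "tangent A B \<noteq> 0" by auto
  then have "tangent A B \<bullet> tangent A B > 0" by simp
  moreover have "tangent A B \<bullet> tangent A B = B \<bullet> tangent A B"
  proof -
    have "tangent A B \<bullet> tangent A B = (B - (A \<bullet> B) *\<^sub>R A) \<bullet> tangent A B" by (simp only: tangent_def)
    then show ?thesis using tangent_self[OF u(1), of B] by (simp add: inner_diff_left)
  qed
  ultimately show ?thesis using tangent_sq[OF u(2)] by simp
qed

lemma dual_triple_nice_1:
  assumes "dual_triple A B C a b c" "X \<bullet> tangent A B > 0" "X \<bullet> tangent A C > 0" "X \<bullet> A > 0"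
  shows "((X \<bullet> A) *\<^sub>R A - X) \<bullet> A = 0" "((X \<bullet> A) *\<^sub>R A - X) \<bullet> B < 0" "((X \<bullet> A) *\<^sub>R A - X) \<bullet> C < 0"
proof -
  have "norm A = 1" using assms by (simp add: dual_triple_def)
  then show "((X \<bullet> A) *\<^sub>R A - X) \<bullet> A = 0" by (simp add: inner_diff_left inner_unit)
  show "((X \<bullet> A) *\<^sub>R A - X) \<bullet> B < 0" "((X \<bullet> A) *\<^sub>R A - X) \<bullet> C < 0"
    using assms(2,3) by (simp_all add: tangent_def inner_diff_left inner_diff_right mult.commute)
qed

text \<open>\<open>p\<close> and \<open>q\<close> solve the Gram system for the projection of
  \<open>X\<close> to the span of \<open>A\<close> and \<open>B\<close>. The residual
  \<open>N\<close> is orthogonal to both, so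
  \<open>N \<bullet> N = (c \<bullet> X) * (N \<bullet> C)\<close>, which fixes the sign of
  \<open>N \<bullet> C\<close>.\<close>

lemma dual_triple_nice_2:
  assumes tr: "dual_triple A B C a b c" and X: "X \<bullet> tangent A B > 0" "X \<bullet> tangent B A > 0" "c \<bullet> X > 0"
  obtains p q where "p > 0" "q > 0" "(p *\<^sub>R A + q *\<^sub>R B - X) \<bullet> A = 0" "(p *\<^sub>R A + q *\<^sub>R B - X) \<bullet> B = 0"
    "(p *\<^sub>R A + q *\<^sub>R B - X) \<bullet> C < 0"
proof -
  have u: "norm A = 1" "norm B = 1" using tr by (auto simp: dual_triple_def)
  define k where "k = A \<bullet> B"
  have k: "1 - k\<^sup>2 > 0" using dual_triple_inner_less_1[OF tr] by (simp add: k_def)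
  define p where "p = (X \<bullet> tangent B A) / (1 - k\<^sup>2)"
  define q where "q = (X \<bullet> tangent A B) / (1 - k\<^sup>2)"
  have pq: "p > 0" "q > 0" using X k by (auto simp: p_def q_def)
  have p: "p * (1 - k\<^sup>2) = X \<bullet> A - k * (X \<bullet> B)" and q: "q * (1 - k\<^sup>2) = X \<bullet> B - k * (X \<bullet> A)"
    using k by (simp_all add: p_def q_def k_def tangent_def inner_diff_right inner_commute)
  define N where "N = X - (p *\<^sub>R A + q *\<^sub>R B)"
  have "(1 - k\<^sup>2) * (p + q * k) = (1 - k\<^sup>2) * (X \<bullet> A)"
    using p q by algebra
  then have NA: "N \<bullet> A = 0"
    using k u by (simp add: N_def k_def inner_diff_left inner_add_left inner_unit inner_commute[of B A])
  have "(1 - k\<^sup>2) * (p * k + q) = (1 - k\<^sup>2) * (X \<bullet> B)"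
    using p q by algebra
  then have NB: "N \<bullet> B = 0"
    using k u by (simp add: N_def k_def inner_diff_left inner_add_left inner_unit)
  have cN: "c \<bullet> N = c \<bullet> X" using tr by (simp add: N_def dual_triple_def inner_diff_right inner_add_right)
  have "N \<bullet> N = N \<bullet> ((a \<bullet> N) *\<^sub>R A + (b \<bullet> N) *\<^sub>R B + (c \<bullet> N) *\<^sub>R C)"
    using tr unfolding dual_triple_def by metis
  then have "N \<bullet> N = (c \<bullet> X) * (N \<bullet> C)" using NA NB cN by (simp add: inner_add_right)
  moreover have "N \<bullet> N > 0" using cN X by auto
  ultimately have "N \<bullet> C > 0" using X by (simp add: zero_less_mult_iff)
  moreover have "p *\<^sub>R A + q *\<^sub>R B - X = - N" by (simp add: N_def)
  ultimately show ?thesis using that[OF pq] NA NB by simp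
qed

text \<open>A single vertex needs the two tangents there, a pair needs the tangents at both ends and
  the opposite dual coordinate, the empty set needs the inner products with the vertices, and the
  full set all dual coordinates.\<close>

lemma dual_triple_nice_direction:
  assumes tr: "dual_triple A B C a b c" and ne: "A \<noteq> B" "A \<noteq> C" "B \<noteq> C"
    and pos: "X \<bullet> A > 0" "X \<bullet> B > 0" "X \<bullet> C > 0" "a \<bullet> X > 0" "b \<bullet> X > 0" "c \<bullet> X > 0"
    and tan: "X \<bullet> tangent A B > 0" "X \<bullet> tangent B A > 0" "X \<bullet> tangent A C > 0"
      "X \<bullet> tangent C A > 0" "X \<bullet> tangent B C > 0" "X \<bullet> tangent C B > 0"
  shows "nice_direction {A, B, C} X"
  unfolding nice_direction_def
proof (intro allI impI)
  fix J assume "J \<subseteq> {A, B, C}"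
  let ?P = "\<lambda>J c. (\<forall>S\<in>J. c S > 0 \<and> ((\<Sum>T\<in>J. c T *\<^sub>R T) - X) \<bullet> S = 0) \<and>
     (\<forall>S\<in>{A, B, C} - J. ((\<Sum>T\<in>J. c T *\<^sub>R T) - X) \<bullet> S < 0)"
  note BCA = dual_triple_rotate[OF tr]
  note CAB = dual_triple_rotate[OF BCA]
  note ACB = dual_triple_rotate[OF dual_triple_swap[OF tr]]
  have "J \<in> Pow {A, B, C}" using \<open>J \<subseteq> {A, B, C}\<close> by simp
  then have "J = {} \<or> J = {A} \<or> J = {B} \<or> J = {C} \<or> J = {A, B} \<or> J = {B, C} \<or> J = {A, C} \<or> J = {A, B, C}"
    unfolding Pow_insert Pow_empty by auto
  then consider "J = {}" | "J = {A}" | "J = {B}" | "J = {C}" | "J = {A, B}" | "J = {B, C}" | "J = {A, C}" | "J = {A, B, C}"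
    by argo
  then show "\<exists>c. ?P J c"
  proof cases
    case 1
    then show ?thesis using pos by simp
  next
    case 2
    then show ?thesis using dual_triple_nice_1[OF tr tan(1,3) pos(1)] pos
      by (intro exI[of _ "\<lambda>_. X \<bullet> A"]) auto
  next
    case 3
    then show ?thesis using dual_triple_nice_1[OF BCA tan(5,2) pos(2)] pos
      by (intro exI[of _ "\<lambda>_. X \<bullet> B"]) auto
  next
    case 4
    then show ?thesis using dual_triple_nice_1[OF CAB tan(4,6) pos(3)] pos
      by (intro exI[of _ "\<lambda>_. X \<bullet> C"]) auto
  next
    case 5
    obtain p q where "p > 0" "q > 0" "(p *\<^sub>R A + q *\<^sub>R B - X) \<bullet> A = 0" "(p *\<^sub>R A + q *\<^sub>R B - X) \<bullet> B = 0"
      "(p *\<^sub>R A + q *\<^sub>R B - X) \<bullet> C < 0"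
      using dual_triple_nice_2[OF tr tan(1,2) pos(6)] by metis
    then show ?thesis using 5 ne by (intro exI[of _ "\<lambda>S. if S = A then p else q"]) auto
  next
    case 6
    obtain p q where "p > 0" "q > 0" "(p *\<^sub>R B + q *\<^sub>R C - X) \<bullet> B = 0" "(p *\<^sub>R B + q *\<^sub>R C - X) \<bullet> C = 0"
      "(p *\<^sub>R B + q *\<^sub>R C - X) \<bullet> A < 0"
      using dual_triple_nice_2[OF BCA tan(5,6) pos(4)] by metis
    then show ?thesis using 6 ne by (intro exI[of _ "\<lambda>S. if S = B then p else q"]) auto
  next
    case 7
    obtain p q where "p > 0" "q > 0" "(p *\<^sub>R A + q *\<^sub>R C - X) \<bullet> A = 0" "(p *\<^sub>R A + q *\<^sub>R C - X) \<bullet> C = 0"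
      "(p *\<^sub>R A + q *\<^sub>R C - X) \<bullet> B < 0"
      using dual_triple_nice_2[OF ACB tan(3,4) pos(5)] by metis
    then show ?thesis using 7 ne by (intro exI[of _ "\<lambda>S. if S = A then p else q"]) auto
  next
    case 8
    have "(\<Sum>T\<in>J. (if T = A then a \<bullet> X else if T = B then b \<bullet> X else c \<bullet> X) *\<^sub>R T) =
        (a \<bullet> X) *\<^sub>R A + (b \<bullet> X) *\<^sub>R B + (c \<bullet> X) *\<^sub>R C"
      using ne 8 by (simp add: add.assoc)
    also have "\<dots> = X" using tr unfolding dual_triple_def by metis
    finally have "(\<Sum>T\<in>J. (if T = A then a \<bullet> X else if T = B then b \<bullet> X else c \<bullet> X) *\<^sub>R T) = X" .
    then show ?thesis using 8 pos
      by (intro exI[of _ "\<lambda>T. if T = A then a \<bullet> X else if T = B then b \<bullet> X else c \<bullet> X"]) auto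
  qed
qed

section \<open>Tight projection inequalities\<close>

lemma inner_tangent_eq_0: "X \<bullet> tangent S T = 0 \<longleftrightarrow> X \<bullet> T = (S \<bullet> T) * (X \<bullet> S)"
  by (simp add: tangent_def inner_diff_right)

text \<open>If both were tight, the component of \<open>X\<close> orthogonal to \<open>A\<close>
  would be orthogonal to all three vertices and hence zero, making \<open>X\<close> a multiple of
  \<open>A\<close>.\<close>

lemma tangent_tight_unique_source:
  assumes tr: "dual_triple A B C a b c" and X: "b \<bullet> X > 0"
  shows "\<not> (X \<bullet> tangent A B = 0 \<and> X \<bullet> tangent A C = 0)"
proof
  assume tight: "X \<bullet> tangent A B = 0 \<and> X \<bullet> tangent A C = 0"
  define Y where "Y = X - (X \<bullet> A) *\<^sub>R A"
  have "norm A = 1" using tr by (simp add: dual_triple_def)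
  then have "Y \<bullet> A = 0" "Y \<bullet> B = 0" "Y \<bullet> C = 0"
    using tight by (simp_all add: Y_def tangent_def inner_diff_left inner_diff_right inner_unit mult.commute)
  moreover have "Y \<bullet> Y = Y \<bullet> ((a \<bullet> Y) *\<^sub>R A + (b \<bullet> Y) *\<^sub>R B + (c \<bullet> Y) *\<^sub>R C)"
    using tr unfolding dual_triple_def by metis
  ultimately have "Y \<bullet> Y = 0" by (simp add: inner_add_right)
  then have "X = (X \<bullet> A) *\<^sub>R A" by (simp add: Y_def)
  then have "b \<bullet> X = (X \<bullet> A) * (b \<bullet> A)" by (metis inner_scaleR_right)
  then show False using X tr by (simp add: dual_triple_def)
qed

text \<open>A tight constraint multiplies the inner product with \<open>X\<close> by
  \<open>S \<bullet> T\<close>; going back and forth would give the factor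
  \<open>(A \<bullet> B)\<^sup>2 < 1\<close>.\<close>

lemma tangent_tight_antisym:
  assumes tr: "dual_triple A B C a b c" and X: "X \<bullet> A > 0"
  shows "\<not> (X \<bullet> tangent A B = 0 \<and> X \<bullet> tangent B A = 0)"
proof
  assume "X \<bullet> tangent A B = 0 \<and> X \<bullet> tangent B A = 0"
  then have "X \<bullet> B = (A \<bullet> B) * (X \<bullet> A)" "X \<bullet> A = (A \<bullet> B) * (X \<bullet> B)"
    unfolding inner_tangent_eq_0 inner_commute[of B A] by blast+
  then have "(1 - (A \<bullet> B)\<^sup>2) * (X \<bullet> A) = 0" by algebra
  then show False using X dual_triple_inner_less_1[OF tr] by simp
qed

text \<open>Going once around the triangle multiplies \<open>X \<bullet> A\<close> by three factors
  of absolute value below 1.\<close>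

lemma tangent_tight_acyclic:
  assumes tr: "dual_triple A B C a b c" and X: "X \<bullet> A > 0"
  shows "\<not> (X \<bullet> tangent A B = 0 \<and> X \<bullet> tangent B C = 0 \<and> X \<bullet> tangent C A = 0)"
proof
  assume "X \<bullet> tangent A B = 0 \<and> X \<bullet> tangent B C = 0 \<and> X \<bullet> tangent C A = 0"
  then have "X \<bullet> B = (A \<bullet> B) * (X \<bullet> A)" "X \<bullet> C = (B \<bullet> C) * (X \<bullet> B)" "X \<bullet> A = (C \<bullet> A) * (X \<bullet> C)"
    unfolding inner_tangent_eq_0 by blast+
  then have "(1 - (A \<bullet> B) * (B \<bullet> C) * (C \<bullet> A)) * (X \<bullet> A) = 0" by algebra
  then have eq: "(A \<bullet> B) * (B \<bullet> C) * (C \<bullet> A) = 1" using X by simp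
  have l: "(A \<bullet> B)\<^sup>2 < 1" "(B \<bullet> C)\<^sup>2 < 1" "(C \<bullet> A)\<^sup>2 < 1"
    using dual_triple_inner_less_1[OF tr] dual_triple_inner_less_1[OF dual_triple_rotate[OF tr]]
      dual_triple_inner_less_1[OF dual_triple_rotate[OF dual_triple_rotate[OF tr]]] by auto
  have "(A \<bullet> B)\<^sup>2 * (B \<bullet> C)\<^sup>2 * (C \<bullet> A)\<^sup>2 = ((A \<bullet> B) * (B \<bullet> C) * (C \<bullet> A))\<^sup>2"
    by (simp add: power_mult_distrib)
  then have "(A \<bullet> B)\<^sup>2 * (B \<bullet> C)\<^sup>2 * (C \<bullet> A)\<^sup>2 = 1" using eq by simp
  moreover have "(A \<bullet> B)\<^sup>2 * (B \<bullet> C)\<^sup>2 \<le> 1 * 1"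
    using l by (intro mult_mono) auto
  then have "(A \<bullet> B)\<^sup>2 * (B \<bullet> C)\<^sup>2 * (C \<bullet> A)\<^sup>2 \<le> 1 * (C \<bullet> A)\<^sup>2"
    by (intro mult_right_mono) auto
  ultimately show False using l by simp
qed

text \<open>Written in the coordinates of \<open>X\<close>, tightness balances a positive
  contribution of \<open>B\<close> against that of \<open>C\<close>, so \<open>C\<close> is on the
  negative side of \<open>tangent A B\<close>. Both a move towards \<open>B\<close> and one away
  from \<open>C\<close> therefore help, while \<open>A\<close> is neutral.\<close>

lemma tangent_tight_push:
  assumes tr: "dual_triple A B C a b c" and X: "b \<bullet> X > 0" "c \<bullet> X > 0" and tight: "X \<bullet> tangent A B = 0"
    and qr: "q \<ge> 0" "r \<le> 0" "q \<noteq> 0 \<or> r \<noteq> 0"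
  shows "(p *\<^sub>R A + q *\<^sub>R B + r *\<^sub>R C) \<bullet> tangent A B > 0"
proof -
  have u: "norm A = 1" "norm B = 1" using tr by (auto simp: dual_triple_def)
  define k where "k = 1 - (A \<bullet> B)\<^sup>2"
  have k: "k > 0" using dual_triple_inner_less_1[OF tr] by (simp add: k_def)
  have gA: "A \<bullet> tangent A B = 0" and gB: "B \<bullet> tangent A B = k"
    using tangent_self[OF u(1)] tangent_sq[OF u(2)] by (simp_all add: k_def)
  have "X \<bullet> tangent A B = ((a \<bullet> X) *\<^sub>R A + (b \<bullet> X) *\<^sub>R B + (c \<bullet> X) *\<^sub>R C) \<bullet> tangent A B"
    using tr unfolding dual_triple_def by metis
  then have "(b \<bullet> X) * k + (c \<bullet> X) * (C \<bullet> tangent A B) = 0"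
    using tight gA gB by (simp add: inner_add_left)
  moreover have "(b \<bullet> X) * k > 0" using X k by simp
  ultimately have "(c \<bullet> X) * (C \<bullet> tangent A B) < 0" by linarith
  then have C: "C \<bullet> tangent A B < 0" using X by (simp add: mult_less_0_iff)
  have "q * k \<ge> 0" "r * (C \<bullet> tangent A B) \<ge> 0" "q * k > 0 \<or> r * (C \<bullet> tangent A B) > 0"
    using qr k C by (auto simp: zero_le_mult_iff zero_less_mult_iff)
  then have "q * k + r * (C \<bullet> tangent A B) > 0" by linarith
  then show ?thesis using gA gB by (simp add: inner_add_left)
qed

lemma eventually_perturb_pos:
  fixes X D g :: "'a::real_inner"
  assumes "X \<bullet> g \<ge> 0" "X \<bullet> g = 0 \<Longrightarrow> D \<bullet> g > 0"
  shows "\<forall>\<^sub>F \<epsilon> in at_right 0. (X + \<epsilon> *\<^sub>R D) \<bullet> g > 0"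
proof (cases "X \<bullet> g = 0")
  case True
  show ?thesis
    using eventually_at_right_less[of "0::real"]
    by eventually_elim (use True assms(2) in \<open>simp add: inner_add_left\<close>)
next
  case False
  have "((\<lambda>\<epsilon>. (X + \<epsilon> *\<^sub>R D) \<bullet> g) \<longlongrightarrow> (X + 0 *\<^sub>R D) \<bullet> g) (at_right 0)" by (intro tendsto_intros)
  then show ?thesis by (rule order_tendstoD) (use False assms(1) in simp)
qed

text \<open>A constraint \<open>X \<bullet> tangent S T \<ge> 0\<close> that is tight at \<open>X\<close> is relaxed by moving towards \<open>T\<close> and away from
  the third vertex; the tight constraints form no cycle, so these moves do not conflict.\<close>

lemma dual_triple_perturb:
  assumes tr: "dual_triple A B C a b c"
    and pos: "X \<bullet> A > 0" "X \<bullet> B > 0" "X \<bullet> C > 0" "a \<bullet> X > 0" "b \<bullet> X > 0" "c \<bullet> X > 0"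
    and tan: "X \<bullet> tangent A B \<ge> 0" "X \<bullet> tangent B A \<ge> 0" "X \<bullet> tangent A C \<ge> 0"
      "X \<bullet> tangent C A \<ge> 0" "X \<bullet> tangent B C \<ge> 0" "X \<bullet> tangent C B \<ge> 0"
  obtains Y where "Y \<bullet> A > 0" "Y \<bullet> B > 0" "Y \<bullet> C > 0" "a \<bullet> Y > 0" "b \<bullet> Y > 0" "c \<bullet> Y > 0"
    "Y \<bullet> tangent A B > 0" "Y \<bullet> tangent B A > 0" "Y \<bullet> tangent A C > 0"
    "Y \<bullet> tangent C A > 0" "Y \<bullet> tangent B C > 0" "Y \<bullet> tangent C B > 0"
proof -
  note BCA = dual_triple_rotate[OF tr]
  note CAB = dual_triple_rotate[OF BCA]
  note BAC = dual_triple_swap[OF tr]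
  note ACB = dual_triple_rotate[OF BAC]
  note CBA = dual_triple_rotate[OF ACB]
  define tight :: "'a \<Rightarrow> 'a \<Rightarrow> real" where "tight S T = of_bool (X \<bullet> tangent S T = 0)" for S T
  define p where "p = tight B A + tight C A - tight B C - tight C B"
  define q where "q = tight A B + tight C B - tight A C - tight C A"
  define r where "r = tight A C + tight B C - tight A B - tight B A"
  define D where "D = p *\<^sub>R A + q *\<^sub>R B + r *\<^sub>R C"
  \<comment> \<open>If the pair from \<open>A\<close> to \<open>B\<close> is tight, the one from
    \<open>A\<close> to \<open>C\<close> is not, which gives \<open>q \<ge> 0\<close> and
    \<open>r \<le> 0\<close>. Both can vanish only if the pairs from \<open>B\<close> to
    \<open>C\<close> and from \<open>C\<close> to \<open>A\<close> are tight too, a directed cycle.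
    The other pairs behave likewise.\<close>
  have ex: "\<not> (X \<bullet> tangent A B = 0 \<and> X \<bullet> tangent A C = 0)"
    "\<not> (X \<bullet> tangent B C = 0 \<and> X \<bullet> tangent B A = 0)"
    "\<not> (X \<bullet> tangent C A = 0 \<and> X \<bullet> tangent C B = 0)"
    "\<not> (X \<bullet> tangent A B = 0 \<and> X \<bullet> tangent B A = 0)"
    "\<not> (X \<bullet> tangent B C = 0 \<and> X \<bullet> tangent C B = 0)"
    "\<not> (X \<bullet> tangent C A = 0 \<and> X \<bullet> tangent A C = 0)"
    "\<not> (X \<bullet> tangent A B = 0 \<and> X \<bullet> tangent B C = 0 \<and> X \<bullet> tangent C A = 0)"
    "\<not> (X \<bullet> tangent B A = 0 \<and> X \<bullet> tangent A C = 0 \<and> X \<bullet> tangent C B = 0)"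
    using tangent_tight_unique_source[OF tr pos(5)] tangent_tight_unique_source[OF BCA pos(6)]
      tangent_tight_unique_source[OF CAB pos(4)] tangent_tight_antisym[OF tr pos(1)]
      tangent_tight_antisym[OF BCA pos(2)] tangent_tight_antisym[OF CAB pos(3)]
      tangent_tight_acyclic[OF tr pos(1)] tangent_tight_acyclic[OF BAC pos(2)] by blast+
  have "D \<bullet> tangent A B > 0" if "X \<bullet> tangent A B = 0"
  proof -
    have "(p *\<^sub>R A + q *\<^sub>R B + r *\<^sub>R C) \<bullet> tangent A B > 0"
      by (rule tangent_tight_push[OF tr pos(5,6) that])
        (use that ex in \<open>auto simp: p_def q_def r_def tight_def of_bool_def split: if_splits\<close>)
    then show ?thesis by (simp add: D_def)
  qed
  moreover have "D \<bullet> tangent B A > 0" if "X \<bullet> tangent B A = 0"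
  proof -
    have "(q *\<^sub>R B + p *\<^sub>R A + r *\<^sub>R C) \<bullet> tangent B A > 0"
      by (rule tangent_tight_push[OF BAC pos(4,6) that])
        (use that ex in \<open>auto simp: p_def q_def r_def tight_def of_bool_def split: if_splits\<close>)
    then show ?thesis by (simp add: D_def add_ac)
  qed
  moreover have "D \<bullet> tangent A C > 0" if "X \<bullet> tangent A C = 0"
  proof -
    have "(p *\<^sub>R A + r *\<^sub>R C + q *\<^sub>R B) \<bullet> tangent A C > 0"
      by (rule tangent_tight_push[OF ACB pos(6,5) that])
        (use that ex in \<open>auto simp: p_def q_def r_def tight_def of_bool_def split: if_splits\<close>)
    then show ?thesis by (simp add: D_def add_ac)
  qed
  moreover have "D \<bullet> tangent C A > 0" if "X \<bullet> tangent C A = 0"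
  proof -
    have "(r *\<^sub>R C + p *\<^sub>R A + q *\<^sub>R B) \<bullet> tangent C A > 0"
      by (rule tangent_tight_push[OF CAB pos(4,5) that])
        (use that ex in \<open>auto simp: p_def q_def r_def tight_def of_bool_def split: if_splits\<close>)
    then show ?thesis by (simp add: D_def add_ac)
  qed
  moreover have "D \<bullet> tangent B C > 0" if "X \<bullet> tangent B C = 0"
  proof -
    have "(q *\<^sub>R B + r *\<^sub>R C + p *\<^sub>R A) \<bullet> tangent B C > 0"
      by (rule tangent_tight_push[OF BCA pos(6,4) that])
        (use that ex in \<open>auto simp: p_def q_def r_def tight_def of_bool_def split: if_splits\<close>)
    then show ?thesis by (simp add: D_def add_ac)
  qed
  moreover have "D \<bullet> tangent C B > 0" if "X \<bullet> tangent C B = 0"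
  proof -
    have "(r *\<^sub>R C + q *\<^sub>R B + p *\<^sub>R A) \<bullet> tangent C B > 0"
      by (rule tangent_tight_push[OF CBA pos(5,4) that])
        (use that ex in \<open>auto simp: p_def q_def r_def tight_def of_bool_def split: if_splits\<close>)
    then show ?thesis by (simp add: D_def add_ac)
  qed
  ultimately have
    "\<forall>\<^sub>F \<epsilon> in at_right 0. \<forall>g\<in>{A, B, C, a, b, c, tangent A B, tangent B A, tangent A C,
       tangent C A, tangent B C, tangent C B}. (X + \<epsilon> *\<^sub>R D) \<bullet> g > 0"
    by (intro eventually_ball_finite ballI eventually_perturb_pos)
      (use pos tan in \<open>auto simp: inner_commute[of X]\<close>)
  then obtain \<epsilon> where "\<forall>g\<in>{A, B, C, a, b, c, tangent A B, tangent B A, tangent A C,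
       tangent C A, tangent B C, tangent C B}. (X + \<epsilon> *\<^sub>R D) \<bullet> g > 0"
    using eventually_happens[of _ "at_right (0::real)"] by fastforce
  then show ?thesis by (intro that[of "X + \<epsilon> *\<^sub>R D"]) (auto simp: inner_commute[of _ "X + \<epsilon> *\<^sub>R D"])
qed

section \<open>Spherical conditions as linear inequalities\<close>

lemma sph_hull_inner_nonneg:
  assumes "\<And>s. s \<in> S \<Longrightarrow> a \<bullet> s \<ge> 0" "y \<in> sph_hull S"
  shows "a \<bullet> y \<ge> 0"
proof -
  have "convex hull S \<subseteq> {x. a \<bullet> x \<ge> 0}"
    by (rule hull_minimal) (use assms convex_halfspace_ge[of 0 a] in auto)
  then show ?thesis using assms(2) by (auto simp: sph_hull_def subset_iff)
qed

text \<open>From an interior point one can move slightly against \<open>a\<close> and return to the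
  sphere by rescaling without leaving \<open>H\<close>; the inequality there is strict progress at
  \<open>X\<close>.\<close>

lemma interior_of_sphere_inner_pos:
  fixes a :: "real^3"
  assumes X: "X \<in> top_of_set (sphere 0 1) interior_of H" and H: "\<And>y. y \<in> H \<Longrightarrow> a \<bullet> y \<ge> 0" and a: "a \<noteq> 0"
  shows "a \<bullet> X > 0"
proof -
  obtain T where T: "openin (top_of_set (sphere 0 1)) T" "X \<in> T" "T \<subseteq> H"
    using X unfolding interior_of_def by blast
  then obtain U where U: "open U" "T = sphere 0 1 \<inter> U" by (auto simp: openin_open)
  have nX: "norm X = 1" using T U by auto
  have l1: "((\<lambda>\<epsilon>. X - \<epsilon> *\<^sub>R a) \<longlongrightarrow> X - 0 *\<^sub>R a) (at_right 0)" by (intro tendsto_intros)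
  then have l1: "((\<lambda>\<epsilon>. X - \<epsilon> *\<^sub>R a) \<longlongrightarrow> X) (at_right 0)" by simp
  have l2: "((\<lambda>\<epsilon>. norm (X - \<epsilon> *\<^sub>R a)) \<longlongrightarrow> 1) (at_right 0)"
    using tendsto_norm[OF l1] nX by simp
  have "((\<lambda>\<epsilon>. inverse (norm (X - \<epsilon> *\<^sub>R a)) *\<^sub>R (X - \<epsilon> *\<^sub>R a)) \<longlongrightarrow> inverse 1 *\<^sub>R X) (at_right 0)"
    by (intro tendsto_scaleR tendsto_inverse l1 l2) simp
  then have "\<forall>\<^sub>F \<epsilon> in at_right 0. inverse (norm (X - \<epsilon> *\<^sub>R a)) *\<^sub>R (X - \<epsilon> *\<^sub>R a) \<in> U"
    using topological_tendstoD U T by fastforce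
  moreover have "\<forall>\<^sub>F \<epsilon> in at_right 0. norm (X - \<epsilon> *\<^sub>R a) > 0"
    using order_tendstoD(1)[OF l2, of 0] by simp
  ultimately have ev: "\<forall>\<^sub>F \<epsilon> in at_right 0. \<epsilon> > 0 \<and> norm (X - \<epsilon> *\<^sub>R a) > 0 \<and>
      inverse (norm (X - \<epsilon> *\<^sub>R a)) *\<^sub>R (X - \<epsilon> *\<^sub>R a) \<in> U"
    using eventually_at_right_less[of "0::real"] by eventually_elim blast
  obtain \<epsilon> where \<epsilon>: "\<epsilon> > 0" "norm (X - \<epsilon> *\<^sub>R a) > 0"
      "inverse (norm (X - \<epsilon> *\<^sub>R a)) *\<^sub>R (X - \<epsilon> *\<^sub>R a) \<in> U"
    using eventually_happens[OF ev] by auto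
  then have "inverse (norm (X - \<epsilon> *\<^sub>R a)) *\<^sub>R (X - \<epsilon> *\<^sub>R a) \<in> H" using T U by auto
  from H[OF this] have "a \<bullet> (X - \<epsilon> *\<^sub>R a) \<ge> 0" using \<epsilon> by (simp add: zero_le_mult_iff)
  moreover have "\<epsilon> * (a \<bullet> a) > 0" using \<epsilon> a by simp
  ultimately show ?thesis by (simp add: inner_diff_right)
qed

lemma sph_dist_less_pi_half:
  assumes "norm X = 1" "norm A = 1" "sph_dist X A < pi / 2"
  shows "X \<bullet> A > 0"
proof (rule ccontr)
  assume "\<not> X \<bullet> A > 0"
  moreover have "\<bar>X \<bullet> A\<bar> \<le> 1" using Cauchy_Schwarz_ineq2[of X A] assms by simp
  ultimately have "arccos 0 \<le> arccos (X \<bullet> A)" by (intro arccos_le_arccos) auto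
  then show False using assms(3) by (simp add: sph_dist_def arccos_0)
qed

text \<open>Orthogonality at the nearest point \<open>W\<close> gives
  \<open>X \<bullet> g = (g \<bullet> W) * (X \<bullet> W)\<close> for
  \<open>g = tangent A B\<close>. The first factor is non-negative because \<open>W\<close> lies
  between \<open>A\<close> and \<open>B\<close>, the second positive because \<open>W\<close> is at
  least as close as \<open>A\<close>. For \<open>W = A\<close> equality holds, so nothing strict can
  be expected.\<close>

lemma projects_to_tangent:
  assumes u: "norm A = 1" "norm B = 1" and XA: "X \<bullet> A > 0" and pr: "projects_to X (sph_hull {A, B})"
  shows "X \<bullet> tangent A B \<ge> 0"
proof -
  let ?s = "sph_hull {A, B}"
  obtain W where W: "W \<in> ?s" "\<And>t. t \<in> span ?s \<Longrightarrow> t \<bullet> W = 0 \<Longrightarrow> (X - (X \<bullet> W) *\<^sub>R W) \<bullet> t = 0"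
      "\<And>Z. Z \<in> ?s \<Longrightarrow> sph_dist X W \<le> sph_dist X Z"
    and sphere: "insert X ?s \<subseteq> sphere 0 1"
    using pr unfolding projects_to_def in_open_hemisphere_def by blast
  have nX: "norm X = 1" and nW: "norm W = 1" using sphere W by auto
  have mem: "S \<in> ?s" if "S \<in> {A, B}" for S
  proof -
    have hull: "S \<in> convex hull {A, B}" using that by (rule hull_inc)
    have unit: "S = inverse (norm S) *\<^sub>R S" using that u by auto
    show ?thesis unfolding sph_hull_def by (rule image_eqI) (rule unit, rule hull)
  qed
  have abs: "\<bar>X \<bullet> Z\<bar> \<le> 1" if "norm Z = 1" for Z
    using Cauchy_Schwarz_ineq2[of X Z] nX that by simp
  have "arccos (X \<bullet> W) \<le> arccos (X \<bullet> A)" using W(3) mem by (simp add: sph_dist_def)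
  then have "X \<bullet> A \<le> X \<bullet> W" using arccos_le_mono abs[OF nW] abs[OF u(1)] by blast
  then have XW: "X \<bullet> W > 0" using XA by simp
  define g where "g = tangent A B"
  define t where "t = g - (g \<bullet> W) *\<^sub>R W"
  have "g \<in> span ?s" unfolding g_def tangent_def
    by (intro span_diff span_scale span_base mem) auto
  then have "t \<in> span ?s" unfolding t_def
    using W(1) by (intro span_diff span_scale) (auto intro: span_base)
  moreover have tW: "t \<bullet> W = 0" using nW by (simp add: t_def inner_diff_left inner_unit)
  ultimately have "(X - (X \<bullet> W) *\<^sub>R W) \<bullet> t = 0" by (rule W(2))
  then have "X \<bullet> t = 0" using tW by (simp add: inner_diff_left inner_commute[of W])
  then have Xg: "X \<bullet> g = (g \<bullet> W) * (X \<bullet> W)" by (simp add: t_def inner_diff_right)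
  have "\<bar>A \<bullet> B\<bar> \<le> 1" using Cauchy_Schwarz_ineq2[of A B] u by simp
  then have "(A \<bullet> B)\<^sup>2 \<le> 1" by (simp add: abs_square_le_1)
  then have "g \<bullet> B \<ge> 0" using tangent_sq[OF u(2), of A] by (simp add: g_def inner_commute[of _ B])
  moreover have "g \<bullet> A = 0" using tangent_self[OF u(1), of B] by (simp add: g_def inner_commute[of _ A])
  ultimately have "g \<bullet> W \<ge> 0"
    by (intro sph_hull_inner_nonneg[OF _ W(1)]) auto
  then show ?thesis using Xg XW by (simp add: g_def)
qed

lemma dual_triple_exists:
  fixes A B C :: "real^3"
  assumes "is_sph_triangle A B C"
  obtains d where "dual_triple A B C (d A) (d B) (d C)"
    "\<And>S T. S \<in> {A, B, C} \<Longrightarrow> T \<in> {A, B, C} \<Longrightarrow> d S \<bullet> T = (if S = T then 1 else 0)"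
    "\<And>x. x = (\<Sum>S\<in>{A, B, C}. (d S \<bullet> x) *\<^sub>R S)"
proof -
  have u: "norm A = 1" "norm B = 1" "norm C = 1" and ne: "A \<noteq> B" "A \<noteq> C" "B \<noteq> C"
    and ind: "independent {A, B, C}"
    using assms by (auto simp: is_sph_triangle_def in_open_hemisphere_def)
  obtain d where d: "\<And>S T. S \<in> {A, B, C} \<Longrightarrow> T \<in> {A, B, C} \<Longrightarrow> d S \<bullet> T = (if S = T then 1 else 0)"
    using exists_dual_basis[OF ind] by blast
  have "dim {A, B, C} = DIM(real^3)"
    using dim_eq_card_independent[OF ind] ne by simp
  then have span: "span {A, B, C} = UNIV" using dim_eq_full by blast
  have ex: "x = (\<Sum>S\<in>{A, B, C}. (d S \<bullet> x) *\<^sub>R S)" for x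
    by (rule dual_basis_expand[OF _ span d]) auto
  have "(\<Sum>S\<in>{A, B, C}. (d S \<bullet> x) *\<^sub>R S) = (d A \<bullet> x) *\<^sub>R A + (d B \<bullet> x) *\<^sub>R B + (d C \<bullet> x) *\<^sub>R C" for x
    using ne by (simp add: add.assoc)
  then have "\<forall>x. x = (d A \<bullet> x) *\<^sub>R A + (d B \<bullet> x) *\<^sub>R B + (d C \<bullet> x) *\<^sub>R C" using ex by metis
  moreover have "d A \<bullet> A = 1" "d A \<bullet> B = 0" "d A \<bullet> C = 0" "d B \<bullet> A = 0" "d B \<bullet> B = 1" "d B \<bullet> C = 0"
    "d C \<bullet> A = 0" "d C \<bullet> B = 0" "d C \<bullet> C = 1"
    using ne d[of A A] d[of A B] d[of A C] d[of B A] d[of B B] d[of B C] d[of C A] d[of C B] d[of C C]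
    by simp_all
  ultimately have "dual_triple A B C (d A) (d B) (d C)"
    unfolding dual_triple_def using u by blast
  then show ?thesis using d ex by (rule that)
qed

section \<open>The polytope near a vertex\<close>

lemma sphere_section_near:
  assumes sec: "sphere_section P v (norm p) = sph_hull {A, B, C}"
    and p: "p = a *\<^sub>R A + b *\<^sub>R B + c *\<^sub>R C" "a \<ge> 0" "b \<ge> 0" "c \<ge> 0" "p \<noteq> 0"
  shows "v + p \<in> P"
proof -
  \<comment> \<open>Dividing by the total weight brings \<open>p\<close> into the convex hull; the
    radial projection in \<open>sph_hull\<close> does not see this factor.\<close>
  define s where "s = a + b + c"
  have "s \<noteq> 0"
  proof
    assume "s = 0"
    then have "a = 0" "b = 0" "c = 0" using p by (auto simp: s_def)
    then show False using p by simp
  qed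
  then have s: "s > 0" using p by (simp add: s_def)
  have "inverse s *\<^sub>R p = (a / s) *\<^sub>R A + (b / s) *\<^sub>R B + (c / s) *\<^sub>R C"
    unfolding p(1) by (simp add: scaleR_add_right divide_inverse mult.commute)
  moreover have "a / s + b / s + c / s = 1" using s by (simp add: s_def flip: add_divide_distrib)
  ultimately have "inverse s *\<^sub>R p \<in> convex hull {A, B, C}"
    unfolding convex_hull_3 using p s
    by (intro CollectI exI[of _ "a / s"] exI[of _ "b / s"] exI[of _ "c / s"]) auto
  then have hull: "inverse (norm (inverse s *\<^sub>R p)) *\<^sub>R (inverse s *\<^sub>R p) \<in> sph_hull {A, B, C}"
    unfolding sph_hull_def by (rule imageI)
  have "inverse (norm (inverse s *\<^sub>R p)) * inverse s = inverse (norm p)"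
    using s by simp
  then have "inverse (norm (inverse s *\<^sub>R p)) *\<^sub>R (inverse s *\<^sub>R p) = inverse (norm p) *\<^sub>R p"
    by (metis scaleR_scaleR)
  then have "inverse (norm p) *\<^sub>R p \<in> sphere_section P v (norm p)" using hull sec by metis
  then obtain x where "x \<in> P" "inverse (norm p) *\<^sub>R p = inverse (norm p) *\<^sub>R (x - v)"
    by (auto simp: sphere_section_def)
  then have "p = x - v" using p(5) by simp
  then show ?thesis using \<open>x \<in> P\<close> by simp
qed

text \<open>By convexity \<open>x\<close> can be pulled towards \<open>v\<close> onto a sphere of
  radius below \<open>\<rho>\<close> without changing the sign of \<open>a\<close>, so the local
  section controls all of \<open>P\<close>.\<close>

lemma sphere_section_cone:
  assumes P: "convex P" "v \<in> P" and \<rho>: "\<rho> > 0"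
    and sec: "\<And>\<epsilon>. 0 < \<epsilon> \<Longrightarrow> \<epsilon> < \<rho> \<Longrightarrow> sphere_section P v \<epsilon> = sph_hull S"
    and a: "\<And>s. s \<in> S \<Longrightarrow> a \<bullet> s \<ge> 0" and x: "x \<in> P"
  shows "a \<bullet> (x - v) \<ge> 0"
proof (cases "x = v")
  case False
  define N where "N = norm (x - v)"
  have N: "N > 0" using False by (simp add: N_def)
  define s where "s = min 1 (\<rho> / (2 * N))"
  have s: "0 < s" "s \<le> 1" using \<rho> N by (auto simp: s_def)
  have "s * N \<le> \<rho> / (2 * N) * N" using N by (intro mult_right_mono) (auto simp: s_def)
  then have "s * N < \<rho>" using N \<rho> by simp
  moreover have sN: "s * N > 0" using s N by simp
  ultimately have eq: "sphere_section P v (s * N) = sph_hull S" by (intro sec)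
  have "(1 - s) *\<^sub>R v + s *\<^sub>R x \<in> P" using P x s by (intro convexD) auto
  moreover have "(1 - s) *\<^sub>R v + s *\<^sub>R x = v + s *\<^sub>R (x - v)" by (simp add: algebra_simps)
  ultimately have "v + s *\<^sub>R (x - v) \<in> P \<inter> sphere v (s * N)"
    using s by (auto simp: dist_norm N_def)
  then have "inverse (s * N) *\<^sub>R (v + s *\<^sub>R (x - v) - v) \<in> sphere_section P v (s * N)"
    unfolding sphere_section_def by (rule imageI)
  then have "a \<bullet> (inverse (s * N) *\<^sub>R (v + s *\<^sub>R (x - v) - v)) \<ge> 0"
    using sph_hull_inner_nonneg[OF a] eq by metis
  moreover have "inverse (s * N) *\<^sub>R (v + s *\<^sub>R (x - v) - v) = inverse N *\<^sub>R (x - v)" using s by simp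
  ultimately have "inverse N * (a \<bullet> (x - v)) \<ge> 0" by (metis inner_scaleR_right)
  then show ?thesis using N by (simp add: zero_le_mult_iff)
qed simp

text \<open>After the perturbation all inequalities are strict and hold on a non-empty open set,
  which a negligible set cannot cover. \<open>N\<close> is meant for the directions that are not
  transverse.\<close>

lemma nice_triangle_direction:
  assumes nice: "nice_triangle A B C" and tr: "dual_triple A B C a b c" and neg: "negligible N"
  obtains X where "nice_direction {A, B, C} X" "X \<notin> N"
proof -
  have u: "norm A = 1" "norm B = 1" "norm C = 1" using tr by (auto simp: dual_triple_def)
  have ne: "A \<noteq> B" "A \<noteq> C" "B \<noteq> C" using nice by (auto simp: nice_triangle_def is_sph_triangle_def)
  obtain X where X: "X \<in> top_of_set (sphere 0 1) interior_of sph_hull {A, B, C}"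
    "projects_to X (sph_hull {A, B})" "projects_to X (sph_hull {B, C})" "projects_to X (sph_hull {C, A})"
    "sph_dist X A < pi/2" "sph_dist X B < pi/2" "sph_dist X C < pi/2"
    using nice by (auto simp: nice_triangle_def)
  have nX: "norm X = 1" using X(2) by (auto simp: projects_to_def in_open_hemisphere_def)
  note pos = sph_dist_less_pi_half[OF nX u(1) X(5)] sph_dist_less_pi_half[OF nX u(2) X(6)]
    sph_dist_less_pi_half[OF nX u(3) X(7)]
  have dual_pos: "g \<bullet> X > 0" if "g \<in> {a, b, c}" for g
  proof (rule interior_of_sphere_inner_pos[OF X(1)])
    show "g \<noteq> 0" using that tr by (auto simp: dual_triple_def)
    show "\<And>y. y \<in> sph_hull {A, B, C} \<Longrightarrow> 0 \<le> g \<bullet> y"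
      by (rule sph_hull_inner_nonneg[of "{A, B, C}"]) (use that tr in \<open>auto simp: dual_triple_def\<close>)
  qed
  have swap: "{B, A} = {A, B}" "{A, C} = {C, A}" "{C, B} = {B, C}" by auto
  have tan: "X \<bullet> tangent A B \<ge> 0" "X \<bullet> tangent B A \<ge> 0" "X \<bullet> tangent A C \<ge> 0"
    "X \<bullet> tangent C A \<ge> 0" "X \<bullet> tangent B C \<ge> 0" "X \<bullet> tangent C B \<ge> 0"
    using projects_to_tangent[OF u(1,2) pos(1) X(2)] projects_to_tangent[OF u(2,1) pos(2)]
      projects_to_tangent[OF u(1,3) pos(1)] projects_to_tangent[OF u(3,1) pos(3) X(4)]
      projects_to_tangent[OF u(2,3) pos(2) X(3)] projects_to_tangent[OF u(3,2) pos(3)] swap X(2-4)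
    by auto
  obtain Y where Y: "Y \<bullet> A > 0" "Y \<bullet> B > 0" "Y \<bullet> C > 0" "a \<bullet> Y > 0" "b \<bullet> Y > 0" "c \<bullet> Y > 0"
    "Y \<bullet> tangent A B > 0" "Y \<bullet> tangent B A > 0" "Y \<bullet> tangent A C > 0"
    "Y \<bullet> tangent C A > 0" "Y \<bullet> tangent B C > 0" "Y \<bullet> tangent C B > 0"
    using dual_triple_perturb[OF tr pos dual_pos[of a] dual_pos[of b] dual_pos[of c] tan] by auto
  define G where "G = {A, B, C, a, b, c, tangent A B, tangent B A, tangent A C,
    tangent C A, tangent B C, tangent C B}"
  define U where "U = (\<Inter>g\<in>G. {Y. g \<bullet> Y > 0})"
  have "open U" unfolding U_def by (intro open_INT ballI open_halfspace_gt) (simp add: G_def)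
  moreover have "Y \<in> U" using Y by (auto simp: U_def G_def inner_commute[of _ Y])
  ultimately have "\<not> negligible U" using open_not_negligible by blast
  then have "\<not> U \<subseteq> N" using neg negligible_subset by blast
  then obtain Z where Z: "Z \<in> U" "Z \<notin> N" by blast
  then have Zg: "Z \<bullet> g > 0" if "g \<in> G" for g using that by (auto simp: U_def inner_commute)
  have "nice_direction {A, B, C} Z"
    by (rule dual_triple_nice_direction[OF tr ne]) (use Zg in \<open>auto simp: G_def inner_commute[of _ Z]\<close>)
  then show ?thesis using that Z by blast
qed

theorem theorem4:
  fixes P :: "(real^3) set"
  assumes "generic_polytope P"
    and "\<exists>v. nice_vertex P v"
  shows "max_normals P \<ge> 10"
proof -
  have P: "polytope P" "interior P \<noteq> {}"
    using assms(1) by (auto simp: generic_polytope_def simple_polytope_def)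
  have cP: "convex P" using P polytope_imp_convex by auto
  obtain v A B C where v: "v extreme_point_of P" and nice: "nice_triangle A B C"
    and sec: "\<forall>\<^sub>F \<epsilon> in at_right 0. sphere_section P v \<epsilon> = sph_hull {A, B, C}"
    using assms(2) by (auto simp: nice_vertex_def)
  have vP: "v \<in> P" using v by (simp add: extreme_point_of_def)
  have tri: "is_sph_triangle A B C" using nice by (simp add: nice_triangle_def)
  have ne: "A \<noteq> B" "A \<noteq> C" "B \<noteq> C" using tri by (auto simp: is_sph_triangle_def)
  obtain d where tr: "dual_triple A B C (d A) (d B) (d C)"
    and dual: "\<And>S T. S \<in> {A, B, C} \<Longrightarrow> T \<in> {A, B, C} \<Longrightarrow> d S \<bullet> T = (if S = T then 1 else 0)"
    and expand: "\<And>x. x = (\<Sum>S\<in>{A, B, C}. (d S \<bullet> x) *\<^sub>R S)"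
    by (rule dual_triple_exists[OF tri]) (rule that)
  obtain \<rho> where \<rho>: "\<rho> > 0" "\<And>\<epsilon>. 0 < \<epsilon> \<Longrightarrow> \<epsilon> < \<rho> \<Longrightarrow> sphere_section P v \<epsilon> = sph_hull {A, B, C}"
    using sec unfolding eventually_at_right_field by auto
  \<comment> \<open>The spherical sections describe the cone at \<open>v\<close> directly, so the
    vertices of the triangle serve as \<open>Bs\<close> without a detour through the edges of
    \<open>P\<close>.\<close>
  interpret simplicial_vertex P v "{A, B, C}" d \<rho>
  proof
    show "polytope P" "interior P \<noteq> {}" "\<rho> > 0" by (fact P(1) P(2) \<rho>(1))+
    show "finite {A, B, C}" by simp
    show "d S \<bullet> T = (if S = T then 1 else 0)" if "S \<in> {A, B, C}" "T \<in> {A, B, C}" for S T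
      using that by (rule dual)
    show "x = (\<Sum>S\<in>{A, B, C}. (d S \<bullet> x) *\<^sub>R S)" for x by (rule expand)
  next
    fix x S assume x: "x \<in> P" and S: "S \<in> {A, B, C}"
    show "d S \<bullet> (x - v) \<ge> 0"
      by (rule sphere_section_cone[OF cP vP \<rho> _ x]) (use dual[OF S] in auto)
  next
    fix p assume p: "\<And>S. S \<in> {A, B, C} \<Longrightarrow> d S \<bullet> p \<ge> 0" and n: "norm p < \<rho>"
    show "v + p \<in> P"
    proof (cases "p = 0")
      case False
      have sec: "sphere_section P v (norm p) = sph_hull {A, B, C}"
        by (rule \<rho>(2)) (use False n in auto)
      have "p = (d A \<bullet> p) *\<^sub>R A + (d B \<bullet> p) *\<^sub>R B + (d C \<bullet> p) *\<^sub>R C"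
        using tr unfolding dual_triple_def by blast
      then show ?thesis
        using False p by (intro sphere_section_near[OF sec]) auto
    qed (use vP in simp)
  qed
  obtain X where X: "nice_direction {A, B, C} X" "X \<notin> {X. \<not> transverse_ray P v X}"
    using nice_triangle_direction[OF nice tr negligible_not_transverse[OF P(1)]] by metis
  obtain y \<F> where y: "finite \<F>" "P \<in> \<F>" "card \<F> = 2 ^ card {A, B, C} + 2"
    "\<And>F. F \<in> \<F> \<Longrightarrow> y \<in> open_cell P F"
  proof (rule extra_cell[OF _ X(1)])
    show "2 \<le> DIM(real^3)" by simp
    show "transverse_ray P v X" using X(2) by simp
  qed (rule that)
  \<comment> \<open>\<open>A\<close>, \<open>B\<close> and \<open>C\<close> are distinct, so the
    count is \<open>2 ^ 3 + 2\<close>.\<close>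
  have "card \<F> \<ge> 10" using y(3) ne by simp
  then show ?thesis using max_normals_ge_10[OF P y(1,2) _ y(4)] by blast
qed

end
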